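(* For each $m\ge 0$, the elements $r^{i}$, $0\le i\le 2m$, form a $\mathbb{Z}/2$-basis of $M_{4m}$. Consequently $M=\mathbb{Z}/2[r]$. Furthermore the elements $r^{2k}(r^{2}+r)$, $k\ge 0$, form a $\mathbb{Z}/2$-basis of $M(\mathrm{odd})$.
   Context: For even $k\ge 0$, $M_{k}$ is the set of $f\in\mathbb{Z}/2[[x]]$ for which there is a (holomorphic) modular form of weight $k$ for $\Gamma_{0}(5)$ whose expansion at infinity (in $x=e^{2\pi i z}$) lies in $\mathbb{Z}[[x]]$ and reduces mod $2$ to $f$. One has $M_{0}\subset M_{4}\subset M_{8}\subset\cdots$; $M=\bigcup_{m}M_{4m}$, and $M(\mathrm{odd})=M\cap x\,\mathbb{Z}/2[[x^{2}]]$. Let $r=\sum_{n>0}(x^{n^{2}}+x^{2n^{2}}+x^{5n^{2}}+x^{10n^{2}})\in\mathbb{Z}/2[[x]]$. *)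

theory Defs
  imports "HOL-Analysis.Analysis" "HOL-Library.Z2" "HOL-Computational_Algebra.Formal_Power_Series"
begin

definition uhp :: "complex set" where
  "uhp = {z. Im z > 0}"

definition moeb :: "int \<Rightarrow> int \<Rightarrow> int \<Rightarrow> int \<Rightarrow> complex \<Rightarrow> complex" where
  "moeb a b c d z = (of_int a * z + of_int b) / (of_int c * z + of_int d)"

text \<open>Holomorphic modular forms of weight k for Gamma_0(5):
  holomorphic on the upper half plane, weight-k invariance under Gamma_0(5),
  and holomorphic at all cusps (every slash-transform by SL2(Z) is bounded
  as Im z tends to infinity).\<close>
definition modform_G05 :: "nat \<Rightarrow> (complex \<Rightarrow> complex) \<Rightarrow> bool" where
  "modform_G05 k f \<longleftrightarrow>
     f holomorphic_on uhp \<and>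
     (\<forall>a b c d. a * d - b * c = 1 \<and> 5 dvd c \<longrightarrow>
        (\<forall>z\<in>uhp. f (moeb a b c d z) = (of_int c * z + of_int d) ^ k * f z)) \<and>
     (\<forall>a b c d. a * d - b * c = 1 \<longrightarrow>
        (\<exists>Y B. \<forall>z. Im z > Y \<longrightarrow>
           norm (f (moeb a b c d z) / (of_int c * z + of_int d) ^ k) \<le> B))"

text \<open>M_k: reductions mod 2 of integral expansions at infinity (in x = e^{2 pi i z})
  of modular forms of weight k for Gamma_0(5).  Reduction mod 2 is of_int into bit.\<close>
definition Mk :: "nat \<Rightarrow> bit fps set" where
  "Mk k = {Abs_fps (\<lambda>n. of_int (a n)) | a f. modform_G05 k f \<and>
            (\<forall>z\<in>uhp. (\<lambda>n. of_int (a n) * exp (2 * of_real pi * \<i> * of_nat n * z)) sums f z)}"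

definition M :: "bit fps set" where
  "M = (\<Union>m. Mk (4 * m))"

definition M_odd :: "bit fps set" where
  "M_odd = {F \<in> M. \<forall>n. even n \<longrightarrow> fps_nth F n = 0}"

text \<open>r = sum_{n>0} (x^{n^2} + x^{2n^2} + x^{5n^2} + x^{10n^2}) in Z/2[[x]]:
  the coefficient of x^j is the number of pairs (t,n), t in {1,2,5,10}, n>0, with j = t n^2, mod 2.\<close>
definition r :: "bit fps" where
  "r = Abs_fps (\<lambda>j. of_nat (card {(t, n::nat). t \<in> {1, 2, 5, 10::nat} \<and> n > 0 \<and> j = t * n\<^sup>2}))"

end

theory Submission
  imports Defs "HOL-Complex_Analysis.Complex_Analysis"
begin

text \<open>
  Let \<open>a = 1 - 5 \<Sum> \<chi>(k) k q\<^sup>m\<^sup>k\<close> and \<open>c = \<Sum> \<chi>(m) k q\<^sup>m\<^sup>k\<close>, where \<open>\<chi>\<close> is the quadratic character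
  mod \<open>5\<close>.  Up to constants they are differences of values of the Weierstrass function at
  \<open>5\<close>-division points, hence forms of weight two with character \<open>\<chi>\<close> on \<open>\<Gamma>\<^sub>0(5)\<close>, exchanged by
  \<open>z \<mapsto> -1 / (5 z)\<close>.  Counting divisors mod \<open>2\<close> gives \<open>c = r\<close> and \<open>a = 1 + r\<close>, so the forms
  \<open>c\<^sup>i (a + c)\<^sup>2\<^sup>m\<^sup>-\<^sup>i = q\<^sup>i + \<dots>\<close> of weight \<open>4 m\<close> reduce to \<open>r\<^sup>i\<close>.  They span all integral forms once a
  form vanishing at infinity to order greater than \<open>2 m\<close> is known to be zero, and that follows from
  the maximum principle applied to its quotient by \<open>c\<^sup>2\<^sup>m\<close>, provided that \<open>c\<close> has no zeros.

  The absence of zeros is a bootstrap.  Hecke's estimate for the maximum of \<open>\<bar>f\<bar> y\<^sup>k\<^sup>/\<^sup>2\<close>, applied to the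
  product of \<open>f\<close> over the cosets of \<open>\<Gamma>\<^sub>0(5)\<close>, bounds the order at infinity with a slightly too
  large constant; in weight eight this still shows that \<open>3 c'\<^sup>2 - 2 c c''\<close> is \<open>c\<^sup>2\<close> times a holomorphic
  form, which is impossible at a zero of \<open>c\<close>.
\<close>

section \<open>Vanishing of forms of level one\<close>

text \<open>The span argument needs the sharp count in every weight \<open>4 * m\<close>: a nonzero
  form of weight \<open>2 * j\<close> has order at most j at infinity. Comparing maxima cannot give
  it. For level one and weight 2L it uses that the maximum lies at height at least
  \<open>sqrt 3 / 2\<close>, which at best treats L < pi sqrt(3) n, about 5.44 n, where the truth is
  L < 6 n. With the rounded constant 5 and six cosets the criterion is
  \<open>6 * j \<le> 5 * n\<close>; for n = j + 1 it holds exactly when j \<le> 5. So a form of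
  small weight has to certify that c has no zeros, after which division by a power of c brings every
  weight down to zero, where order one is enough. The bracket suits this purpose: j = 4 is in range,
  and at a zero of c of order k its leading coefficient is 3 k^2 - 2 k (k - 1) = k (k + 2) times a
  nonzero square, at order 2 k - 2, whereas a holomorphic multiple of c^2 vanishes to order at least
  2 k.\<close>

lemma uhp_iff [simp]: "z \<in> uhp \<longleftrightarrow> Im z > 0"
  by (simp add: uhp_def)

lemma Im_minus_inverse: "Im (-1 / z) = Im z / (norm z)\<^sup>2"
  by (cases "z = 0") (auto simp: Im_divide cmod_power2 field_simps)

lemma Im_minus_inverse_pos: "Im z > 0 \<Longrightarrow> Im (-1 / z) > 0"
  unfolding Im_minus_inverse by (cases "z = 0") auto

lemma periodic_int:
  fixes \<phi> :: "complex \<Rightarrow> real"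
  assumes "\<And>z. Im z > y \<Longrightarrow> \<phi> (z + 1) = \<phi> z"
  shows "Im z > y \<Longrightarrow> \<phi> (z + of_int n) = \<phi> z"
proof (induction n)
  case (nonneg n)
  then show ?case
  proof (induction n)
    case (Suc n)
    then show ?case using assms[of "z + of_nat n"] by (simp add: add.assoc add.commute[of 1])
  qed simp
next
  case (neg n)
  then show ?case
  proof (induction n)
    case 0
    then show ?case using assms[of "z - 1"] by simp
  next
    case (Suc n)
    then show ?case using assms[of "z - 2 - of_nat n"] by (simp add: algebra_simps)
  qed
qed

lemma translate_to_strip:
  fixes \<phi> :: "complex \<Rightarrow> real"
  assumes "\<And>z. Im z > y \<Longrightarrow> \<phi> (z + 1) = \<phi> z" and "Im z > y"
  obtains z' where "\<bar>Re z'\<bar> \<le> 1/2" "Im z' = Im z" "\<phi> z' = \<phi> z"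
proof
  have "\<bar>of_int (round (Re z)) - Re z\<bar> \<le> 1/2"
    by (rule of_int_round_abs_le)
  then show "\<bar>Re (z + of_int (- round (Re z)))\<bar> \<le> 1/2"
    by (simp add: abs_minus_commute)
  show "\<phi> (z + of_int (- round (Re z))) = \<phi> z"
    using periodic_int[of y \<phi> z] assms by blast
qed simp

text \<open>Replacing the sharp height \<open>sqrt 3 / 2\<close> by something smaller makes every inversion
  raise the imaginary part by a definite factor, so that the reduction terminates.\<close>
lemma reduce_to_strip:
  fixes \<phi> :: "complex \<Rightarrow> real"
  assumes per: "\<And>z. Im z > 0 \<Longrightarrow> \<phi> (z + 1) = \<phi> z"
    and inv: "\<And>z. Im z > 0 \<Longrightarrow> \<phi> (-1 / z) = \<phi> z"
    and "Im w > 0"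
  obtains z where "\<bar>Re z\<bar> \<le> 1/2" "Im z \<ge> 43/50" "\<phi> z = \<phi> w"
proof -
  \<comment> \<open>k bounds the number of inversions: in the strip below height 43/50 one has |z|^2
    \<le> 1/4 + (43/50)^2 = 0.9896, so an inversion multiplies the height by at least
    100/99.\<close>
  have step: "\<exists>z. \<bar>Re z\<bar> \<le> 1/2 \<and> Im z \<ge> 43/50 \<and> \<phi> z = \<phi> w"
    if "Im w > 0" "Im w \<ge> (99/100)^k" for w k
    using that
  proof (induction k arbitrary: w)
    case 0
    from translate_to_strip[of 0 \<phi> w] per 0 obtain z where "\<bar>Re z\<bar> \<le> 1/2" "Im z = Im w" "\<phi> z = \<phi> w"
      by blast
    with 0 show ?case by (intro exI[of _ z]) auto
  next
    case (Suc k)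
    from translate_to_strip[of 0 \<phi> w] per Suc.prems obtain z
      where z: "\<bar>Re z\<bar> \<le> 1/2" "Im z = Im w" "\<phi> z = \<phi> w"
      by blast
    show ?case
    proof (cases "Im z \<ge> 43/50")
      case True
      with z show ?thesis by blast
    next
      case False
      have pos: "Im z > 0" using z Suc by simp
      have "(Re z)\<^sup>2 \<le> (1/2)\<^sup>2" "(Im z)\<^sup>2 \<le> (43/50)\<^sup>2"
        using z False pos by (auto simp: abs_le_square_iff[symmetric] intro!: power_mono)
      then have n: "(norm z)\<^sup>2 \<le> 99/100"
        unfolding cmod_power2 by (simp add: power2_eq_square)
      have "norm z > 0" using pos by auto
      then have np: "(norm z)\<^sup>2 > 0" by simp
      have "(99/100)^k * (norm z)\<^sup>2 \<le> (99/100)^k * (99/100)"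
        using n by (intro mult_left_mono) auto
      also have "\<dots> \<le> Im z" using Suc z by simp
      finally have "Im (-1/z) \<ge> (99/100)^k"
        unfolding Im_minus_inverse using np by (simp add: field_simps)
      then obtain z' where "\<bar>Re z'\<bar> \<le> 1/2" "Im z' \<ge> 43/50" "\<phi> z' = \<phi> (-1/z)"
        using Suc.IH[of "-1/z"] Im_minus_inverse_pos[OF pos] by blast
      with inv[OF pos] z show ?thesis by (intro exI[of _ z']) auto
    qed
  qed
  obtain k where "(99/100::real)^k < Im w"
    using real_arch_pow_inv[of "Im w" "99/100"] assms(3) by auto
  with step[of w k] assms(3) that show ?thesis by force
qed

text \<open>Reduction moves every point into the strip, and \<open>small\<close> keeps large heights
  below the value at w, so the supremum is that over a compact rectangle. It serves both a function
  invariant under inversion and one that is merely periodic.\<close>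

lemma attains_max_on_halfplane:
  fixes \<psi> :: "complex \<Rightarrow> real"
  assumes cont: "continuous_on {z. Im z \<ge> y} \<psi>"
    and red: "\<And>w. Im w \<ge> y \<Longrightarrow> \<exists>z. \<bar>Re z\<bar> \<le> 1/2 \<and> Im z \<ge> y \<and> \<psi> z = \<psi> w"
    and w: "Im w \<ge> y" and small: "\<And>z. Im z > Y \<Longrightarrow> \<psi> z < \<psi> w"
  obtains z where "\<bar>Re z\<bar> \<le> 1/2" "Im z \<ge> y" "\<And>z'. Im z' \<ge> y \<Longrightarrow> \<psi> z' \<le> \<psi> z"
proof -
  define K where "K = cbox (Complex (-1/2) y) (Complex (1/2) Y)"
  have K: "z \<in> K \<longleftrightarrow> \<bar>Re z\<bar> \<le> 1/2 \<and> y \<le> Im z \<and> Im z \<le> Y" for z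
    unfolding K_def in_cbox_complex_iff by auto
  obtain w' where w': "\<bar>Re w'\<bar> \<le> 1/2" "Im w' \<ge> y" "\<psi> w' = \<psi> w" using red[OF w] by blast
  with small[of w'] have "w' \<in> K" unfolding K by force
  then have ne: "K \<noteq> {}" by auto
  have "compact K" by (simp add: K_def compact_cbox)
  moreover have "continuous_on K \<psi>" using cont by (rule continuous_on_subset) (auto simp: K)
  ultimately obtain z where z: "z \<in> K" "\<And>v. v \<in> K \<Longrightarrow> \<psi> v \<le> \<psi> z"
    using continuous_attains_sup[of K \<psi>] ne by blast
  have "\<psi> v \<le> \<psi> z" if v: "Im v \<ge> y" for v
  proof -
    obtain v' where v': "\<bar>Re v'\<bar> \<le> 1/2" "Im v' \<ge> y" "\<psi> v' = \<psi> v" using red[OF v] by blast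
    show ?thesis
    proof (cases "Im v' \<le> Y")
      case True
      with v' z(2)[of v'] show ?thesis by (auto simp: K)
    next
      case False
      then have "\<psi> v' < \<psi> w" using small by simp
      with v' w' z(2)[OF \<open>w' \<in> K\<close>] show ?thesis by simp
    qed
  qed
  with z that[of z] show ?thesis by (auto simp: K)
qed

lemma power_times_exp_small:
  fixes C a e :: real
  assumes "a > 0" "e > 0"
  obtains Y where "\<And>y. y > Y \<Longrightarrow> C * exp (- a * y) * y ^ L < e"
proof -
  have "((\<lambda>y. C * ((a*y) ^ L / exp (a*y))) \<longlongrightarrow> C * 0) at_top"
    by (intro tendsto_intros filterlim_compose[OF tendsto_power_div_exp_0]
        filterlim_tendsto_pos_mult_at_top[OF tendsto_const assms(1)] filterlim_ident)
  then have "\<forall>\<^sub>F y in at_top. C * ((a*y) ^ L / exp (a*y)) < e * a ^ L"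
    using assms by (intro order_tendstoD(2)) auto
  then obtain Y where Y: "\<And>y. y \<ge> Y \<Longrightarrow> C * ((a*y) ^ L / exp (a*y)) < e * a ^ L"
    unfolding eventually_at_top_linorder by blast
  have "C * exp (- a * y) * y ^ L < e" if "y > Y" for y
  proof -
    have "(C * exp (- a * y) * y ^ L) * a ^ L < e * a ^ L"
      using Y[of y] that by (simp add: exp_minus power_mult_distrib field_simps)
    then show ?thesis using assms by simp
  qed
  with that show ?thesis by blast
qed

text \<open>Compare the maximum of the invariant function \<open>\<bar>F z\<bar> (Im z)\<^sup>L\<close>, attained at height
  \<open>y0\<close>, with \<open>F z / q\<^sup>n\<close> at a slightly smaller height.  The exponent \<open>n\<close> is
  lowered by a factor so that \<open>F z / q\<^sup>\<nu>\<close> tends to zero at the cusp.\<close>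
lemma level_one_vanishing:
  fixes F :: "complex \<Rightarrow> complex"
  assumes hol: "F holomorphic_on uhp"
    and per: "\<And>z. Im z > 0 \<Longrightarrow> norm (F (z + 1)) = norm (F z)"
    and inv: "\<And>z. Im z > 0 \<Longrightarrow> norm (F (-1 / z)) = norm z ^ (2 * L) * norm (F z)"
    and dec: "\<And>z. Im z > Y \<Longrightarrow> norm (F z) \<le> C * exp (- (2 * pi * real n) * Im z)"
    and n: "n \<ge> 1" "L \<le> 5 * n" and w: "Im w > 0"
  shows "F w = 0"
proof (rule ccontr)
  assume "F w \<noteq> 0"
  define \<phi> where "\<phi> = (\<lambda>z. norm (F z) * Im z ^ L)"
  have w0: "\<phi> w > 0" using \<open>F w \<noteq> 0\<close> w by (simp add: \<phi>_def)
  have \<phi>per: "\<phi> (z + 1) = \<phi> z" if "Im z > 0" for z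
    using per[OF that] by (simp add: \<phi>_def)
  have \<phi>inv: "\<phi> (-1 / z) = \<phi> z" if "Im z > 0" for z
  proof -
    have "z \<noteq> 0" using that by auto
    then show ?thesis
      unfolding \<phi>_def Im_minus_inverse inv[OF that]
      by (simp add: power_divide power_mult)
  qed
  have contF: "continuous_on {z. Im z \<ge> y} F" if "y > 0" for y
    using holomorphic_on_imp_continuous_on[OF hol]
    by (rule continuous_on_subset) (use that in auto)
  obtain w1 where w1: "\<bar>Re w1\<bar> \<le> 1/2" "Im w1 \<ge> 43/50" "\<phi> w1 = \<phi> w"
    using reduce_to_strip[of \<phi> w] \<phi>per \<phi>inv w by blast
  have "2 * pi * real n > 0" using n by simp
  then obtain Y1 where Y1: "\<And>y. y > Y1 \<Longrightarrow> C * exp (- (2 * pi * real n) * y) * y ^ L < \<phi> w1"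
    using power_times_exp_small[of "2 * pi * real n" "\<phi> w1" C L] w0 w1 by auto
  have small: "\<phi> z < \<phi> w1" if "Im z > max 0 (max Y Y1)" for z
  proof -
    have "\<phi> z \<le> C * exp (- (2 * pi * real n) * Im z) * Im z ^ L"
      unfolding \<phi>_def using dec[of z] that by (intro mult_right_mono) auto
    also have "\<dots> < \<phi> w1" using Y1[of "Im z"] that by simp
    finally show ?thesis .
  qed
  obtain z0 where z0: "Im z0 \<ge> 43/50" and z0max: "\<And>z. Im z \<ge> 43/50 \<Longrightarrow> \<phi> z \<le> \<phi> z0"
  proof (rule attains_max_on_halfplane[of "43/50" \<phi> w1 "max 0 (max Y Y1)"])
    show "continuous_on {z. 43 / 50 \<le> Im z} \<phi>"
      unfolding \<phi>_def by (intro continuous_intros contF) auto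
    show "\<exists>z. \<bar>Re z\<bar> \<le> 1/2 \<and> Im z \<ge> 43/50 \<and> \<phi> z = \<phi> v" if "43/50 \<le> Im v" for v
      using reduce_to_strip[of \<phi> v] \<phi>per \<phi>inv that by (metis less_le_trans zero_less_divide_iff zero_less_numeral)
  qed (use w1 small in auto)
  have glob: "\<phi> z \<le> \<phi> z0" if "Im z > 0" for z
    using reduce_to_strip[of \<phi> z] \<phi>per \<phi>inv that z0max by metis
  define y0 where "y0 = Im z0"
  \<comment> \<open>Any small enough drop would do; 43/50 - 1/100 = 85/100 leaves room in the
    closing numerical comparison.\<close>
  define y1 where "y1 = y0 - 1/100"
  define \<nu> where "\<nu> = 999/1000 * real n"
  \<comment> \<open>\<open>\<nu>\<close> need not be an integer, so H itself need not have period 1.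
    Its norm has, and that is all the maximum argument uses.\<close>
  define H where "H = (\<lambda>z. F z * exp (- (2 * of_real pi * \<i> * of_real \<nu>) * z))"
  have normH: "norm (H z) = norm (F z) * exp (2 * pi * \<nu> * Im z)" for z
    by (simp add: H_def norm_mult)
  have y: "y1 \<ge> 85/100" "y0 > 0" using z0 by (auto simp: y0_def y1_def)
  have "\<phi> z0 > 0" using glob[OF w] w0 by simp
  then have F0: "norm (F z0) > 0" unfolding \<phi>_def using y by (auto simp: y0_def)
  then have H0: "norm (H z0) > 0" unfolding normH by simp
  have "2 * pi * (real n - \<nu>) > 0" using n by (simp add: \<nu>_def)
  then obtain Y2 where Y2: "\<And>y. y > Y2 \<Longrightarrow> C * exp (- (2 * pi * (real n - \<nu>)) * y) * y ^ 0 < norm (H z0)"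
    using power_times_exp_small[of "2 * pi * (real n - \<nu>)" "norm (H z0)" C 0] H0 by auto
  have smallH: "norm (H z) < norm (H z0)" if "Im z > max 0 (max Y Y2)" for z
  proof -
    have "norm (H z) \<le> C * exp (- (2 * pi * real n) * Im z) * exp (2 * pi * \<nu> * Im z)"
      unfolding normH using dec[of z] that by (intro mult_right_mono) auto
    also have "\<dots> = C * exp (- (2 * pi * (real n - \<nu>)) * Im z)"
      by (simp add: mult_exp_exp algebra_simps)
    also have "\<dots> < norm (H z0)" using Y2[of "Im z"] that by simp
    finally show ?thesis .
  qed
  have Hper: "norm (H (z + 1)) = norm (H z)" if "Im z > 0" for z
    unfolding normH using per[OF that] by simp
  obtain z1 where z1: "Im z1 \<ge> y1" and z1max: "\<And>z. Im z \<ge> y1 \<Longrightarrow> norm (H z) \<le> norm (H z1)"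
  proof (rule attains_max_on_halfplane[of y1 "\<lambda>z. norm (H z)" z0 "max 0 (max Y Y2)"])
    show "continuous_on {z. y1 \<le> Im z} (\<lambda>z. norm (H z))"
      unfolding H_def using y by (intro continuous_intros contF) auto
    show "\<exists>z. \<bar>Re z\<bar> \<le> 1/2 \<and> Im z \<ge> y1 \<and> norm (H z) = norm (H v)" if "y1 \<le> Im v" for v
      using translate_to_strip[of 0 "\<lambda>z. norm (H z)" v] Hper that y
      by (metis less_le_trans zero_less_divide_iff zero_less_numeral)
  qed (use smallH in \<open>auto simp: y1_def y0_def\<close>)
  have "norm (H z0) \<le> norm (H z1)" by (rule z1max) (simp add: y1_def y0_def)
  \<comment> \<open>An interior maximum would make H constant, against its smaller values high
    up.\<close>
  have "Im z1 = y1"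
  proof (rule ccontr)
    assume "Im z1 \<noteq> y1"
    with z1 have "Im z1 > y1" by simp
    have op: "open {z. y1 < Im z}" by (simp add: open_halfspace_Im_gt)
    have "H constant_on {z. y1 < Im z}"
    proof (rule maximum_modulus_principle[OF _ op _ op])
      show "H holomorphic_on {z. y1 < Im z}"
        unfolding H_def by (intro holomorphic_intros holomorphic_on_subset[OF hol]) (use y in auto)
      show "connected {z. y1 < Im z}"
        by (intro convex_connected convex_halfspace_Im_gt)
    qed (use \<open>Im z1 > y1\<close> z1max in auto)
    moreover define v where "v = Complex 0 (max y1 (max 0 (max Y Y2)) + 1)"
    ultimately have "H v = H z1" using \<open>Im z1 > y1\<close> unfolding constant_on_def by (auto simp: v_def)
    moreover have "norm (H v) < norm (H z0)" by (rule smallH) (auto simp: v_def)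
    ultimately show False using \<open>norm (H z0) \<le> norm (H z1)\<close> by simp
  qed
  have A: "norm (F z0) * exp (2 * pi * \<nu> * y0) \<le> norm (F z1) * exp (2 * pi * \<nu> * y1)"
    using \<open>norm (H z0) \<le> norm (H z1)\<close> unfolding normH \<open>Im z1 = y1\<close> y0_def .
  have B: "norm (F z1) * y1 ^ L \<le> norm (F z0) * y0 ^ L"
    using glob[of z1] y \<open>Im z1 = y1\<close> unfolding \<phi>_def y0_def by simp
  \<comment> \<open>Chaining A and B eliminates the unknown size of F at z1; cancelling F z0 then
    leaves an inequality between heights only.\<close>
  have "norm (F z0) * exp (2 * pi * \<nu> * y0) * y1 ^ L \<le> norm (F z1) * exp (2 * pi * \<nu> * y1) * y1 ^ L"
    using y by (intro mult_right_mono A) auto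
  also have "\<dots> = (norm (F z1) * y1 ^ L) * exp (2 * pi * \<nu> * y1)" by simp
  also have "\<dots> \<le> (norm (F z0) * y0 ^ L) * exp (2 * pi * \<nu> * y1)"
    by (intro mult_right_mono B) auto
  finally have "exp (2 * pi * \<nu> * y0) * y1 ^ L \<le> y0 ^ L * exp (2 * pi * \<nu> * y1)"
    using F0 by (simp add: mult.assoc mult.left_commute[of "norm (F z0)"])
  then have "exp (2 * pi * \<nu> * y0) / exp (2 * pi * \<nu> * y1) \<le> (y0 / y1) ^ L"
    using y by (simp add: power_divide field_simps)
  also have "y0 / y1 = 1 + (1/100) / y1" using y by (simp add: y1_def field_simps)
  also have "(1 + (1/100) / y1) ^ L \<le> exp ((1/100) / y1) ^ L"
    using y by (intro power_mono exp_ge_add_one_self) auto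
  also have "\<dots> = exp (real L * ((1/100) / y1))" by (simp only: exp_of_nat_mult)
  also have "exp (2 * pi * \<nu> * y0) / exp (2 * pi * \<nu> * y1) = exp (2 * pi * \<nu> * (1/100))"
    by (simp add: exp_diff[symmetric] y1_def algebra_simps)
  finally have "2 * pi * \<nu> * (1/100) \<le> real L * ((1/100) / y1)" by simp
  \<comment> \<open>5 / 0.85 < 5.89 while 6 * 0.999 = 5.994, so the bound pi > 3 already yields the
    contradiction.\<close>
  also have "\<dots> \<le> (5 * real n) * ((1/100) / (85/100))"
    using n y by (intro mult_mono divide_left_mono) auto
  finally have "2 * pi * \<nu> \<le> 5 * real n / (85/100)" by simp
  moreover have "2 * 3 * \<nu> \<le> 2 * pi * \<nu>"
    using pi_gt3 by (intro mult_right_mono) (auto simp: \<nu>_def)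
  ultimately show False using n by (simp add: \<nu>_def)
qed

section \<open>Forms with quadratic character on \<open>\<Gamma>\<^sub>0(5)\<close>\<close>

definition chi5 :: "int \<Rightarrow> int" where
  "chi5 n = (if n mod 5 \<in> {1, 4} then 1 else if n mod 5 \<in> {2, 3} then -1 else 0)"

text \<open>Weight \<open>2 * j\<close> goes with the character \<open>chi5 ^ j\<close>, so that
  products add the indices. Growth is restricted at infinity and at 0, which represent the two cusps
  of \<open>\<Gamma>\<^sub>0(5)\<close>.\<close>

definition char_form :: "nat \<Rightarrow> (complex \<Rightarrow> complex) \<Rightarrow> bool" where
  "char_form j f \<longleftrightarrow>
     f holomorphic_on uhp \<and>
     (\<forall>a b c d z. a * d - b * c = 1 \<and> 5 dvd c \<and> Im z > 0 \<longrightarrow>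
        f (moeb a b c d z) = of_int (chi5 d) ^ j * (of_int c * z + of_int d) ^ (2 * j) * f z) \<and>
     (\<exists>Y B. \<forall>z. Im z > Y \<longrightarrow> norm (f z) \<le> B) \<and>
     (\<exists>Y B. \<forall>z. Im z > Y \<longrightarrow> norm (f (-1 / z)) \<le> B * norm z ^ (2 * j))"

lemma char_formI:
  assumes "f holomorphic_on uhp"
    and "\<And>a b c d z. a * d - b * c = 1 \<Longrightarrow> 5 dvd c \<Longrightarrow> Im z > 0 \<Longrightarrow>
        f (moeb a b c d z) = of_int (chi5 d) ^ j * (of_int c * z + of_int d) ^ (2 * j) * f z"
    and "\<And>z. Im z > Y \<Longrightarrow> norm (f z) \<le> B"
    and "\<And>z. Im z > Y' \<Longrightarrow> norm (f (-1 / z)) \<le> B' * norm z ^ (2 * j)"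
  shows "char_form j f"
  using assms unfolding char_form_def by blast

lemma char_form_holo: "char_form j f \<Longrightarrow> f holomorphic_on uhp"
  by (simp add: char_form_def)

lemma char_form_trans:
  "char_form j f \<Longrightarrow> a * d - b * c = 1 \<Longrightarrow> 5 dvd c \<Longrightarrow> Im z > 0 \<Longrightarrow>
     f (moeb a b c d z) = of_int (chi5 d) ^ j * (of_int c * z + of_int d) ^ (2 * j) * f z"
  by (simp add: char_form_def)

lemma char_form_bdd:
  assumes "char_form j f"
  obtains Y B where "Y > 0" "B > 0" "\<And>z. Im z > Y \<Longrightarrow> norm (f z) \<le> B"
    "\<And>z. Im z > Y \<Longrightarrow> norm (f (-1 / z)) \<le> B * norm z ^ (2 * j)"
proof -
  from assms obtain Y B Y' B' where *: "\<And>z. Im z > Y \<Longrightarrow> norm (f z) \<le> B"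
    "\<And>z. Im z > Y' \<Longrightarrow> norm (f (-1 / z)) \<le> B' * norm z ^ (2 * j)"
    unfolding char_form_def by blast
  have "norm (f (-1 / z)) \<le> max 1 (max B B') * norm z ^ (2 * j)" if "Im z > max 1 (max Y Y')" for z
  proof -
    have "norm (f (-1 / z)) \<le> B' * norm z ^ (2 * j)" using * that by simp
    also have "\<dots> \<le> max 1 (max B B') * norm z ^ (2 * j)" by (intro mult_right_mono) auto
    finally show ?thesis .
  qed
  moreover have "norm (f z) \<le> max 1 (max B B')" if "Im z > max 1 (max Y Y')" for z
    using *(1)[of z] that by simp
  ultimately show ?thesis using that[of "max 1 (max Y Y')" "max 1 (max B B')"] by simp
qed

lemma chi5_unit:
  assumes "a * d - b * c = 1" "5 dvd c"
  shows "chi5 d = 1 \<or> chi5 d = -1"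
proof -
  have "\<not> 5 dvd d"
  proof
    assume "5 dvd d"
    then have "5 dvd a * d - b * c" using assms(2) by simp
    with assms(1) show False by simp
  qed
  then have "d mod 5 \<noteq> 0" by presburger
  moreover have "0 \<le> d mod 5" "d mod 5 < 5" by auto
  ultimately have "d mod 5 \<in> {1,2,3,4}" by auto
  then show ?thesis by (auto simp: chi5_def)
qed

lemma char_form_norm:
  assumes "char_form j f" "a * d - b * c = 1" "5 dvd c" "Im z > 0"
  shows "norm (f (moeb a b c d z)) = norm (of_int c * z + of_int d) ^ (2 * j) * norm (f z)"
  using char_form_trans[OF assms] chi5_unit[OF assms(2,3)]
  by (auto simp: norm_mult norm_power)

lemma char_form_mult:
  assumes f: "char_form i f" and g: "char_form j g"
  shows "char_form (i + j) (\<lambda>z. f z * g z)"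
proof -
  obtain Y B where Y: "Y > 0" "B > 0" "\<And>z. Im z > Y \<Longrightarrow> norm (f z) \<le> B"
    "\<And>z. Im z > Y \<Longrightarrow> norm (f (-1 / z)) \<le> B * norm z ^ (2 * i)"
    using char_form_bdd[OF f] by blast
  obtain Y' B' where Y': "Y' > 0" "B' > 0" "\<And>z. Im z > Y' \<Longrightarrow> norm (g z) \<le> B'"
    "\<And>z. Im z > Y' \<Longrightarrow> norm (g (-1 / z)) \<le> B' * norm z ^ (2 * j)"
    using char_form_bdd[OF g] by blast
  show ?thesis
  proof (rule char_formI[where Y = "max Y Y'" and B = "B * B'" and Y' = "max Y Y'" and B' = "B * B'"])
    show "(\<lambda>z. f z * g z) holomorphic_on uhp"
      by (intro holomorphic_intros char_form_holo[OF f] char_form_holo[OF g])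
    show "f (moeb a b c d z) * g (moeb a b c d z)
        = of_int (chi5 d) ^ (i + j) * (of_int c * z + of_int d) ^ (2 * (i + j)) * (f z * g z)"
      if "a * d - b * c = 1" "5 dvd c" "Im z > 0" for a b c d z
      using char_form_trans[OF f that] char_form_trans[OF g that]
      by (simp add: power_add distrib_left mult_ac)
    show "norm (f z * g z) \<le> B * B'" if "Im z > max Y Y'" for z
      unfolding norm_mult using Y Y' that by (intro mult_mono) auto
    show "norm (f (-1 / z) * g (-1 / z)) \<le> B * B' * norm z ^ (2 * (i + j))" if "Im z > max Y Y'" for z
    proof -
      have "norm (f (-1 / z) * g (-1 / z)) \<le> (B * norm z ^ (2 * i)) * (B' * norm z ^ (2 * j))"
        unfolding norm_mult using Y Y' that by (intro mult_mono) auto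
      then show ?thesis by (simp add: power_add distrib_left mult_ac)
    qed
  qed
qed

lemma char_form_add:
  assumes f: "char_form j f" and g: "char_form j g"
  shows "char_form j (\<lambda>z. f z + g z)"
proof -
  obtain Y B where Y: "Y > 0" "B > 0" "\<And>z. Im z > Y \<Longrightarrow> norm (f z) \<le> B"
    "\<And>z. Im z > Y \<Longrightarrow> norm (f (-1 / z)) \<le> B * norm z ^ (2 * j)"
    using char_form_bdd[OF f] by blast
  obtain Y' B' where Y': "Y' > 0" "B' > 0" "\<And>z. Im z > Y' \<Longrightarrow> norm (g z) \<le> B'"
    "\<And>z. Im z > Y' \<Longrightarrow> norm (g (-1 / z)) \<le> B' * norm z ^ (2 * j)"
    using char_form_bdd[OF g] by blast
  show ?thesis
  proof (rule char_formI[where Y = "max Y Y'" and B = "B + B'" and Y' = "max Y Y'" and B' = "B + B'"])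
    show "(\<lambda>z. f z + g z) holomorphic_on uhp"
      by (intro holomorphic_intros char_form_holo[OF f] char_form_holo[OF g])
    show "f (moeb a b c d z) + g (moeb a b c d z)
        = of_int (chi5 d) ^ j * (of_int c * z + of_int d) ^ (2 * j) * (f z + g z)"
      if "a * d - b * c = 1" "5 dvd c" "Im z > 0" for a b c d z
      using char_form_trans[OF f that] char_form_trans[OF g that] by (simp add: distrib_left)
    show "norm (f z + g z) \<le> B + B'" if "Im z > max Y Y'" for z
      using Y Y' that by (intro norm_triangle_mono) auto
    show "norm (f (-1 / z) + g (-1 / z)) \<le> (B + B') * norm z ^ (2 * j)" if "Im z > max Y Y'" for z
      unfolding distrib_right using Y Y' that by (intro norm_triangle_mono) auto
  qed
qed

lemma char_form_const: "char_form 0 (\<lambda>z. c)"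
  by (rule char_formI[where B = "norm c" and B' = "norm c"]) auto

lemma char_form_cmult: "char_form j f \<Longrightarrow> char_form j (\<lambda>z. c * f z)"
  using char_form_mult[OF char_form_const[of c], of j f] by simp

lemma char_form_diff: "char_form j f \<Longrightarrow> char_form j g \<Longrightarrow> char_form j (\<lambda>z. f z - g z)"
  using char_form_add[of j f "\<lambda>z. -1 * g z"] char_form_cmult[of j g "-1"] by simp

lemma char_form_power: "char_form j f \<Longrightarrow> char_form (n * j) (\<lambda>z. f z ^ n)"
  by (induction n) (auto simp: char_form_const char_form_mult)

lemma char_form_sum:
  assumes "finite I" "\<And>i. i \<in> I \<Longrightarrow> char_form j (f i)"
  shows "char_form j (\<lambda>z. \<Sum>i\<in>I. f i z)"
  using assms
proof (induction rule: finite_induct)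
  case empty
  have "char_form j (\<lambda>z. 0)" by (rule char_formI[where B = 0 and B' = 0]) auto
  then show ?case by simp
next
  case (insert i I)
  then show ?case by (simp add: char_form_add)
qed

section \<open>Comparison with modular forms on \<open>\<Gamma>\<^sub>0(5)\<close> for even
  j\<close>

lemma moeb_denom_nonzero:
  assumes "a * d - b * c = (1::int)" "Im z > 0"
  shows "of_int c * z + of_int d \<noteq> 0"
proof
  assume *: "of_int c * z + of_int d = 0"
  then have "Im (of_int c * z + of_int d) = 0" by simp
  then have "c = 0" using assms(2) by simp
  moreover from this * have "d = 0" by simp
  ultimately show False using assms(1) by simp
qed

lemma Im_moeb:
  assumes "a * d - b * c = 1" "Im z > 0"
  shows "Im (moeb a b c d z) > 0"
proof -
  have nz: "of_int c * z + of_int d \<noteq> 0" by (rule moeb_denom_nonzero[OF assms])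
  have det: "real_of_int a * real_of_int d - real_of_int b * real_of_int c = 1"
    using assms(1) by (metis of_int_1 of_int_diff of_int_mult)
  have "Im (moeb a b c d z) =
    Im ((of_int a * z + of_int b) * cnj (of_int c * z + of_int d)) / (norm (of_int c * z + of_int d))\<^sup>2"
    unfolding moeb_def by (metis Im_divide_of_real complex_div_cnj of_real_power)
  also have "Im ((of_int a * z + of_int b) * cnj (of_int c * z + of_int d)) =
    (real_of_int a * real_of_int d - real_of_int b * real_of_int c) * Im z"
    by (simp add: algebra_simps)
  finally show ?thesis using det nz assms(2) by simp
qed

text \<open>\<open>SL\<^sub>2(Z)\<close> is the union of the cosets of \<open>\<Gamma>\<^sub>0(5)\<close> represented by the identity and by
  \<open>z \<mapsto> -1 / (z + l)\<close>, so boundedness at all cusps reduces to the cusps at infinity and zero.\<close>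
lemma char_form_imp_modform:
  assumes f: "char_form j f" and "even j"
  shows "modform_G05 (2 * j) f"
  unfolding modform_G05_def
proof (intro conjI allI impI ballI; (elim conjE)?)
  show "f holomorphic_on uhp" by (rule char_form_holo[OF f])
next
  fix a b c d :: int and z
  assume *: "a * d - b * c = 1" "5 dvd c" "z \<in> uhp"
  have "of_int (chi5 d) ^ j = (1::complex)"
    using chi5_unit[OF *(1,2)] \<open>even j\<close> by auto
  then show "f (moeb a b c d z) = (of_int c * z + of_int d) ^ (2 * j) * f z"
    using char_form_trans[OF f *(1,2)] * by simp
next
  fix a b c d :: int
  assume det: "a * d - b * c = 1"
  obtain Y B where Y: "Y > 0" "B > 0" "\<And>z. Im z > Y \<Longrightarrow> norm (f z) \<le> B"
    "\<And>z. Im z > Y \<Longrightarrow> norm (f (-1 / z)) \<le> B * norm z ^ (2 * j)"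
    using char_form_bdd[OF f] by blast
  have "norm (f (moeb a b c d z) / (of_int c * z + of_int d) ^ (2 * j)) \<le> B" if z: "Im z > Y" for z
  proof -
    have z0: "Im z > 0" using z Y by simp
    have nz: "of_int c * z + of_int d \<noteq> 0" by (rule moeb_denom_nonzero[OF det z0])
    show ?thesis
    proof (cases "5 dvd c")
      case True
      show ?thesis
        using char_form_norm[OF f det True z0] nz Y(3)[OF z]
        by (simp add: norm_divide norm_power)
    next
      case False
      then have "coprime 5 c" using prime_imp_coprime[of "5::int" c] by simp
      then obtain u v where uv: "u * 5 + v * c = 1" by (metis bezout_int coprime_iff_gcd_eq_1)
      \<comment> \<open>v inverts c modulo 5, so \<open>c * l\<close> is congruent to d. The given
        matrix times the inverse of the one for -1 / (z + l) then lies in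
        \<open>\<Gamma>\<^sub>0(5)\<close>, and the real translation by l keeps the height.\<close>
      define l where "l = v * d"
      have "c * l - d = d * (v * c - 1)" by (simp add: l_def algebra_simps)
      also have "\<dots> = 5 * (- u * d)" using uv by (simp add: algebra_simps flip: uv)
      finally have dv: "5 dvd c * l - d" by simp
      define w where "w = -1 / (z + of_int l)"
      have w0: "Im w > 0" unfolding w_def by (rule Im_minus_inverse_pos) (use z0 in simp)
      have zl: "z + of_int l \<noteq> 0" using z0 by (auto simp: complex_eq_iff)
      have den: "of_int (c * l - d) * w + of_int c = (of_int c * z + of_int d) / (z + of_int l)"
        using zl by (simp add: w_def field_simps)
      have num: "of_int (a * l - b) * w + of_int a = (of_int a * z + of_int b) / (z + of_int l)"
        using zl by (simp add: w_def field_simps)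
      have "moeb a b c d z = moeb (a * l - b) a (c * l - d) c w"
        unfolding moeb_def den num using zl by simp
      moreover have "(a * l - b) * c - a * (c * l - d) = 1" using det by (simp add: algebra_simps)
      ultimately have "norm (f (moeb a b c d z)) =
          norm (of_int (c * l - d) * w + of_int c) ^ (2 * j) * norm (f w)"
        using char_form_norm[OF f _ dv w0] by metis
      also have "\<dots> \<le> norm (of_int (c * l - d) * w + of_int c) ^ (2 * j) * (B * norm (z + of_int l) ^ (2 * j))"
        unfolding w_def using Y(4)[of "z + of_int l"] z by (intro mult_left_mono) auto
      also have "\<dots> = B * norm (of_int c * z + of_int d) ^ (2 * j)"
        unfolding den using zl by (simp add: norm_divide power_divide)
      finally show ?thesis using nz by (simp add: norm_divide norm_power divide_le_eq)
    qed
  qed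
  then show "\<exists>Y B. \<forall>z. Im z > Y \<longrightarrow> norm (f (moeb a b c d z) / (of_int c * z + of_int d) ^ (2 * j)) \<le> B"
    by blast
qed

lemma modform_imp_char_form:
  assumes f: "modform_G05 (2 * j) f" and "even j"
  shows "char_form j f"
proof -
  have bd: "\<exists>Y B. \<forall>z. Im z > Y \<longrightarrow> norm (f (moeb a b c d z) / (of_int c * z + of_int d) ^ (2 * j)) \<le> B"
    if "a * d - b * c = 1" for a b c d using f that unfolding modform_G05_def by blast
  obtain Y B where 1: "\<And>z. Im z > Y \<Longrightarrow> norm (f z) \<le> B"
    using bd[of 1 1 0 0] by (auto simp: moeb_def)
  obtain Y' B' where 2: "\<And>z. Im z > Y' \<Longrightarrow> norm (f (-1 / z) / z ^ (2 * j)) \<le> B'"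
    using bd[of 0 0 "-1" 1] by (auto simp: moeb_def)
  show ?thesis
  proof (rule char_formI[where Y = Y and B = B and Y' = "max 0 Y'" and B' = B'])
    show "f holomorphic_on uhp" using f by (simp add: modform_G05_def)
    show "f (moeb a b c d z) = of_int (chi5 d) ^ j * (of_int c * z + of_int d) ^ (2 * j) * f z"
      if *: "a * d - b * c = 1" "5 dvd c" "Im z > 0" for a b c d z
    proof -
      have "of_int (chi5 d) ^ j = (1::complex)"
        using chi5_unit[OF *(1,2)] \<open>even j\<close> by auto
      moreover have "f (moeb a b c d z) = (of_int c * z + of_int d) ^ (2 * j) * f z"
        using f * unfolding modform_G05_def by (auto simp: uhp_def)
      ultimately show ?thesis by simp
    qed
    show "norm (f (-1 / z)) \<le> B' * norm z ^ (2 * j)" if "Im z > max 0 Y'" for z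
    proof -
      have "z \<noteq> 0" using that by auto
      with 2[of z] that show ?thesis by (simp add: norm_divide norm_power divide_le_eq)
    qed
  qed (use 1 in auto)
qed

lemma char_form_cong:
  assumes f: "char_form j f" and eq: "\<And>z. Im z > 0 \<Longrightarrow> g z = f z"
  shows "char_form j g"
proof -
  obtain Y B where Y: "Y > 0" "B > 0" "\<And>z. Im z > Y \<Longrightarrow> norm (f z) \<le> B"
    "\<And>z. Im z > Y \<Longrightarrow> norm (f (-1 / z)) \<le> B * norm z ^ (2 * j)"
    using char_form_bdd[OF f] by blast
  show ?thesis
  proof (rule char_formI)
    show "g holomorphic_on uhp"
      using char_form_holo[OF f] by (rule holomorphic_transform) (simp add: eq)
    show "g (moeb a b c d z) = of_int (chi5 d) ^ j * (of_int c * z + of_int d) ^ (2 * j) * g z"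
      if "a * d - b * c = 1" "5 dvd c" "Im z > 0" for a b c d z
      using char_form_trans[OF f that] Im_moeb[OF that(1,3)] that by (simp add: eq)
    show "norm (g z) \<le> B" if "Im z > Y" for z
      using Y that by (simp add: eq)
    show "norm (g (-1 / z)) \<le> B * norm z ^ (2 * j)" if "Im z > Y" for z
    proof -
      have "Im z > 0" using Y(1) that by simp
      from eq[OF Im_minus_inverse_pos[OF this]] show ?thesis using Y(4)[OF that] by simp
    qed
  qed
qed

lemma connected_uhp: "connected uhp"
  unfolding uhp_def by (intro convex_connected convex_halfspace_Im_gt)

lemma open_uhp: "open uhp"
  unfolding uhp_def by (simp add: open_halfspace_Im_gt)

text \<open>On the open set where f is nonzero g vanishes; if that set is nonempty, analytic
  continuation makes g vanish on all of S.\<close>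

lemma holomorphic_mult_eq_0:
  assumes "f holomorphic_on S" "g holomorphic_on S" "open S" "connected S"
    and zero: "\<And>z. z \<in> S \<Longrightarrow> f z * g z = 0"
  shows "(\<forall>z\<in>S. f z = 0) \<or> (\<forall>z\<in>S. g z = 0)"
proof (rule ccontr)
  assume "\<not> ?thesis"
  then obtain w where w: "w \<in> S" "f w \<noteq> 0" and ng: "\<not> (\<forall>z\<in>S. g z = 0)" by blast
  have "continuous_on S f" using assms(1) by (rule holomorphic_on_imp_continuous_on)
  then have op: "open (S \<inter> f -` (- {0}))"
    using \<open>open S\<close> by (metis continuous_on_open_vimage Int_commute open_Compl closed_singleton)
  have "g z = 0" if "z \<in> S" for z
  proof (rule analytic_continuation_open[OF op \<open>open S\<close> _ \<open>connected S\<close> _ \<open>g holomorphic_on S\<close> holomorphic_on_const _ that])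
    show "S \<inter> f -` (- {0}) \<noteq> {}" using w by auto
    show "g z = 0" if "z \<in> S \<inter> f -` (- {0})" for z using zero[of z] that by auto
  qed auto
  with ng show False by blast
qed

lemma holomorphic_prod_eq_0:
  assumes "finite I" "\<And>i. i \<in> I \<Longrightarrow> f i holomorphic_on S" "open S" "connected S" "S \<noteq> {}"
    and "\<And>z. z \<in> S \<Longrightarrow> (\<Prod>i\<in>I. f i z) = 0"
  shows "\<exists>i\<in>I. \<forall>z\<in>S. f i z = 0"
  using assms(1,2,6)
proof (induction rule: finite_induct)
  case empty
  with \<open>S \<noteq> {}\<close> show ?case by auto
next
  case (insert i I)
  have "(\<forall>z\<in>S. f i z = 0) \<or> (\<forall>z\<in>S. (\<Prod>i\<in>I. f i z) = 0)"
    using insert by (intro holomorphic_mult_eq_0 holomorphic_on_prod assms(3,4)) auto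
  with insert show ?case by auto
qed

text \<open>The product of \<open>f\<close> over the six cosets of \<open>\<Gamma>\<^sub>0(5)\<close> has level one.\<close>
lemma char_form_vanishing:
  assumes f: "char_form j f"
    and dec: "\<And>z. Im z > Y \<Longrightarrow> norm (f z) \<le> C * exp (- (2 * pi * real n) * Im z)"
    and n: "n \<ge> 1" "6 * j \<le> 5 * n" and w: "Im w > 0"
  shows "f w = 0"
proof -
  \<comment> \<open>g is the slash transform of f by the inversion; its shifts by l < 5, together
    with f, represent the six cosets.\<close>
  define g where "g = (\<lambda>z. f (-1 / z) / z ^ (2 * j))"
  define F where "F = (\<lambda>z. f z * (\<Prod>l<5. g (z + of_nat l)))"
  have prod5: "(\<Prod>l<5. h l) = h 0 * (h 1 * (h 2 * (h 3 * h 4)))" for h :: "nat \<Rightarrow> complex"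
    by (simp add: eval_nat_numeral mult_ac)
  have F5: "F z = f z * (g z * (g (z + 1) * (g (z + 2) * (g (z + 3) * g (z + 4)))))" for z
    by (simp add: F_def prod5)
  obtain Y' B where Y': "Y' > 0" "B > 0" "\<And>z. Im z > Y' \<Longrightarrow> norm (f (-1 / z)) \<le> B * norm z ^ (2 * j)"
    using char_form_bdd[OF f] by metis
  have gb: "norm (g z) \<le> B" if "Im z > Y'" for z
  proof -
    have "z \<noteq> 0" using that Y'(1) by auto
    with Y'(3)[OF that] show ?thesis by (simp add: g_def norm_divide norm_power divide_le_eq)
  qed
  have holg: "g holomorphic_on uhp"
  proof -
    have "f holomorphic_on (\<lambda>z. -1 / z) ` uhp"
      by (rule holomorphic_on_subset[OF char_form_holo[OF f]])
         (use Im_minus_inverse_pos in auto)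
    then have "(f \<circ> (\<lambda>z. -1 / z)) holomorphic_on uhp"
      by (intro holomorphic_on_compose) (auto intro!: holomorphic_intros)
    then show ?thesis unfolding g_def o_def by (intro holomorphic_intros) auto
  qed
  have holgs: "(\<lambda>z. g (z + of_nat l)) holomorphic_on uhp" for l
  proof -
    have "g holomorphic_on (\<lambda>z. z + of_nat l) ` uhp"
      by (rule holomorphic_on_subset[OF holg]) auto
    then have "(g \<circ> (\<lambda>z. z + of_nat l)) holomorphic_on uhp"
      by (intro holomorphic_on_compose) (auto intro!: holomorphic_intros)
    then show ?thesis unfolding o_def .
  qed
  have holF: "F holomorphic_on uhp"
    unfolding F_def by (intro holomorphic_on_mult holomorphic_on_prod holgs char_form_holo[OF f])
  have f_per: "norm (f (z + 1)) = norm (f z)" if "Im z > 0" for z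
    using char_form_norm[OF f, of 1 1 1 0 z] that by (simp add: moeb_def)
  \<comment> \<open>Translation by 5 is conjugate under the inversion to the matrix with rows (-1,
    0) and (5, -1), which lies in \<open>\<Gamma>\<^sub>0(5)\<close>. So in norm the shift l matters
    only modulo 5.\<close>
  have g_per: "norm (g (z + 5)) = norm (g z)" if z: "Im z > 0" for z
  proof -
    have z0: "z \<noteq> 0" "z + 5 \<noteq> 0" using z by (auto simp: complex_eq_iff)
    have "-1 / (z + 5) = moeb (-1) 0 5 (-1) (-1 / z)"
      using z0 by (simp add: moeb_def divide_simps)
    then have "norm (f (-1 / (z + 5))) = norm (5 * (-1 / z) - 1) ^ (2 * j) * norm (f (-1 / z))"
      using char_form_norm[OF f, of "-1" "-1" 0 5 "-1 / z"] Im_minus_inverse_pos[OF z] by simp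
    also have "5 * (-1 / z) - 1 = - ((z + 5) / z)" using z0 by (simp add: field_simps)
    finally show ?thesis
      unfolding g_def using z0 by (simp add: norm_divide norm_power power_divide)
  qed
  have g_inv0: "norm (g (-1 / z)) = norm z ^ (2 * j) * norm (f z)" if "Im z > 0" for z
    by (simp add: g_def norm_mult norm_divide norm_power power_divide)
  have f_inv: "norm (f (-1 / z)) = norm z ^ (2 * j) * norm (g z)" if "Im z > 0" for z
    using that by (auto simp: g_def norm_divide norm_power)
  \<comment> \<open>Inversion sends the coset of i to that of l with i l congruent to -1 modulo 5:
    it swaps 1 and 4 and fixes 2 and 3, while the shift 0 is exchanged with the identity
    coset.\<close>
  have g_inv: "norm (g (-1 / z + of_int i)) = norm z ^ (2 * j) * norm (g (z + of_int l))"
    if z: "Im z > 0" and il: "5 dvd i * l + 1" for z i l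
  proof -
    define v where "v = -1 / (z + of_int l)"
    have v0: "Im v > 0" unfolding v_def by (rule Im_minus_inverse_pos) (use z in simp)
    have zl: "z + of_int l \<noteq> 0" using z by (auto simp: complex_eq_iff)
    have z0: "z \<noteq> 0" using z by auto
    have "Im (-1 / z + of_int i) > 0" using Im_minus_inverse_pos[OF z] by simp
    then have nz: "-1 / z + of_int i \<noteq> 0" by (metis less_irrefl zero_complex.sel(2))
    have eq: "-1 / z + of_int i = (of_int i * z - 1) / z" using z0 by (simp add: field_simps)
    have nz': "of_int i * z - 1 \<noteq> 0" using nz z0 unfolding eq by simp
    have den: "of_int (i * l + 1) * v + of_int i = (of_int i * z - 1) / (z + of_int l)"
      using zl by (simp add: v_def field_simps)
    have num: "of_int (-l) * v + of_int (-1) = - z / (z + of_int l)"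
      using zl by (simp add: v_def field_simps)
    have "-1 / (-1 / z + of_int i) = moeb (-l) (-1) (i * l + 1) i v"
      unfolding moeb_def den num eq using zl by simp
    then have "norm (f (-1 / (-1 / z + of_int i))) = (norm (of_int i * z - 1) / norm (z + of_int l)) ^ (2 * j) * norm (f v)"
      using char_form_norm[OF f _ il v0, of "-l" i "-1"] by (simp add: den norm_divide del: of_int_add of_int_mult)
    then show ?thesis
      unfolding g_def v_def eq using zl z0 nz' 
      by (simp add: norm_mult norm_divide norm_power power_divide)
  qed
  have "F z = 0" if "Im z > 0" for z
  proof (rule level_one_vanishing[where F = F and L = "6 * j" and Y = "max Y Y'" and C = "C * B ^ 5", OF holF _ _ _ n that])
    show "norm (F (z + 1)) = norm (F z)" if "Im z > 0" for z
      using f_per[OF that] g_per[OF that] unfolding F5 norm_mult by (simp add: add.assoc mult_ac)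
    show "norm (F (-1 / z)) = norm z ^ (2 * (6 * j)) * norm (F z)" if z: "Im z > 0" for z
    proof -
      have "norm (F (-1 / z)) = norm (f (-1 / z)) * (norm (g (-1 / z)) * (norm (g (-1 / z + of_int 1))
         * (norm (g (-1 / z + of_int 2)) * (norm (g (-1 / z + of_int 3)) * norm (g (-1 / z + of_int 4))))))"
        by (simp add: F5 norm_mult)
      also have "\<dots> = (norm z ^ (2 * j) * norm (g z)) * ((norm z ^ (2 * j) * norm (f z)) *
         ((norm z ^ (2 * j) * norm (g (z + of_int 4))) * ((norm z ^ (2 * j) * norm (g (z + of_int 2))) *
          ((norm z ^ (2 * j) * norm (g (z + of_int 3))) * (norm z ^ (2 * j) * norm (g (z + of_int 1)))))))"
      proof -
        have "5 dvd (1 * 4 + 1 :: int)" "5 dvd (2 * 2 + 1 :: int)" "5 dvd (3 * 3 + 1 :: int)" "5 dvd (4 * 1 + 1 :: int)"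
          by simp_all
        then show ?thesis by (simp only: f_inv[OF z] g_inv0[OF z] g_inv[OF z \<open>5 dvd (1 * 4 + 1 :: int)\<close>]
            g_inv[OF z \<open>5 dvd (2 * 2 + 1 :: int)\<close>] g_inv[OF z \<open>5 dvd (3 * 3 + 1 :: int)\<close>]
            g_inv[OF z \<open>5 dvd (4 * 1 + 1 :: int)\<close>])
      qed
      also have "\<dots> = (norm z ^ (2 * j)) ^ 6 * norm (F z)"
        by (simp add: F5 norm_mult eval_nat_numeral mult_ac)
      also have "(norm z ^ (2 * j)) ^ 6 = norm z ^ (2 * (6 * j))"
        by (simp add: power_mult[symmetric] mult_ac)
      finally show ?thesis .
    qed
    \<comment> \<open>Only the factor f decays. The other five are bounded, by the growth condition
      on f at the cusp 0, so the order n survives in the product.\<close>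
    show "norm (F z) \<le> C * B ^ 5 * exp (- (2 * pi * real n) * Im z)" if "Im z > max Y Y'" for z
    proof -
      have G: "norm (g z * (g (z + 1) * (g (z + 2) * (g (z + 3) * g (z + 4))))) \<le> B * (B * (B * (B * B)))"
        unfolding norm_mult using that Y' by (intro mult_mono gb) auto
      have "norm (F z) \<le> (C * exp (- (2 * pi * real n) * Im z)) * (B * (B * (B * (B * B))))"
        unfolding F5 norm_mult[of "f z"] using that dec[of z] order_trans[OF norm_ge_zero dec[of z]]
        by (intro mult_mono G) auto
      then show ?thesis by (simp add: eval_nat_numeral mult_ac)
    qed
  qed
  \<comment> \<open>A product vanishing identically forces one factor to vanish identically; if it
    is a shift of g, the inversion carries this back to f.\<close>
  then have "(\<forall>z\<in>uhp. f z = 0) \<or> (\<forall>z\<in>uhp. (\<Prod>l<5. g (z + of_nat l)) = 0)"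
    by (intro holomorphic_mult_eq_0 holomorphic_on_prod holgs char_form_holo[OF f] open_uhp connected_uhp)
       (auto simp: F_def)
  then show ?thesis
  proof
    assume 0: "\<forall>z\<in>uhp. (\<Prod>l<5. g (z + of_nat l)) = 0"
    have "\<exists>l\<in>{..<5}. \<forall>z\<in>uhp. g (z + of_nat l) = 0"
      using 0 w by (intro holomorphic_prod_eq_0 holgs open_uhp connected_uhp) auto
    then obtain l where l: "\<And>z. z \<in> uhp \<Longrightarrow> g (z + of_nat l) = 0" by blast
    have "g (-1 / w) = 0" using l[of "-1 / w - of_nat l"] Im_minus_inverse_pos[OF w] by simp
    with g_inv0[OF w] w show ?thesis by auto
  qed (use w in simp)
qed

section \<open>Expansions at infinity\<close>

definition qexp :: "complex \<Rightarrow> complex" where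
  "qexp z = exp (2 * of_real pi * \<i> * z)"

definition qser :: "complex fps \<Rightarrow> complex \<Rightarrow> complex" where
  "qser F z = eval_fps F (qexp z)"

lemma norm_qexp: "norm (qexp z) = exp (- (2 * pi) * Im z)"
  by (simp add: qexp_def)

lemma norm_qexp_less_1: "Im z > 0 \<Longrightarrow> norm (qexp z) < 1"
  by (simp add: norm_qexp)

lemma qexp_nonzero [simp]: "qexp z \<noteq> 0"
  by (simp add: qexp_def)

lemma qexp_of_nat_mult: "qexp (of_nat n * z) = qexp z ^ n"
  by (simp add: qexp_def exp_of_nat_mult[symmetric] mult_ac)

lemma has_field_derivative_qexp:
  "(qexp has_field_derivative (2 * of_real pi * \<i>) * qexp z) (at z)"
  unfolding qexp_def by (auto intro!: derivative_eq_intros)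

lemma holomorphic_qexp: "qexp holomorphic_on S"
  unfolding qexp_def by (intro holomorphic_intros)

lemma qexp_surj:
  assumes "x \<noteq> 0" "norm x < 1"
  obtains z where "Im z > 0" "qexp z = x"
proof
  have "Im (Ln x / (2 * of_real pi * \<i>)) = - Re (Ln x) / (2 * pi)"
    by (simp add: Im_divide power2_eq_square)
  also have "Re (Ln x) = ln (norm x)" using assms by simp
  finally show "Im (Ln x / (2 * of_real pi * \<i>)) > 0"
    using assms by (simp add: divide_neg_pos)
  show "qexp (Ln x / (2 * of_real pi * \<i>)) = x"
    using assms by (simp add: qexp_def)
qed

definition unit_conv :: "complex fps \<Rightarrow> bool" where
  "unit_conv F \<longleftrightarrow> fps_conv_radius F \<ge> 1"

lemma unit_conv_less: "unit_conv F \<Longrightarrow> norm q < 1 \<Longrightarrow> ereal (norm q) < fps_conv_radius F"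
  unfolding unit_conv_def by (metis ereal_less(3) less_ereal.simps(1) less_le_trans one_ereal_def)

lemma unit_conv_const [simp]: "unit_conv (fps_const c)"
  by (simp add: unit_conv_def)

lemma unit_conv_X [simp]: "unit_conv fps_X"
  by (simp add: unit_conv_def)

lemma unit_conv_add: "unit_conv F \<Longrightarrow> unit_conv G \<Longrightarrow> unit_conv (F + G)"
  unfolding unit_conv_def using fps_conv_radius_add[of F G] by (meson min.boundedI order_trans)

lemma unit_conv_diff: "unit_conv F \<Longrightarrow> unit_conv G \<Longrightarrow> unit_conv (F - G)"
  unfolding unit_conv_def using fps_conv_radius_diff[of F G] by (meson min.boundedI order_trans)

lemma unit_conv_mult: "unit_conv F \<Longrightarrow> unit_conv G \<Longrightarrow> unit_conv (F * G)"
  unfolding unit_conv_def using fps_conv_radius_mult[of F G] by (meson min.boundedI order_trans)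

lemma unit_conv_power: "unit_conv F \<Longrightarrow> unit_conv (F ^ n)"
  unfolding unit_conv_def using fps_conv_radius_power[of F n] by (meson order_trans)

lemma unit_conv_deriv: "unit_conv F \<Longrightarrow> unit_conv (fps_deriv F)"
  unfolding unit_conv_def using fps_conv_radius_deriv[of F] by (meson order_trans)

lemma unit_conv_sum: "(\<And>i. i \<in> I \<Longrightarrow> unit_conv (F i)) \<Longrightarrow> unit_conv (\<Sum>i\<in>I. F i)"
proof (induction I rule: infinite_finite_induct)
  case (insert i I)
  then show ?case by (simp add: unit_conv_add)
qed (simp_all add: unit_conv_def)

lemma unit_convI:
  assumes "\<And>q. norm q < 1 \<Longrightarrow> q \<noteq> 0 \<Longrightarrow> summable (\<lambda>n. fps_nth F n * q ^ n)"
  shows "unit_conv F"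
  unfolding unit_conv_def fps_conv_radius_def
proof (rule conv_radius_geI_ex)
  fix x :: real assume x: "0 < x" "ereal x < 1"
  then have "x < 1" by (simp add: one_ereal_def)
  with x show "\<exists>z. norm z = x \<and> summable (\<lambda>n. fps_nth F n * z ^ n)"
    using assms[of "of_real x"] by (intro exI[of _ "of_real x"]) auto
qed

lemma qser_const [simp]: "qser (fps_const c) z = c"
  by (simp add: qser_def)

lemma qser_add: "unit_conv F \<Longrightarrow> unit_conv G \<Longrightarrow> Im z > 0 \<Longrightarrow> qser (F + G) z = qser F z + qser G z"
  unfolding qser_def by (intro eval_fps_add unit_conv_less norm_qexp_less_1)

lemma qser_diff: "unit_conv F \<Longrightarrow> unit_conv G \<Longrightarrow> Im z > 0 \<Longrightarrow> qser (F - G) z = qser F z - qser G z"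
  unfolding qser_def by (intro eval_fps_diff unit_conv_less norm_qexp_less_1)

lemma qser_mult: "unit_conv F \<Longrightarrow> unit_conv G \<Longrightarrow> Im z > 0 \<Longrightarrow> qser (F * G) z = qser F z * qser G z"
  unfolding qser_def by (intro eval_fps_mult unit_conv_less norm_qexp_less_1)

lemma qser_power: "unit_conv F \<Longrightarrow> Im z > 0 \<Longrightarrow> qser (F ^ n) z = qser F z ^ n"
  unfolding qser_def by (intro eval_fps_power unit_conv_less norm_qexp_less_1)

lemma qser_sum:
  assumes "\<And>i. i \<in> I \<Longrightarrow> unit_conv (F i)" "Im z > 0"
  shows "qser (\<Sum>i\<in>I. F i) z = (\<Sum>i\<in>I. qser (F i) z)"
  using assms
proof (induction I rule: infinite_finite_induct)
  case (insert i I)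
  then show ?case by (simp add: qser_add unit_conv_sum)
qed (simp_all add: qser_def)

lemma qser_sums:
  assumes "unit_conv F" "Im z > 0"
  shows "(\<lambda>n. fps_nth F n * qexp z ^ n) sums qser F z"
  unfolding qser_def using assms by (intro sums_eval_fps unit_conv_less norm_qexp_less_1)

lemma qser_eqI: "(\<lambda>n. fps_nth F n * qexp z ^ n) sums s \<Longrightarrow> qser F z = s"
  by (simp add: qser_def eval_fps_def sums_iff)

lemma qser_holomorphic:
  assumes "unit_conv F"
  shows "qser F holomorphic_on uhp"
proof -
  have "(eval_fps F \<circ> qexp) holomorphic_on uhp"
  proof (rule holomorphic_on_compose[OF holomorphic_qexp holomorphic_on_eval_fps])
    show "qexp ` uhp \<subseteq> eball 0 (fps_conv_radius F)"
      using unit_conv_less[OF assms norm_qexp_less_1] by auto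
  qed
  then show ?thesis by (simp add: qser_def[abs_def] o_def)
qed

lemma qser_has_field_derivative:
  assumes "unit_conv F" "Im z > 0"
  shows "(qser F has_field_derivative 2 * of_real pi * \<i> * qser (fps_X * fps_deriv F) z) (at z)"
proof -
  have "((\<lambda>z. eval_fps F (qexp z)) has_field_derivative
      eval_fps (fps_deriv F) (qexp z) * (2 * of_real pi * \<i> * qexp z)) (at z)"
    by (rule DERIV_chain2[OF has_field_derivative_eval_fps has_field_derivative_qexp])
       (intro unit_conv_less norm_qexp_less_1 assms)
  moreover have "qser (fps_X * fps_deriv F) z = qexp z * eval_fps (fps_deriv F) (qexp z)"
    using assms by (subst qser_mult) (auto intro: unit_conv_deriv simp: qser_def)
  ultimately show ?thesis by (simp add: qser_def[abs_def] mult_ac)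
qed

text \<open>\<open>qexp\<close> omits the origin of the disc, so the value there is supplied by
  continuity before power series can be compared.\<close>

lemma qser_eq_0_imp:
  assumes F: "unit_conv F" and zero: "\<And>z. Im z > 0 \<Longrightarrow> qser F z = 0"
  shows "F = 0"
proof (rule ccontr)
  assume "F \<noteq> 0"
  have *: "eval_fps F x = 0" if "x \<noteq> 0" "norm x < 1" for x
    using qexp_surj[OF that] zero unfolding qser_def by metis
  have pos: "fps_conv_radius F > 0"
    using unit_conv_less[OF F, of 0] by (simp add: zero_ereal_def)
  have cont: "isCont (eval_fps F) 0"
    using pos by (intro continuous_eval_fps) (simp add: zero_ereal_def)
  have "eventually (\<lambda>x::complex. x \<noteq> 0 \<and> norm x < 1) (at 0)"
    unfolding eventually_at by (intro exI[of _ 1]) (auto simp: dist_norm)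
  then have "eventually (\<lambda>x. eval_fps F x = 0) (at 0)"
    by eventually_elim (use * in auto)
  then have "(eval_fps F \<longlongrightarrow> 0) (at 0)" by (rule tendsto_eventually)
  with cont have "eval_fps F 0 = 0"
    unfolding isCont_def using tendsto_unique[OF at_neq_bot] by blast
  with * have "eval_fps F x = 0" if "norm x < 1" for x using that by (cases "x = 0") auto
  then have "eventually (\<lambda>x. eval_fps F x = eval_fps 0 x) (nhds 0)"
    unfolding eventually_nhds_metric by (intro exI[of _ 1]) (auto simp: dist_norm)
  then have "F = 0" by (intro eval_fps_eqD pos) auto
  with \<open>F \<noteq> 0\<close> show False by simp
qed

lemma qser_factor:
  assumes F: "unit_conv F" and "n \<le> subdegree F" and "Im z > 0"
  shows "qser F z = qser (fps_shift n F) z * qexp z ^ n"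
  using eval_fps_shift[OF assms(2), of "qexp z"] unit_conv_less[OF F norm_qexp_less_1[OF assms(3)]]
  unfolding qser_def by simp

lemma unit_conv_shift: "unit_conv F \<Longrightarrow> unit_conv (fps_shift n F)"
  by (simp add: unit_conv_def)

text \<open>The region Im z > 1 is mapped into a closed disc of radius smaller than 1, which is
  compact.\<close>

lemma qser_bdd:
  assumes F: "unit_conv F"
  obtains B where "B > 0" "\<And>z. Im z > 1 \<Longrightarrow> norm (qser F z) \<le> B"
proof -
  define \<rho> where "\<rho> = exp (- (2 * pi))"
  have sub: "cball (0::complex) \<rho> \<subseteq> eball 0 (fps_conv_radius F)"
  proof (rule subsetI)
    fix x :: complex assume "x \<in> cball 0 \<rho>"
    then have "norm x < 1" by (auto simp: \<rho>_def intro: le_less_trans)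
    then show "x \<in> eball 0 (fps_conv_radius F)" using unit_conv_less[OF F] by simp
  qed
  have "continuous_on (cball 0 \<rho>) (eval_fps F)"
    by (rule continuous_on_subset[OF continuous_on_eval_fps sub])
  then have "bounded (eval_fps F ` cball 0 \<rho>)"
    by (intro compact_imp_bounded compact_continuous_image) auto
  then obtain B where B: "B > 0" "\<And>x. norm x \<le> \<rho> \<Longrightarrow> norm (eval_fps F x) \<le> B"
    unfolding bounded_pos by auto
  have "norm (qser F z) \<le> B" if "Im z > 1" for z
    unfolding qser_def using that by (intro B) (simp add: norm_qexp \<rho>_def)
  with B(1) that show ?thesis by blast
qed

lemma qser_decay:
  assumes F: "unit_conv F" and n: "n \<le> subdegree F"
  obtains C where "C > 0" "\<And>z. Im z > 1 \<Longrightarrow> norm (qser F z) \<le> C * exp (- (2 * pi * real n) * Im z)"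
proof -
  obtain B where B: "B > 0" "\<And>z. Im z > 1 \<Longrightarrow> norm (qser (fps_shift n F) z) \<le> B"
    using qser_bdd[OF unit_conv_shift[OF F]] by blast
  have "norm (qser F z) \<le> B * exp (- (2 * pi * real n) * Im z)" if "Im z > 1" for z
  proof -
    have "norm (qser F z) = norm (qser (fps_shift n F) z) * norm (qexp z) ^ n"
      using that by (subst qser_factor[OF F n]) (auto simp: norm_mult norm_power)
    also have "\<dots> \<le> B * norm (qexp z) ^ n"
      using B(2)[OF that] by (intro mult_right_mono) auto
    also have "norm (qexp z) ^ n = exp (- (2 * pi * real n) * Im z)"
      unfolding norm_qexp exp_of_nat_mult[symmetric] by (simp add: mult_ac)
    finally show ?thesis .
  qed
  with B(1) that show ?thesis by blast
qed

text \<open>With the leading power of q removed, the series stays close to its nonzero constant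
  term. The bound controls the denominators near both cusps in
  \<open>modform_eq_0_of_order\<close>.\<close>

lemma qser_lower_bound:
  assumes F: "unit_conv F" and nz: "F \<noteq> 0"
  obtains Y c where "Y > 0" "c > 0"
    "\<And>z. Im z > Y \<Longrightarrow> c * exp (- (2 * pi * real (subdegree F)) * Im z) \<le> norm (qser F z)"
proof -
  define n where "n = subdegree F"
  define G where "G = fps_shift n F"
  have G: "unit_conv G" unfolding G_def by (rule unit_conv_shift[OF F])
  have G0: "fps_nth G 0 \<noteq> 0" using nz by (simp add: G_def n_def)
  define c where "c = norm (fps_nth G 0) / 2"
  have c: "c > 0" using G0 by (simp add: c_def)
  have "isCont (eval_fps G) 0"
    using unit_conv_less[OF G, of 0] by (intro continuous_eval_fps) auto
  then obtain d where d: "d > 0" "\<And>x. norm x < d \<Longrightarrow> dist (eval_fps G x) (eval_fps G 0) < c"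
    unfolding continuous_at_eps_delta using c by (metis dist_0_norm dist_commute)
  obtain Y0 where Y0: "\<And>y. y > Y0 \<Longrightarrow> 1 * exp (- (2 * pi) * y) * y ^ 0 < d"
    using power_times_exp_small[of "2 * pi" d 1 0] d(1) by auto
  have "c * exp (- (2 * pi * real n) * Im z) \<le> norm (qser F z)" if z: "Im z > max 1 Y0" for z
  proof -
    have "norm (qexp z) < d" using Y0[of "Im z"] z by (simp add: norm_qexp)
    from d(2)[OF this] have "norm (qser G z - fps_nth G 0) < c"
      by (simp add: qser_def eval_fps_at_0 dist_norm)
    moreover have "norm (fps_nth G 0) \<le> norm (qser G z) + norm (qser G z - fps_nth G 0)"
      by (metis norm_minus_commute norm_triangle_sub)
    ultimately have "c \<le> norm (qser G z)" by (simp add: c_def)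
    then have "c * norm (qexp z) ^ n \<le> norm (qser G z) * norm (qexp z) ^ n"
      by (intro mult_right_mono) auto
    also have "\<dots> = norm (qser F z)"
      using z by (subst qser_factor[OF F, of n]) (auto simp: norm_mult norm_power n_def G_def)
    also have "norm (qexp z) ^ n = exp (- (2 * pi * real n) * Im z)"
      unfolding norm_qexp exp_of_nat_mult[symmetric] by (simp add: mult_ac)
    finally show ?thesis .
  qed
  then show ?thesis using that[of "max 1 Y0" c] c by (simp add: n_def)
qed

section \<open>Division values of the Weierstrass function\<close>

text \<open>The exponent 3/2 exceeds 1, so the weights are summable, and the product of two of them
  dominates the inverse cube of a lattice vector up to a constant. Double sums thus reduce to
  products of single sums.\<close>

definition half_weight :: "int \<Rightarrow> real" where
  "half_weight x = (1 + \<bar>of_int x\<bar>) powr (-3/2)"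

lemma half_weight_summable: "half_weight summable_on UNIV"
proof -
  have "summable (\<lambda>n. real (n + 1) powr (-3/2))"
    using summable_ignore_initial_segment[of "\<lambda>n. real n powr (-3/2)" 1]
    by (simp add: summable_real_powr_iff)
  then have s: "(\<lambda>n::nat. (1 + real n) powr (-3/2)) summable_on UNIV"
    by (intro summable_nonneg_imp_summable_on) (auto simp: add.commute)
  have "half_weight summable_on range int"
    by (subst summable_on_reindex) (use s in \<open>auto simp: half_weight_def o_def\<close>)
  moreover have "half_weight summable_on range (\<lambda>n. - int n)"
    by (subst summable_on_reindex) (use s in \<open>auto simp: half_weight_def o_def inj_on_def\<close>)
  moreover have "(UNIV :: int set) = range int \<union> range (\<lambda>n. - int n)"
  proof -
    have "x \<in> range int \<union> range (\<lambda>n. - int n)" for x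
    proof (cases "x \<ge> 0")
      case True
      then have "x = int (nat x)" by simp
      then show ?thesis by blast
    next
      case False
      then have "x = - int (nat (- x))" by simp
      then show ?thesis by blast
    qed
    then show ?thesis by blast
  qed
  ultimately show ?thesis by (metis summable_on_union)
qed

lemma half_weight_pos: "half_weight x > 0"
proof -
  have "1 + \<bar>real_of_int x\<bar> > 0" by linarith
  then show ?thesis by (simp add: half_weight_def)
qed

lemma half_weight_prod_summable: "(\<lambda>(x, y). half_weight x * half_weight y) summable_on UNIV"
proof -
  have "(\<lambda>(x, y). half_weight x * half_weight y) summable_on (SIGMA x:UNIV. UNIV)"
  proof (rule summable_on_SigmaI)
    show "((\<lambda>y. case (x, y) of (x, y) \<Rightarrow> half_weight x * half_weight y)
        has_sum (half_weight x * infsum half_weight UNIV)) UNIV" for x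
      by (simp add: has_sum_cmult_right half_weight_summable)
    show "(\<lambda>x. half_weight x * infsum half_weight UNIV) summable_on UNIV"
      by (intro summable_on_cmult_left half_weight_summable)
  qed (auto intro!: mult_nonneg_nonneg less_imp_le[OF half_weight_pos])
  then show ?thesis by simp
qed

text \<open>If y is large compared with x, the real part is at least half of
  \<open>\<bar>y\<bar>\<close>; otherwise the imaginary part, of size
  \<open>\<bar>x\<bar> * Im \<tau>\<close>, is comparable with the maximum.\<close>

lemma lattice_lower_bound:
  assumes "Im \<tau> > 0"
  obtains \<delta> where "\<delta> > 0" "\<And>x y. \<delta> * max \<bar>of_int x\<bar> \<bar>of_int y\<bar> \<le> norm (of_int x * \<tau> + of_int y)"
proof
  define \<delta> where "\<delta> = min (Im \<tau> / (2 * (\<bar>Re \<tau>\<bar> + 1))) (1/2)"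
  show "\<delta> > 0" using assms by (simp add: \<delta>_def)
  fix x y :: int
  define X Y where "X = real_of_int x" and "Y = real_of_int y"
  have 1: "\<bar>X\<bar> * Im \<tau> \<le> norm (of_int x * \<tau> + of_int y)"
    using abs_Im_le_cmod[of "of_int x * \<tau> + of_int y"] assms by (simp add: abs_mult X_def)
  have 2: "\<bar>Y\<bar> - \<bar>X\<bar> * \<bar>Re \<tau>\<bar> \<le> norm (of_int x * \<tau> + of_int y)"
    using abs_Re_le_cmod[of "of_int x * \<tau> + of_int y"] by (simp add: X_def Y_def flip: abs_mult)
  show "\<delta> * max \<bar>of_int x\<bar> \<bar>of_int y\<bar> \<le> norm (of_int x * \<tau> + of_int y)"
    unfolding X_def[symmetric] Y_def[symmetric]
  proof (cases "2 * \<bar>X\<bar> * (\<bar>Re \<tau>\<bar> + 1) \<le> \<bar>Y\<bar>")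
    case True
    then have h: "2 * \<bar>X\<bar> + 2 * (\<bar>X\<bar> * \<bar>Re \<tau>\<bar>) \<le> \<bar>Y\<bar>" by (simp add: algebra_simps)
    have "0 \<le> \<bar>X\<bar> * \<bar>Re \<tau>\<bar>" by simp
    with h have m: "max \<bar>X\<bar> \<bar>Y\<bar> = \<bar>Y\<bar>" by linarith
    have "\<delta> \<le> 1/2" unfolding \<delta>_def by (rule min.cobounded2)
    then have "\<delta> * \<bar>Y\<bar> \<le> 1/2 * \<bar>Y\<bar>" by (intro mult_right_mono) auto
    with h 2 show "\<delta> * max \<bar>X\<bar> \<bar>Y\<bar> \<le> norm (of_int x * \<tau> + of_int y)" unfolding m by linarith
  next
    case False
    have "\<bar>X\<bar> * 1 \<le> \<bar>X\<bar> * (2 * (\<bar>Re \<tau>\<bar> + 1))" by (intro mult_left_mono) auto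
    with False have m: "max \<bar>X\<bar> \<bar>Y\<bar> \<le> 2 * (\<bar>Re \<tau>\<bar> + 1) * \<bar>X\<bar>" by (simp add: algebra_simps)
    have "\<delta> * max \<bar>X\<bar> \<bar>Y\<bar> \<le> Im \<tau> / (2 * (\<bar>Re \<tau>\<bar> + 1)) * (2 * (\<bar>Re \<tau>\<bar> + 1) * \<bar>X\<bar>)"
      using assms by (intro mult_mono m) (auto simp: \<delta>_def)
    also have "\<dots> = \<bar>X\<bar> * Im \<tau>" by (simp add: field_simps)
    also note 1
    finally show "\<delta> * max \<bar>X\<bar> \<bar>Y\<bar> \<le> norm (of_int x * \<tau> + of_int y)" .
  qed
qed

lemma powr_minus_three_halves:
  fixes u :: real
  assumes "u > 0"
  shows "(u powr (-3/2))\<^sup>2 = 1 / u ^ 3"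
proof -
  have "(u powr (-3/2))\<^sup>2 = u powr (-3)"
    by (simp add: power2_eq_square flip: powr_add)
  also have "\<dots> = 1 / u ^ 3" using assms by (simp add: powr_minus_divide powr_numeral)
  finally show ?thesis .
qed

lemma lattice_cube_bound:
  assumes "Im \<tau> > 0"
  obtains C where "C > 0" "\<And>x y. (x, y) \<noteq> (0, 0) \<Longrightarrow>
      1 / norm (of_int x * \<tau> + of_int y) ^ 3 \<le> C * (half_weight x * half_weight y)"
    "\<And>x y. (x, y) \<noteq> (0, 0) \<Longrightarrow> 1 / norm (of_int x * \<tau> + of_int y) ^ 2 \<le> C * half_weight x"
    "\<And>x y. (x, y) \<noteq> (0, 0) \<Longrightarrow> 1 / norm (of_int x * \<tau> + of_int y) ^ 2 \<le> C * half_weight y"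
proof -
  from lattice_lower_bound[OF assms] obtain \<delta> where \<delta>: "\<delta> > 0"
    "\<And>x y. \<delta> * max \<bar>of_int x\<bar> \<bar>of_int y\<bar> \<le> norm (of_int x * \<tau> + of_int y)" by blast
  have low: "\<delta> / 2 * (1 + \<bar>of_int x\<bar>) \<le> norm (of_int x * \<tau> + of_int y)"
    "\<delta> / 2 * (1 + \<bar>of_int y\<bar>) \<le> norm (of_int x * \<tau> + of_int y)" if "(x, y) \<noteq> (0, 0)" for x y
  proof -
    define m where "m = max \<bar>real_of_int x\<bar> \<bar>of_int y\<bar>"
    have "1 \<le> \<bar>x\<bar> \<or> 1 \<le> \<bar>y\<bar>" using that by auto
    then have "1 \<le> \<bar>real_of_int x\<bar> \<or> 1 \<le> \<bar>real_of_int y\<bar>" by linarith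
    then have "1 + \<bar>of_int x\<bar> \<le> 2 * m" "1 + \<bar>of_int y\<bar> \<le> 2 * m" by (auto simp: m_def)
    then have "\<delta> / 2 * (1 + \<bar>of_int x\<bar>) \<le> \<delta> / 2 * (2 * m)" "\<delta> / 2 * (1 + \<bar>of_int y\<bar>) \<le> \<delta> / 2 * (2 * m)"
      using \<delta> by (intro mult_left_mono; simp)+
    with \<delta>(2)[of x y] show "\<delta> / 2 * (1 + \<bar>of_int x\<bar>) \<le> norm (of_int x * \<tau> + of_int y)"
      "\<delta> / 2 * (1 + \<bar>of_int y\<bar>) \<le> norm (of_int x * \<tau> + of_int y)"
      by (simp_all add: m_def)
  qed
  define C where "C = max ((2 / \<delta>) ^ 3) ((2 / \<delta>) ^ 2)"
  have C: "C > 0" using \<delta> by (simp add: C_def less_max_iff_disj)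
  have cube: "1 / norm (of_int x * \<tau> + of_int y) ^ 3 \<le> C * (half_weight x * half_weight y)"
    if xy: "(x, y) \<noteq> (0, 0)" for x y
  proof -
    define N where "N = norm (of_int x * \<tau> + of_int y)"
    have X: "\<delta> / 2 * (1 + \<bar>of_int x\<bar>) > 0" and Y: "\<delta> / 2 * (1 + \<bar>of_int y\<bar>) > 0"
      using \<delta> by (intro mult_pos_pos; linarith)+
    have N: "N > 0" unfolding N_def by (rule less_le_trans[OF X low(1)[OF xy]])
    \<comment> \<open>The inverse cube is its square root times itself; one root is charged to x,
      the other to y.\<close>
    have hx: "sqrt (1 / N ^ 3) \<le> sqrt ((2 / \<delta>) ^ 3) * half_weight z"
      if z: "\<delta> / 2 * (1 + \<bar>of_int z\<bar>) \<le> N" for z :: int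
    proof -
      have Z: "1 + \<bar>real_of_int z\<bar> > 0" by linarith
      have "N ^ 3 \<ge> (\<delta> / 2 * (1 + \<bar>of_int z\<bar>)) ^ 3"
        using z Z \<delta> by (intro power_mono) auto
      then have "1 / N ^ 3 \<le> 1 / (\<delta> / 2 * (1 + \<bar>of_int z\<bar>)) ^ 3"
        using Z \<delta> N by (intro divide_left_mono) auto
      also have "\<dots> = (2 / \<delta>) ^ 3 * (half_weight z)\<^sup>2"
        unfolding half_weight_def powr_minus_three_halves[OF Z] using \<delta>
        by (simp add: power_mult_distrib power_divide)
      finally have "sqrt (1 / N ^ 3) \<le> sqrt ((2 / \<delta>) ^ 3 * (half_weight z)\<^sup>2)" by simp
      also have "\<dots> = sqrt ((2 / \<delta>) ^ 3) * half_weight z"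
        using half_weight_pos[of z] by (simp add: real_sqrt_mult)
      finally show ?thesis .
    qed
    have "1 / N ^ 3 = sqrt (1 / N ^ 3) * sqrt (1 / N ^ 3)" using N by simp
    also have "\<dots> \<le> (sqrt ((2 / \<delta>) ^ 3) * half_weight x) * (sqrt ((2 / \<delta>) ^ 3) * half_weight y)"
      using low[OF xy] N \<delta> half_weight_pos by (intro mult_mono hx) (auto simp: N_def less_imp_le)
    also have "\<dots> = (sqrt ((2 / \<delta>) ^ 3) * sqrt ((2 / \<delta>) ^ 3)) * (half_weight x * half_weight y)"
      by (simp only: mult_ac)
    also have "\<dots> = (2 / \<delta>) ^ 3 * (half_weight x * half_weight y)" using \<delta> by simp
    also have "\<dots> \<le> C * (half_weight x * half_weight y)"
      using half_weight_pos by (intro mult_right_mono mult_nonneg_nonneg) (auto simp: C_def less_imp_le)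
    finally show ?thesis by (simp add: N_def)
  qed
  have square: "1 / N ^ 2 \<le> C * half_weight z" if z: "\<delta> / 2 * (1 + \<bar>of_int z\<bar>) \<le> N" for N and z :: int
  proof -
    define u where "u = 1 + \<bar>real_of_int z\<bar>"
    have u: "u \<ge> 1" "u > 0" by (auto simp: u_def)
    have N: "N > 0" using z u(2) \<delta> unfolding u_def[symmetric] by (meson half_gt_zero less_le_trans mult_pos_pos)
    have "1 / N ^ 2 \<le> 1 / (\<delta> / 2 * u) ^ 2"
      using z u \<delta> N unfolding u_def[symmetric] by (intro divide_left_mono power_mono) auto
    also have "\<dots> = (2 / \<delta>) ^ 2 * u powr (-2)"
      using u \<delta> by (simp add: power_mult_distrib power_divide powr_minus_divide powr_numeral)
    \<comment> \<open>The exponent -2 may be weakened to -3/2 because u \<ge> 1; the single rows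
      then use the same weight as the double sum.\<close>
    also have "\<dots> \<le> C * u powr (-3/2)"
      using u C by (intro mult_mono powr_mono) (auto simp: C_def)
    finally show ?thesis by (simp add: half_weight_def u_def)
  qed
  show ?thesis using that[OF C cube] square low by blast
qed

definition level5_term :: "int \<times> int \<Rightarrow> complex \<Rightarrow> int \<times> int \<Rightarrow> complex" where
  "level5_term s \<tau> = (\<lambda>(m, n). 1 / (of_int (5 * m + fst s) * \<tau> + of_int (5 * n + snd s))\<^sup>2)"

text \<open>Up to the factor \<open>25\<close> this is the difference of the values of the Weierstrass function of the
  lattice \<open>Z \<tau> + Z\<close> at the \<open>5\<close>-division points \<open>(s\<^sub>1 \<tau> + s\<^sub>2) / 5\<close> and \<open>(t\<^sub>1 \<tau> + t\<^sub>2) / 5\<close>.\<close>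
definition wp_diff :: "int \<times> int \<Rightarrow> int \<times> int \<Rightarrow> complex \<Rightarrow> complex" where
  "wp_diff s t \<tau> = (\<Sum>\<^sub>\<infinity>p. level5_term s \<tau> p - level5_term t \<tau> p)"

text \<open>The division point with coordinates s / 5 is not a lattice point, so no denominator of
  \<open>level5_term\<close> vanishes.\<close>

definition nonzero5 :: "int \<times> int \<Rightarrow> bool" where
  "nonzero5 s \<longleftrightarrow> \<not> (5 dvd fst s \<and> 5 dvd snd s)"

lemma nonzero5_index: "nonzero5 s \<Longrightarrow> (5 * m + fst s, 5 * n + snd s) \<noteq> (0, 0)"
  unfolding nonzero5_def by (auto simp: prod_eq_iff) presburger+

lemma level5_denom_nonzero:
  assumes "Im \<tau> > 0" "nonzero5 s"
  shows "of_int (5 * m + fst s) * \<tau> + of_int (5 * n + snd s) \<noteq> 0"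
proof
  assume *: "of_int (5 * m + fst s) * \<tau> + of_int (5 * n + snd s) = 0"
  then have "Im (of_int (5 * m + fst s) * \<tau> + of_int (5 * n + snd s)) = 0" by simp
  then have "real_of_int (5 * m + fst s) = 0" using assms(1) by simp
  then have 0: "5 * m + fst s = 0" by linarith
  with * have "5 * n + snd s = 0" by (metis add_0 mult_zero_left of_int_0 of_int_eq_0_iff)
  with 0 nonzero5_index[OF assms(2)] show False by blast
qed

lemma inj_level5_index: "inj (\<lambda>(m, n). (5 * m + a, 5 * n + b :: int))" for a :: int
  by (auto simp: inj_on_def)

lemma summable_on_affine_weight: "(\<lambda>n. half_weight (5 * n + a)) summable_on UNIV"
proof -
  have "half_weight summable_on range (\<lambda>n. 5 * n + a)"
    by (rule summable_on_subset_banach[OF half_weight_summable]) auto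
  then show ?thesis by (subst (asm) summable_on_reindex) (auto simp: inj_on_def o_def)
qed

lemma level5_row_summable:
  assumes "Im \<tau> > 0" "nonzero5 s"
  shows "(\<lambda>n. level5_term s \<tau> (m, n)) summable_on UNIV"
    and "(\<lambda>m. level5_term s \<tau> (m, n)) summable_on UNIV"
proof -
  obtain C where C: "\<And>x y. (x, y) \<noteq> (0, 0) \<Longrightarrow> 1 / norm (of_int x * \<tau> + of_int y) ^ 2 \<le> C * half_weight x"
    "\<And>x y. (x, y) \<noteq> (0, 0) \<Longrightarrow> 1 / norm (of_int x * \<tau> + of_int y) ^ 2 \<le> C * half_weight y"
    using lattice_cube_bound[OF assms(1)] by metis
  have nrm: "norm (level5_term s \<tau> (m, n)) = 1 / norm (of_int (5 * m + fst s) * \<tau> + of_int (5 * n + snd s)) ^ 2" for m n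
    by (simp add: level5_term_def norm_divide norm_power)
  show "(\<lambda>n. level5_term s \<tau> (m, n)) summable_on UNIV"
  proof (rule abs_summable_summable, rule summable_on_comparison_test)
    show "(\<lambda>n. C * half_weight (5 * n + snd s)) summable_on UNIV"
      by (intro summable_on_cmult_right summable_on_affine_weight)
  qed (use C(2)[OF nonzero5_index[OF assms(2)]] nrm in auto)
  show "(\<lambda>m. level5_term s \<tau> (m, n)) summable_on UNIV"
  proof (rule abs_summable_summable, rule summable_on_comparison_test)
    show "(\<lambda>m. C * half_weight (5 * m + fst s)) summable_on UNIV"
      by (intro summable_on_cmult_right summable_on_affine_weight)
  qed (use C(1)[OF nonzero5_index[OF assms(2)]] nrm in auto)
qed

text \<open>Inverse squares over a lattice are not absolutely summable, but the two denominators
  differ by the fixed vector \<open>\<eta>\<close>, so the difference of the terms has cubic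
  decay.\<close>

lemma wp_diff_summable:
  assumes \<tau>: "Im \<tau> > 0" and s: "nonzero5 s" and t: "nonzero5 t"
  shows "(\<lambda>p. level5_term s \<tau> p - level5_term t \<tau> p) summable_on UNIV"
proof -
  obtain C where C: "C > 0" "\<And>x y. (x, y) \<noteq> (0, 0) \<Longrightarrow>
      1 / norm (of_int x * \<tau> + of_int y) ^ 3 \<le> C * (half_weight x * half_weight y)"
    using lattice_cube_bound[OF \<tau>] by metis
  define U where "U = (\<lambda>s (m, n). of_int (5 * m + fst s) * \<tau> + of_int (5 * n + snd s))"
  define W where "W = (\<lambda>s (m, n). half_weight (5 * m + fst s) * half_weight (5 * n + snd s))"
  have Wsum: "W s summable_on UNIV" for s
  proof -
    have "(\<lambda>(x, y). half_weight x * half_weight y) summable_on range (\<lambda>(m, n). (5 * m + fst s, 5 * n + snd s))"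
      by (rule summable_on_subset_banach[OF half_weight_prod_summable]) auto
    then show ?thesis
      by (subst (asm) summable_on_reindex[OF inj_level5_index]) (simp add: o_def W_def case_prod_unfold)
  qed
  have cube: "1 / norm (U s p) ^ 3 \<le> C * W s p" if "nonzero5 s" for s p
    using C(2)[OF nonzero5_index[OF that, of "fst p" "snd p"]]
    by (simp add: U_def W_def case_prod_unfold)
  define \<eta> where "\<eta> = of_int (fst t - fst s) * \<tau> + of_int (snd t - snd s)"
  have bound: "norm (level5_term s \<tau> p - level5_term t \<tau> p) \<le> norm \<eta> * (C * W s p + C * W t p)" for p
  proof -
    define u v where "u = U s p" and "v = U t p"
    have u: "u \<noteq> 0" and v: "v \<noteq> 0"
      using level5_denom_nonzero[OF \<tau> s] level5_denom_nonzero[OF \<tau> t]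
      by (auto simp: u_def v_def U_def case_prod_unfold)
    have \<eta>: "\<eta> = v - u" by (simp add: \<eta>_def u_def v_def U_def case_prod_unfold algebra_simps)
    define a b where "a = 1 / norm u" and "b = 1 / norm v"
    have ab: "a > 0" "b > 0" using u v by (auto simp: a_def b_def)
    have "level5_term s \<tau> p - level5_term t \<tau> p = 1 / u\<^sup>2 - 1 / v\<^sup>2"
      by (simp add: level5_term_def u_def v_def U_def case_prod_unfold)
    also have "\<dots> = \<eta> * (1 / (u * v\<^sup>2) + 1 / (u\<^sup>2 * v))"
      unfolding \<eta> using u v by (simp add: field_simps power2_eq_square)
    finally have "norm (level5_term s \<tau> p - level5_term t \<tau> p) \<le> norm \<eta> * (norm (1 / (u * v\<^sup>2)) + norm (1 / (u\<^sup>2 * v)))"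
      by (simp add: norm_mult mult_left_mono norm_triangle_ineq del: norm_divide)
    also have "norm (1 / (u * v\<^sup>2)) + norm (1 / (u\<^sup>2 * v)) = a * b\<^sup>2 + a\<^sup>2 * b"
      by (simp add: a_def b_def norm_divide norm_mult norm_power power_divide)
    \<comment> \<open>Mixed cubic terms give way to pure cubes, each of which has the weights of its
      own shifted lattice.\<close>
    also have "a * b\<^sup>2 + a\<^sup>2 * b \<le> a ^ 3 + b ^ 3"
    proof -
      have "0 \<le> (a + b) * (a - b)\<^sup>2" using ab by simp
      also have "\<dots> = a ^ 3 + b ^ 3 - (a * b\<^sup>2 + a\<^sup>2 * b)"
        by (simp add: power2_eq_square power3_eq_cube algebra_simps)
      finally show ?thesis by simp
    qed
    also have "a ^ 3 + b ^ 3 \<le> C * W s p + C * W t p"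
      using cube[OF s, of p] cube[OF t, of p] by (simp add: a_def b_def u_def v_def power_divide)
    finally show ?thesis by (simp add: mult_left_mono)
  qed
  show ?thesis
  proof (rule abs_summable_summable, rule summable_on_comparison_test)
    show "(\<lambda>p. norm \<eta> * (C * W s p + C * W t p)) summable_on UNIV"
      by (intro summable_on_cmult_right summable_on_add Wsum)
  qed (use bound in auto)
qed

lemma wp_diff_add:
  assumes "Im \<tau> > 0" "nonzero5 s" "nonzero5 t" "nonzero5 u"
  shows "wp_diff s t \<tau> + wp_diff t u \<tau> = wp_diff s u \<tau>"
  unfolding wp_diff_def
  by (subst infsum_add[symmetric]) (use wp_diff_summable assms in auto)

lemma wp_diff_swap: "wp_diff t s \<tau> = - wp_diff s t \<tau>"
  unfolding wp_diff_def by (subst infsum_uminus[symmetric]) simp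

lemma infsum_translate_diff:
  fixes f :: "int \<Rightarrow> complex"
  assumes "f summable_on UNIV"
  shows "(\<Sum>\<^sub>\<infinity>n. f (n + w) - f n) = 0"
proof -
  have bij: "bij_betw (\<lambda>n. n + w) UNIV (UNIV :: int set)"
    by (rule bij_betwI[where g = "\<lambda>n. n - w"]) auto
  have "(\<lambda>n. f (n + w)) summable_on UNIV"
    using summable_on_reindex_bij_betw[OF bij, of f] assms by simp
  moreover have "(\<Sum>\<^sub>\<infinity>n. f (n + w)) = infsum f UNIV"
    using infsum_reindex_bij_betw[OF bij, of f] by simp
  ultimately show ?thesis
    using infsum_add[of "\<lambda>n. f (n + w)" UNIV "\<lambda>n. - f n"] assms by (simp add: infsum_uminus summable_on_uminus)
qed

text \<open>The double series only converges as a series of differences; summing first in the direction of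
  the translation makes the inner sums telescope.\<close>
lemma wp_diff_translate_snd:
  assumes \<tau>: "Im \<tau> > 0" and s: "nonzero5 s"
  shows "wp_diff (fst s, snd s + 5 * w) s \<tau> = 0"
proof -
  have t: "nonzero5 (fst s, snd s + 5 * w)" using s unfolding nonzero5_def fst_conv snd_conv by presburger
  have eq: "level5_term (fst s, snd s + 5 * w) \<tau> (m, n) = level5_term s \<tau> (m, n + w)" for m n
    by (simp add: level5_term_def algebra_simps)
  have "wp_diff (fst s, snd s + 5 * w) s \<tau>
     = (\<Sum>\<^sub>\<infinity>m. \<Sum>\<^sub>\<infinity>n. level5_term (fst s, snd s + 5 * w) \<tau> (m, n) - level5_term s \<tau> (m, n))"
    unfolding wp_diff_def
    using infsum_Sigma_banach[of "\<lambda>p. level5_term (fst s, snd s + 5 * w) \<tau> p - level5_term s \<tau> p" UNIV "\<lambda>_. UNIV"]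
      wp_diff_summable[OF \<tau> t s] by simp
  also have "\<dots> = 0"
    unfolding eq using infsum_translate_diff[OF level5_row_summable(1)[OF \<tau> s]] by simp
  finally show ?thesis .
qed

lemma wp_diff_translate_fst:
  assumes \<tau>: "Im \<tau> > 0" and s: "nonzero5 s"
  shows "wp_diff (fst s + 5 * w, snd s) s \<tau> = 0"
proof -
  have t: "nonzero5 (fst s + 5 * w, snd s)" using s unfolding nonzero5_def fst_conv snd_conv by presburger
  have eq: "level5_term (fst s + 5 * w, snd s) \<tau> (m, n) = level5_term s \<tau> (m + w, n)" for m n
    by (simp add: level5_term_def algebra_simps)
  have "wp_diff (fst s + 5 * w, snd s) s \<tau>
     = (\<Sum>\<^sub>\<infinity>m. \<Sum>\<^sub>\<infinity>n. level5_term (fst s + 5 * w, snd s) \<tau> (m, n) - level5_term s \<tau> (m, n))"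
    unfolding wp_diff_def
    using infsum_Sigma_banach[of "\<lambda>p. level5_term (fst s + 5 * w, snd s) \<tau> p - level5_term s \<tau> p" UNIV "\<lambda>_. UNIV"]
      wp_diff_summable[OF \<tau> t s] by simp
  \<comment> \<open>A shift of the first coordinate telescopes along m, so the order of summation is
    exchanged; summability over pairs permits it.\<close>
  also have "\<dots> = (\<Sum>\<^sub>\<infinity>n. \<Sum>\<^sub>\<infinity>m. level5_term (fst s + 5 * w, snd s) \<tau> (m, n) - level5_term s \<tau> (m, n))"
    using wp_diff_summable[OF \<tau> t s] by (intro infsum_swap_banach) (simp add: case_prod_unfold)
  also have "\<dots> = 0"
    unfolding eq using infsum_translate_diff[OF level5_row_summable(2)[OF \<tau> s]] by simp
  finally show ?thesis .
qed

lemma bij_uminus_pair: "bij (\<lambda>p::int \<times> int. (- fst p, - snd p))"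
  by (rule bij_betw_byWitness[where f' = "\<lambda>p. (- fst p, - snd p)"]) auto

text \<open>The Weierstrass function is even: replacing the summation index p by its negative
  changes the sign of the series of differences.\<close>

lemma wp_diff_uminus:
  assumes "Im \<tau> > 0" "nonzero5 s"
  shows "wp_diff (- fst s, - snd s) s \<tau> = 0"
proof -
  define \<phi> where "\<phi> = (\<lambda>p. level5_term (- fst s, - snd s) \<tau> p - level5_term s \<tau> p)"
  have neg: "level5_term (- fst s, - snd s) \<tau> (m, n) = level5_term s \<tau> (- m, - n)" for m n
  proof -
    have "of_int (5 * m + - fst s) * \<tau> + of_int (5 * n + - snd s) =
        - (of_int (5 * - m + fst s) * \<tau> + of_int (5 * - n + snd s))"
      by (simp add: algebra_simps)
    then show ?thesis unfolding level5_term_def split fst_conv snd_conv by (simp only: power2_minus)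
  qed
  have odd: "\<phi> (- fst p, - snd p) = - \<phi> p" for p
    by (cases p) (simp add: \<phi>_def neg)
  have "infsum \<phi> UNIV = (\<Sum>\<^sub>\<infinity>p. \<phi> (- fst p, - snd p))"
    by (rule infsum_reindex_bij_betw[OF bij_uminus_pair, symmetric])
  also have "\<dots> = - infsum \<phi> UNIV" unfolding odd by (rule infsum_uminus)
  finally have "infsum \<phi> UNIV = 0" by simp
  then show ?thesis by (simp add: wp_diff_def \<phi>_def)
qed

text \<open>Periodicity and evenness of the Weierstrass function. The coordinates are shifted one at
  a time, and for the opposite sign the negative of s is inserted in between.\<close>

lemma wp_diff_eq_0:
  assumes \<tau>: "Im \<tau> > 0" and s: "nonzero5 s"
    and "5 dvd fst s' - fst s \<and> 5 dvd snd s' - snd s \<or> 5 dvd fst s' + fst s \<and> 5 dvd snd s' + snd s"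
  shows "wp_diff s' s \<tau> = 0"
proof -
  have *: "wp_diff s' s \<tau> = 0" if s: "nonzero5 s" and c: "5 dvd fst s' - fst s" "5 dvd snd s' - snd s" for s
  proof -
    obtain v where v: "fst s' = fst s + 5 * v" using c(1) by (metis dvdE add.commute diff_add_cancel)
    obtain w where w: "snd s' = snd s + 5 * w" using c(2) by (metis dvdE add.commute diff_add_cancel)
    have s': "s' = (fst s + 5 * v, snd s + 5 * w)" using v w by (simp add: prod_eq_iff)
    have t: "nonzero5 (fst s + 5 * v, snd s)" "nonzero5 (fst s + 5 * v, snd s + 5 * w)"
      using s unfolding nonzero5_def fst_conv snd_conv by presburger+
    have "wp_diff s' s \<tau> = wp_diff s' (fst s + 5 * v, snd s) \<tau> + wp_diff (fst s + 5 * v, snd s) s \<tau>"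
      using t s' wp_diff_add[OF \<tau> _ t(1) s] by simp
    also have "\<dots> = 0"
      using wp_diff_translate_fst[OF \<tau> s, of v] wp_diff_translate_snd[OF \<tau> t(1), of w] s' by simp
    finally show ?thesis .
  qed
  have n: "nonzero5 (- fst s, - snd s)" using s by (simp add: nonzero5_def)
  from assms(3) show ?thesis
  proof
    assume c: "5 dvd fst s' + fst s \<and> 5 dvd snd s' + snd s"
    then have n': "nonzero5 s'" using s unfolding nonzero5_def by presburger
    have "wp_diff s' s \<tau> = wp_diff s' (- fst s, - snd s) \<tau> + wp_diff (- fst s, - snd s) s \<tau>"
      using wp_diff_add[OF \<tau> n' n s] by simp
    then show ?thesis using *[OF n] c wp_diff_uminus[OF \<tau> s] by simp
  qed (use *[OF s] in blast)
qed

lemma wp_diff_cong: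
  assumes \<tau>: "Im \<tau> > 0" and s: "nonzero5 s" and t: "nonzero5 t"
    and s': "5 dvd fst s' - fst s \<and> 5 dvd snd s' - snd s \<or> 5 dvd fst s' + fst s \<and> 5 dvd snd s' + snd s"
    and t': "5 dvd fst t' - fst t \<and> 5 dvd snd t' - snd t \<or> 5 dvd fst t' + fst t \<and> 5 dvd snd t' + snd t"
  shows "wp_diff s' t' \<tau> = wp_diff s t \<tau>"
proof -
  have ns: "nonzero5 s'" and nt: "nonzero5 t'"
    using s t s' t' unfolding nonzero5_def by presburger+
  have "wp_diff s' t' \<tau> = wp_diff s' s \<tau> + (wp_diff s t \<tau> + wp_diff t t' \<tau>)"
    using wp_diff_add[OF \<tau>] ns nt s t by simp
  also have "\<dots> = wp_diff s t \<tau>"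
    using wp_diff_eq_0[OF \<tau> s s'] wp_diff_eq_0[OF \<tau> t t'] wp_diff_swap[of t t'] by simp
  finally show ?thesis .
qed

lemma bij_det_1:
  assumes "a * d - b * c = (1::int)"
  shows "bij (\<lambda>p. (fst p * a + snd p * c, fst p * b + snd p * d))"
proof (rule bij_betw_byWitness[where f' = "\<lambda>p. (fst p * d - snd p * c, snd p * a - fst p * b)"])
  have 1: "(m * a + n * c) * d - (m * b + n * d) * c = m * (a * d - b * c)"
    "(m * b + n * d) * a - (m * a + n * c) * b = n * (a * d - b * c)"
    "(m * d - n * c) * a + (n * a - m * b) * c = m * (a * d - b * c)"
    "(m * d - n * c) * b + (n * a - m * b) * d = n * (a * d - b * c)" for m n
    by (simp_all add: algebra_simps)
  show "\<forall>p\<in>UNIV. (fst (fst p * a + snd p * c, fst p * b + snd p * d) * d - snd (fst p * a + snd p * c, fst p * b + snd p * d) * c,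
      snd (fst p * a + snd p * c, fst p * b + snd p * d) * a - fst (fst p * a + snd p * c, fst p * b + snd p * d) * b) = p"
    unfolding fst_conv snd_conv 1 assms by simp
  show "\<forall>p\<in>UNIV. (fst (fst p * d - snd p * c, snd p * a - fst p * b) * a + snd (fst p * d - snd p * c, snd p * a - fst p * b) * c,
      fst (fst p * d - snd p * c, snd p * a - fst p * b) * b + snd (fst p * d - snd p * c, snd p * a - fst p * b) * d) = p"
    unfolding fst_conv snd_conv 1 assms by simp
qed auto

text \<open>The coefficients (5 m + s1, 5 n + s2) form a row vector on which the matrix acts from
  the right. This permutes the indices (m, n), moves s to s times the matrix, and gives each term
  the square of the automorphy factor.\<close>

lemma wp_diff_moeb:
  assumes det: "a * d - b * c = 1" and \<tau>: "of_int c * \<tau> + of_int d \<noteq> 0"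
  shows "wp_diff s t (moeb a b c d \<tau>) = (of_int c * \<tau> + of_int d)\<^sup>2 *
    wp_diff (fst s * a + snd s * c, fst s * b + snd s * d) (fst t * a + snd t * c, fst t * b + snd t * d) \<tau>"
proof -
  define J where "J = of_int c * \<tau> + of_int d"
  define \<gamma> where "\<gamma> = (\<lambda>p::int \<times> int. (fst p * a + snd p * c, fst p * b + snd p * d))"
  have term_moeb: "level5_term s (moeb a b c d \<tau>) p = J\<^sup>2 * level5_term (\<gamma> s) \<tau> (\<gamma> p)" for s p
  proof -
    obtain m n where p: "p = (m, n)" by (cases p)
    have "of_int (5 * m + fst s) * moeb a b c d \<tau> + of_int (5 * n + snd s) =
      (of_int (5 * m + fst s) * (of_int a * \<tau> + of_int b) + of_int (5 * n + snd s) * J) / J"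
      using \<tau> unfolding moeb_def J_def[symmetric] by (simp add: add_divide_distrib distrib_left)
    also have "of_int (5 * m + fst s) * (of_int a * \<tau> + of_int b) + of_int (5 * n + snd s) * J =
      of_int (5 * (m * a + n * c) + (fst s * a + snd s * c)) * \<tau> + of_int (5 * (m * b + n * d) + (fst s * b + snd s * d))"
      by (simp add: J_def algebra_simps)
    finally show ?thesis
      by (simp add: level5_term_def \<gamma>_def p power_divide del: of_int_add of_int_mult)
  qed
  have "wp_diff s t (moeb a b c d \<tau>) =
      (\<Sum>\<^sub>\<infinity>p. J\<^sup>2 * (level5_term (\<gamma> s) \<tau> (\<gamma> p) - level5_term (\<gamma> t) \<tau> (\<gamma> p)))"
    unfolding wp_diff_def term_moeb by (simp add: right_diff_distrib)
  also have "\<dots> = J\<^sup>2 * (\<Sum>\<^sub>\<infinity>p. level5_term (\<gamma> s) \<tau> (\<gamma> p) - level5_term (\<gamma> t) \<tau> (\<gamma> p))"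
    by (rule infsum_cmult_right')
  also have "(\<Sum>\<^sub>\<infinity>p. level5_term (\<gamma> s) \<tau> (\<gamma> p) - level5_term (\<gamma> t) \<tau> (\<gamma> p)) = wp_diff (\<gamma> s) (\<gamma> t) \<tau>"
    unfolding wp_diff_def
    using infsum_reindex_bij_betw[OF bij_det_1[OF det], of "\<lambda>p. level5_term (\<gamma> s) \<tau> p - level5_term (\<gamma> t) \<tau> p"]
    by (simp add: \<gamma>_def)
  finally show ?thesis by (simp add: J_def \<gamma>_def)
qed

section \<open>Fourier expansions\<close>

text \<open>The logarithmic derivative of the reflection formula, taken for the entire function
  \<open>rGamma\<close> so that no poles interfere.\<close>

lemma Digamma_diff_reflection:
  assumes "z \<notin> \<int>"
  shows "Digamma z - Digamma (1 - z) = - of_real pi * cos (of_real pi * z) / sin (of_real pi * z :: complex)"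
proof -
  have nz: "z \<notin> \<int>\<^sub>\<le>\<^sub>0" "1 - z \<notin> \<int>\<^sub>\<le>\<^sub>0"
    using assms nonpos_Ints_subset_Ints by (auto dest: Ints_diff[OF Ints_1])
  have s0: "sin (of_real pi * z) \<noteq> 0"
    using assms by (simp add: sin_eq_0 mult.commute[of "of_real pi"]) auto
  define R where "R = rGamma z * rGamma (1 - z)"
  have R: "R = sin (of_real pi * z) / of_real pi"
    unfolding R_def by (rule rGamma_reflection_complex)
  have "((\<lambda>z. rGamma z * rGamma (1 - z)) has_field_derivative
      R * (Digamma (1 - z) - Digamma z)) (at z)"
    unfolding R_def using nz by (auto intro!: derivative_eq_intros simp: algebra_simps)
  then have "((\<lambda>z. sin (of_real pi * z) / of_real pi) has_field_derivative
      R * (Digamma (1 - z) - Digamma z)) (at z)"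
    unfolding rGamma_reflection_complex .
  moreover have "((\<lambda>z. sin (of_real pi * z) / of_real pi) has_field_derivative
      cos (of_real pi * z)) (at z)"
    by (auto intro!: derivative_eq_intros)
  ultimately have "R * (Digamma (1 - z) - Digamma z) = cos (of_real pi * z)"
    by (rule DERIV_unique)
  then show ?thesis using s0 unfolding R by (simp add: field_simps)
qed

lemma Polygamma_1_reflection:
  assumes z: "z \<notin> \<int>"
  shows "Polygamma 1 z + Polygamma 1 (1 - z) = of_real pi ^ 2 / sin (of_real pi * z :: complex) ^ 2"
proof -
  have op: "open (- \<int> :: complex set)" by (simp add: open_Compl closed_Ints)
  have nz: "z \<notin> \<int>\<^sub>\<le>\<^sub>0" "1 - z \<notin> \<int>\<^sub>\<le>\<^sub>0"
    using assms nonpos_Ints_subset_Ints by (auto dest: Ints_diff[OF Ints_1])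
  have s0: "sin (of_real pi * z) \<noteq> 0"
    using assms by (simp add: sin_eq_0 mult.commute[of "of_real pi"]) auto
  have "((\<lambda>z. Digamma z - Digamma (1 - z)) has_field_derivative
      Polygamma 1 z + Polygamma 1 (1 - z)) (at z)"
    using nz by (auto intro!: derivative_eq_intros)
  then have "((\<lambda>z. - of_real pi * cos (of_real pi * z) / sin (of_real pi * z)) has_field_derivative
      Polygamma 1 z + Polygamma 1 (1 - z)) (at z)"
    by (rule has_field_derivative_transform_within_open[OF _ op])
       (use z Digamma_diff_reflection in auto)
  moreover have "((\<lambda>z. - of_real pi * cos (of_real pi * z) / sin (of_real pi * z)) has_field_derivative
      of_real pi ^ 2 / sin (of_real pi * z) ^ 2) (at z)"
  proof -
    have "((\<lambda>z. - of_real pi * cos (of_real pi * z) / sin (of_real pi * z)) has_field_derivative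
      (of_real pi ^ 2 * sin (of_real pi * z) ^ 2 + of_real pi ^ 2 * cos (of_real pi * z) ^ 2) / sin (of_real pi * z) ^ 2) (at z)"
      using s0 by (auto intro!: derivative_eq_intros simp: power2_eq_square) (simp add: field_simps)
    also have "of_real pi ^ 2 * sin (of_real pi * z) ^ 2 + of_real pi ^ 2 * cos (of_real pi * z) ^ 2 = of_real pi ^ 2"
      by (metis distrib_left mult.right_neutral sin_cos_squared_add)
    finally show ?thesis .
  qed
  ultimately show ?thesis by (rule DERIV_unique)
qed

lemma has_sum_inverse_square_shift:
  assumes z: "(z::complex) \<notin> \<int>"
  shows "((\<lambda>k::nat. 1 / (z + of_nat k)\<^sup>2) has_sum Polygamma 1 z) UNIV"
proof (rule norm_summable_imp_has_sum)
  have "z \<noteq> 0" using z by auto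
  from Polygamma_LIMSEQ[OF this, of 1] show "(\<lambda>k. 1 / (z + of_nat k)\<^sup>2) sums Polygamma 1 z"
    by (simp add: power2_eq_square inverse_eq_divide)
  have "summable (\<lambda>k. 4 * (1 / real k ^ 2))"
    using inverse_power_summable[of 2, where 'a = real] by (intro summable_mult) (simp add: inverse_eq_divide)
  then show "summable (\<lambda>k. norm (1 / (z + of_nat k)\<^sup>2))"
  proof (rule summable_comparison_test_ev[rotated])
    have "eventually (\<lambda>k. real k \<ge> 2 * norm z + 1) sequentially"
      by (rule eventually_compose_filterlim[OF eventually_ge_at_top filterlim_real_sequentially])
    then show "eventually (\<lambda>k. norm (norm (1 / (z + of_nat k)\<^sup>2)) \<le> 4 * (1 / real k ^ 2)) sequentially"
    proof eventually_elim
      case (elim k)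
      have "real k \<le> norm (z + of_nat k) + norm z"
        by (metis norm_of_nat add.commute add_diff_cancel_right' norm_triangle_ineq4)
      then have "real k / 2 \<le> norm (z + of_nat k)" using elim by simp
      moreover have k: "real k > 0" using elim norm_ge_zero[of z] by linarith
      ultimately have "1 / norm (z + of_nat k) ^ 2 \<le> 1 / (real k / 2) ^ 2"
        by (intro divide_left_mono power_mono) (auto intro!: mult_pos_pos)
      then show ?case by (simp add: norm_divide norm_power power_divide)
    qed
  qed
qed

lemma has_sum_int_split:
  fixes f :: "int \<Rightarrow> complex"
  assumes "((\<lambda>k::nat. f (int k)) has_sum a) UNIV" "((\<lambda>k::nat. f (- 1 - int k)) has_sum b) UNIV"
  shows "(f has_sum (a + b)) UNIV"
proof -
  have "(f has_sum a) (range int)"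
    by (subst has_sum_reindex) (use assms in \<open>auto simp: o_def\<close>)
  moreover have "(f has_sum b) (range (\<lambda>k. - 1 - int k))"
    by (subst has_sum_reindex) (use assms in \<open>auto simp: o_def inj_on_def\<close>)
  moreover have "range int \<inter> range (\<lambda>k. - 1 - int k) = {}" by auto
  moreover have "range int \<union> range (\<lambda>k. - 1 - int k) = UNIV"
  proof -
    have "x \<in> range int \<union> range (\<lambda>k. - 1 - int k)" for x
    proof (cases "x \<ge> 0")
      case True
      then have "x = int (nat x)" by simp
      then show ?thesis by blast
    next
      case False
      then have "x = - 1 - int (nat (- x - 1))" by simp
      then show ?thesis by blast
    qed
    then show ?thesis by blast
  qed
  ultimately show ?thesis by (metis has_sum_Un_disjoint)
qed

text \<open>The integers n \<ge> 0 contribute \<open>Polygamma 1 z\<close> and the negative ones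
  \<open>Polygamma 1 (1 - z)\<close>; the reflection formula evaluates the total.\<close>

lemma has_sum_inverse_square_int:
  assumes z: "(z::complex) \<notin> \<int>"
  shows "((\<lambda>n::int. 1 / (z + of_int n)\<^sup>2) has_sum of_real pi ^ 2 / sin (of_real pi * z) ^ 2) UNIV"
proof -
  have z': "1 - z \<notin> \<int>" using z by (auto dest: Ints_diff[OF Ints_1])
  have *: "(1 - z + of_nat k)\<^sup>2 = (z + of_int (- 1 - int k))\<^sup>2" for k
    by (simp add: power2_eq_square algebra_simps)
  have "((\<lambda>k. 1 / (z + of_int (- 1 - int k))\<^sup>2) has_sum Polygamma 1 (1 - z)) UNIV"
    using has_sum_inverse_square_shift[OF z'] unfolding * .
  moreover have "((\<lambda>k. 1 / (z + of_int (int k))\<^sup>2) has_sum Polygamma 1 z) UNIV"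
    using has_sum_inverse_square_shift[OF z] by simp
  ultimately show ?thesis
    unfolding Polygamma_1_reflection[OF z, symmetric] by (intro has_sum_int_split)
qed

lemma sin_squared_qexp:
  "sin (of_real pi * z) ^ 2 = - ((1 - qexp z) ^ 2 / (4 * qexp z))"
proof -
  define e where "e = exp (\<i> * (of_real pi * z))"
  have e: "e \<noteq> 0" "qexp z = e\<^sup>2"
    by (simp_all add: e_def qexp_def power2_eq_square mult_ac flip: exp_add)
  have "sin (of_real pi * z) = (e - 1 / e) / (2 * \<i>)"
    by (simp add: sin_exp_eq e_def exp_minus inverse_eq_divide)
  then show ?thesis
    using e by (simp add: power_divide) (simp add: field_simps power2_eq_square)
qed

lemma qexp_neq_1: 
  assumes "z \<notin> \<int>"
  shows "qexp z \<noteq> 1"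
proof
  assume "qexp z = 1"
  then obtain n :: int where "Im (2 * of_real pi * \<i> * z) = of_int (2 * n) * pi" "Re (2 * of_real pi * \<i> * z) = 0"
    unfolding qexp_def exp_eq_1 by auto
  then have "Re z = of_int n" "Im z = 0" by auto
  then have "z = of_int n" by (simp add: complex_eq_iff)
  with assms show False by simp
qed

text \<open>Lipschitz's formula for the sum of the inverse squares of z + n. The closed form in q,
  unlike the series of k q^k, also makes sense for Im z \<le> 0, as the row m = 0 and the rows of
  negative index require.\<close>

definition lipschitz :: "complex \<Rightarrow> complex" where
  "lipschitz z = - 4 * of_real pi ^ 2 * (qexp z / (1 - qexp z)\<^sup>2)"

lemma has_sum_lipschitz:
  assumes z: "z \<notin> \<int>"
  shows "((\<lambda>n::int. 1 / (z + of_int n)\<^sup>2) has_sum lipschitz z) UNIV"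
proof -
  have "of_real pi ^ 2 / sin (of_real pi * z) ^ 2 = lipschitz z"
    unfolding sin_squared_qexp lipschitz_def using qexp_neq_1[OF z] by (simp add: field_simps)
  with has_sum_inverse_square_int[OF z] show ?thesis by simp
qed

lemma qexp_minus: "qexp (- z) = 1 / qexp z"
  by (simp add: qexp_def exp_minus inverse_eq_divide)

lemma qexp_add: "qexp (z + w) = qexp z * qexp w"
  by (simp add: qexp_def distrib_left exp_add)

lemma lipschitz_minus: "lipschitz (- z) = lipschitz z"
proof (cases "qexp z = 1")
  case False
  then show ?thesis
    unfolding lipschitz_def qexp_minus by (simp add: field_simps power2_eq_square)
qed (simp add: lipschitz_def qexp_minus)

lemma has_sum_lambert_term:
  fixes q :: "'a::{real_normed_field, banach}"
  assumes "norm q < 1"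
  shows "((\<lambda>k. of_nat k * q ^ k) has_sum q / (1 - q)\<^sup>2) {1..}"
proof -
  have "(\<lambda>k. of_nat (Suc k) * q ^ Suc k) sums (q / (1 - q)\<^sup>2)"
    using sums_mult[OF geometric_deriv_sums[OF assms], of q] by (simp add: mult_ac)
  then have "(\<lambda>k. of_nat k * q ^ k) sums (q / (1 - q)\<^sup>2)"
    using sums_Suc[of "\<lambda>k. of_nat k * q ^ k"] by simp
  moreover have "summable (\<lambda>k. norm (of_nat k * q ^ k))"
  proof -
    have "summable (\<lambda>k. norm q * (of_nat (Suc k) * norm q ^ k))"
      using geometric_deriv_sums[of "norm q"] assms by (intro summable_mult) (auto simp: sums_iff)
    then have "summable (\<lambda>k. norm (of_nat (Suc k) * q ^ Suc k))"
      by (simp add: norm_mult norm_power mult_ac del: of_nat_Suc)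
    then show ?thesis by (subst (asm) summable_Suc_iff)
  qed
  ultimately have "((\<lambda>k. of_nat k * q ^ k) has_sum q / (1 - q)\<^sup>2) UNIV"
    by (intro norm_summable_imp_has_sum)
  then show ?thesis
    by (subst has_sum_cong_neutral[where T = UNIV and g = "\<lambda>k. of_nat k * q ^ k"]) auto
qed

lemma level5_row_sum:
  assumes \<tau>: "Im \<tau> > 0" and s: "nonzero5 s"
  shows "(\<Sum>\<^sub>\<infinity>n. level5_term s \<tau> (m, n)) = lipschitz ((of_int (5 * m + fst s) * \<tau> + of_int (snd s)) / 5) / 25"
proof -
  define z where "z = (of_int (5 * m + fst s) * \<tau> + of_int (snd s)) / 5"
  have "z \<notin> \<int>"
  proof
    assume "z \<in> \<int>"
    then obtain n where "z = of_int n" by (auto elim: Ints_cases)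
    then have "of_int (5 * m + fst s) * \<tau> + of_int (5 * (- n) + snd s) = 0"
      by (simp add: z_def field_simps)
    with level5_denom_nonzero[OF \<tau> s] show False by blast
  qed
  have "level5_term s \<tau> (m, n) = 1 / (z + of_int n)\<^sup>2 / 25" for n
    by (simp add: level5_term_def z_def power_divide field_simps)
  moreover have "((\<lambda>n::int. 1 / (z + of_int n)\<^sup>2 * (1 / 25)) has_sum lipschitz z * (1 / 25)) UNIV"
    by (intro has_sum_cmult_left has_sum_lipschitz \<open>z \<notin> \<int>\<close>)
  ultimately show ?thesis by (simp add: infsumI z_def)
qed

text \<open>Summing along n first collapses a row of each series to one value of
  \<open>lipschitz\<close>; what remains is a single series over m of differences.\<close>

lemma wp_diff_lipschitz:
  fixes s t :: "int \<times> int" and \<tau> :: complex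
  defines "h \<equiv> (\<lambda>m. lipschitz ((of_int (5 * m + fst s) * \<tau> + of_int (snd s)) / 5)
     - lipschitz ((of_int (5 * m + fst t) * \<tau> + of_int (snd t)) / 5))"
  assumes \<tau>: "Im \<tau> > 0" and s: "nonzero5 s" and t: "nonzero5 t"
  shows "h summable_on UNIV" "25 * wp_diff s t \<tau> = infsum h UNIV"
proof -
  have "(\<Sum>\<^sub>\<infinity>n. level5_term s \<tau> (m, n) - level5_term t \<tau> (m, n)) =
      (\<Sum>\<^sub>\<infinity>n. level5_term s \<tau> (m, n)) - (\<Sum>\<^sub>\<infinity>n. level5_term t \<tau> (m, n))" for m
    using infsum_add[of "\<lambda>n. level5_term s \<tau> (m, n)" UNIV "\<lambda>n. - level5_term t \<tau> (m, n)"]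
      level5_row_summable(1)[OF \<tau>] s t by (simp add: infsum_uminus summable_on_uminus)
  then have row: "(\<Sum>\<^sub>\<infinity>n. level5_term s \<tau> (m, n) - level5_term t \<tau> (m, n)) = h m * (1 / 25)" for m
    unfolding level5_row_sum[OF \<tau> s] level5_row_sum[OF \<tau> t] h_def by simp
  have sm: "(\<lambda>(m, n). level5_term s \<tau> (m, n) - level5_term t \<tau> (m, n)) summable_on Sigma UNIV (\<lambda>_. UNIV)"
    using wp_diff_summable[OF \<tau> s t] by (simp add: case_prod_unfold)
  from summable_on_Sigma_banach[OF this]
  have "(\<lambda>m. h m * (1 / 25) * 25) summable_on UNIV"
    unfolding row by (rule summable_on_cmult_left)
  then show "h summable_on UNIV" by simp
  have "wp_diff s t \<tau> = (\<Sum>\<^sub>\<infinity>m. h m * (1 / 25))"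
    using infsum_Sigma'_banach[OF sm] unfolding row by (simp add: wp_diff_def case_prod_unfold)
  also have "\<dots> = infsum h UNIV * (1 / 25)" by (rule infsum_cmult_left')
  finally have "wp_diff s t \<tau> = infsum h UNIV * (1 / 25)" .
  then show "25 * wp_diff s t \<tau> = infsum h UNIV" by (simp only: mult.commute[of 25]) simp
qed

text \<open>The target ring is left open: the same integral series is read over the complex numbers
  for analysis and over \<open>bit\<close> for reduction.\<close>

definition of_int_fps :: "int fps \<Rightarrow> 'a::comm_ring_1 fps" where
  "of_int_fps F = Abs_fps (\<lambda>n. of_int (fps_nth F n))"

lemma of_int_fps_nth [simp]: "fps_nth (of_int_fps F) n = of_int (fps_nth F n)"
  by (simp add: of_int_fps_def)

lemma of_int_fps_add: "of_int_fps (F + G) = of_int_fps F + of_int_fps G"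
  by (simp add: fps_eq_iff)

lemma of_int_fps_diff: "of_int_fps (F - G) = of_int_fps F - of_int_fps G"
  by (simp add: fps_eq_iff)

lemma of_int_fps_mult: "of_int_fps (F * G) = of_int_fps F * of_int_fps G"
  by (simp add: fps_eq_iff fps_mult_nth)

lemma of_int_fps_const: "of_int_fps (fps_const c) = fps_const (of_int c)"
  by (simp add: fps_eq_iff)

lemma of_int_fps_1: "of_int_fps 1 = 1"
  by (simp add: fps_eq_iff)

lemma of_int_fps_power: "of_int_fps (F ^ n) = of_int_fps F ^ n"
  by (induction n) (simp_all add: of_int_fps_mult of_int_fps_1)

lemma of_int_fps_sum: "of_int_fps (\<Sum>i\<in>I. F i) = (\<Sum>i\<in>I. of_int_fps (F i))"
  by (simp add: fps_eq_iff fps_sum_nth)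

text \<open>The expansion of the double sum of \<open>w m k * q ^ (m * k)\<close> over positive m
  and k, collected by \<open>N = m * k\<close>.\<close>

definition lambert :: "(nat \<Rightarrow> nat \<Rightarrow> int) \<Rightarrow> int fps" where
  "lambert w = Abs_fps (\<lambda>N. if N = 0 then 0 else \<Sum>m | m dvd N. w m (N div m))"

lemma lambert_summable:
  fixes q :: complex
  assumes q: "norm q < 1" and w: "\<And>m k. \<bar>w m k\<bar> \<le> int k"
  shows "(\<lambda>(m, k). of_int (w m k) * q ^ (m * k)) summable_on {1..} \<times> {1..}"
proof (rule abs_summable_summable, rule summable_on_comparison_test)
  define x where "x = norm q"
  have x: "0 \<le> x" "x < 1" using q by (auto simp: x_def)
  have E: "((\<lambda>k. real k * x ^ k) has_sum x / (1 - x)\<^sup>2) {1..}"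
    using has_sum_lambert_term[of x] x by simp
  have "summable (\<lambda>m. x ^ (m - 1))"
    using summable_geometric[of x] x summable_Suc_iff[of "\<lambda>m. x ^ (m - 1)"] by simp
  then have "(\<lambda>m. x ^ (m - 1)) summable_on UNIV"
    using x by (intro summable_nonneg_imp_summable_on) auto
  then have geo: "(\<lambda>m. x ^ (m - 1)) summable_on {1..}"
    by (rule summable_on_subset_banach) auto
  show "(\<lambda>(m, k). x ^ (m - 1) * (real k * x ^ k)) summable_on {1..} \<times> {1..}"
  proof (rule summable_on_SigmaI)
    show "((\<lambda>k. case (m, k) of (m, k) \<Rightarrow> x ^ (m - 1) * (real k * x ^ k))
        has_sum x ^ (m - 1) * (x / (1 - x)\<^sup>2)) {1..}" for m
      unfolding split by (intro has_sum_cmult_right E)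
    show "(\<lambda>m. x ^ (m - 1) * (x / (1 - x)\<^sup>2)) summable_on {1..}"
      by (intro summable_on_cmult_left geo)
  qed (use x in auto)
  show "norm (case p of (m, k) \<Rightarrow> of_int (w m k) * q ^ (m * k))
      \<le> (case p of (m, k) \<Rightarrow> x ^ (m - 1) * (real k * x ^ k))" if p: "p \<in> {1..} \<times> {1..}" for p
  proof -
    obtain m k where mk: "p = (m, k)" "m \<ge> 1" "k \<ge> 1" using p by auto
    obtain m' where m': "m = Suc m'" using mk by (cases m) auto
    obtain k' where k': "k = Suc k'" using mk by (cases k) auto
    \<comment> \<open>For positive m and k, \<open>m * k \<ge> (m - 1) + k\<close>; this separates
      the variables.\<close>
    have "x ^ (m * k) \<le> x ^ ((m - 1) + k)"
      using x by (intro power_decreasing) (auto simp: m' k')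
    moreover have "\<bar>real_of_int (w m k)\<bar> \<le> real k"
      using w[of m k] by linarith
    ultimately have "\<bar>real_of_int (w m k)\<bar> * x ^ (m * k) \<le> real k * x ^ ((m - 1) + k)"
      using x by (intro mult_mono) auto
    then show ?thesis by (simp add: mk norm_mult norm_power x_def power_add mult_ac)
  qed
qed auto

lemma lambert_sums:
  fixes q :: complex
  assumes q: "norm q < 1" and w: "\<And>m k. \<bar>w m k\<bar> \<le> int k"
  shows "(\<lambda>n. fps_nth (of_int_fps (lambert w)) n * q ^ n) sums
     (\<Sum>\<^sub>\<infinity>m\<in>{1..}. \<Sum>\<^sub>\<infinity>k\<in>{1..}. of_int (w m k) * q ^ (m * k))"
proof -
  define S where "S = (\<Sum>\<^sub>\<infinity>(m, k)\<in>{1..}\<times>{1..}. of_int (w m k) * q ^ (m * k))"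
  note sm = lambert_summable[OF q w]
  have S: "((\<lambda>(m, k). of_int (w m k) * q ^ (m * k)) has_sum S) ({1..} \<times> {1..})"
    unfolding S_def by (rule has_sum_infsum[OF sm])
  \<comment> \<open>Regrouping by the product N = m k makes the inner sum a finite one, over the
    divisors of N.\<close>
  have "((\<lambda>(N, m). of_int (w m (N div m)) * q ^ N) has_sum S) (Sigma {1..} (\<lambda>N. {m. m dvd N}))
    \<longleftrightarrow> ((\<lambda>(m, k). of_int (w m k) * q ^ (m * k)) has_sum S) ({1..} \<times> {1..})"
  proof (rule has_sum_reindex_bij_witness[where i = "\<lambda>(m, k). (m * k, m)" and j = "\<lambda>(N, m). (m, N div m)"])
    fix p :: "nat \<times> nat" assume "p \<in> Sigma {1..} (\<lambda>N. {m. m dvd N})"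
    then obtain m k where p: "p = (m * k, m)" "m > 0" "k > 0"
      by (auto elim!: dvdE)
    show "(case case p of (N, m) \<Rightarrow> (m, N div m) of (m, k) \<Rightarrow> (m * k, m)) = p"
      "(case p of (N, m) \<Rightarrow> (m, N div m)) \<in> {1..} \<times> {1..}"
      "(case case p of (N, m) \<Rightarrow> (m, N div m) of (m, k) \<Rightarrow> of_int (w m k) * q ^ (m * k)) =
       (case p of (N, m) \<Rightarrow> of_int (w m (N div m)) * q ^ N)"
      using p by auto
  qed (auto simp: Suc_le_eq)
  with S have "((\<lambda>(N, m). of_int (w m (N div m)) * q ^ N) has_sum S) (Sigma {1..} (\<lambda>N. {m. m dvd N}))"
    by blast
  then have "((\<lambda>N. \<Sum>m | m dvd N. of_int (w m (N div m)) * q ^ N) has_sum S) {1..}"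
    by (rule has_sum_SigmaD) (auto intro!: has_sum_finiteI)
  then have "((\<lambda>n. fps_nth (of_int_fps (lambert w)) n * q ^ n) has_sum S) UNIV"
    by (rule has_sum_cong_neutral[THEN iffD1, rotated -1])
       (auto simp: lambert_def sum_distrib_right)
  then have "(\<lambda>n. fps_nth (of_int_fps (lambert w)) n * q ^ n) sums S"
    by (rule has_sum_imp_sums)
  moreover have "S = (\<Sum>\<^sub>\<infinity>m\<in>{1..}. \<Sum>\<^sub>\<infinity>k\<in>{1..}. of_int (w m k) * q ^ (m * k))"
    unfolding S_def using infsum_Sigma_banach[OF sm] by simp
  ultimately show ?thesis by simp
qed

lemma unit_conv_lambert:
  assumes "\<And>m k. \<bar>w m k\<bar> \<le> int k"
  shows "unit_conv (of_int_fps (lambert w))"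
  by (rule unit_convI, rule sums_summable, rule lambert_sums) (use assms in auto)

lemma qser_lambert:
  assumes "\<And>m k. \<bar>w m k\<bar> \<le> int k" "Im z > 0"
  shows "qser (of_int_fps (lambert w)) z =
    (\<Sum>\<^sub>\<infinity>m\<in>{1..}. \<Sum>\<^sub>\<infinity>k\<in>{1..}. of_int (w m k) * qexp z ^ (m * k))"
  by (rule qser_eqI, rule lambert_sums) (use assms norm_qexp_less_1 in auto)

lemma chi5_abs_le_1: "\<bar>chi5 n\<bar> \<le> 1"
  by (simp add: chi5_def)

definition eis_zero :: "int fps" where
  "eis_zero = lambert (\<lambda>m k. chi5 (int m) * int k)"

text \<open>The factor 5 is forced by the row m = 0, which contributes \<open>gauss5 / 5\<close> in
  \<open>lipschitz_fifth_diff\<close>: scaling the constant term to 1 multiplies the other rows by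
  5.\<close>

definition eis_inf :: "int fps" where
  "eis_inf = 1 - fps_const 5 * lambert (\<lambda>m k. chi5 (int k) * int k)"

lemma chi5_weight_le: "\<bar>chi5 n * int k\<bar> \<le> int k"
  using mult_right_mono[OF chi5_abs_le_1[of n], of "int k"] by (simp add: abs_mult)

lemma unit_conv_eis_zero: "unit_conv (of_int_fps eis_zero)"
  unfolding eis_zero_def by (rule unit_conv_lambert) (rule chi5_weight_le)

lemma unit_conv_eis_inf: "unit_conv (of_int_fps eis_inf)"
  unfolding eis_inf_def of_int_fps_diff of_int_fps_mult of_int_fps_const of_int_fps_1
  by (intro unit_conv_diff unit_conv_mult unit_conv_const unit_conv_lambert chi5_weight_le)
     (simp add: unit_conv_def)

lemma lipschitz_uhp:
  assumes "Im z > 0"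
  shows "lipschitz z = - 4 * of_real pi ^ 2 * (\<Sum>\<^sub>\<infinity>k\<in>{1..}. of_nat k * qexp z ^ k)"
  unfolding lipschitz_def infsumI[OF has_sum_lambert_term[OF norm_qexp_less_1[OF assms]]] ..

text \<open>As \<open>lipschitz\<close> is even, the row of index \<open>5 * m + a\<close> can be
  labelled by its absolute value. The classes of a and -a modulo 5 are distinct for a = 1, 2, so
  each positive M in either class occurs once.\<close>

lemma bij_betw_mod5_abs:
  assumes a: "a = 1 \<or> a = (2::int)"
  shows "bij_betw (\<lambda>m. nat \<bar>5 * m + a\<bar>) UNIV {M. M \<ge> 1 \<and> (int M mod 5 = a \<or> int M mod 5 = 5 - a)}"
proof (rule bij_betw_imageI)
  show "inj (\<lambda>m. nat \<bar>5 * m + a\<bar>)"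
  proof (rule injI)
    fix m n assume "nat \<bar>5 * m + a\<bar> = nat \<bar>5 * n + a\<bar>"
    then consider "5 * m + a = 5 * n + a" | "5 * m + a = - (5 * n + a)" by linarith
    then show "m = n"
    proof cases
      case 2
      then have "5 * (- m - n) = 2 * a" by simp
      then have "5 dvd 2 * a" by (metis dvd_triv_left)
      with a show ?thesis by auto
    qed simp
  qed
  show "range (\<lambda>m. nat \<bar>5 * m + a\<bar>) = {M. M \<ge> 1 \<and> (int M mod 5 = a \<or> int M mod 5 = 5 - a)}"
  proof (intro equalityI subsetI)
    fix M assume "M \<in> range (\<lambda>m. nat \<bar>5 * m + a\<bar>)"
    then obtain m where m: "int M = \<bar>5 * m + a\<bar>" by auto
    have am: "a mod 5 = a" "(5 - a) mod 5 = 5 - a" using a by auto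
    have "int M = a + m * 5 \<or> int M = (5 - a) + (- m - 1) * 5"
      unfolding m by (cases "5 * m + a \<ge> 0") auto
    then have "int M mod 5 = a \<or> int M mod 5 = 5 - a"
      using am by (metis mod_mult_self1)
    moreover have "M \<noteq> 0" using calculation a by (intro notI) auto
    ultimately show "M \<in> {M. M \<ge> 1 \<and> (int M mod 5 = a \<or> int M mod 5 = 5 - a)}" by simp
  next
    fix M assume "M \<in> {M. M \<ge> 1 \<and> (int M mod 5 = a \<or> int M mod 5 = 5 - a)}"
    then have "int M mod 5 = a \<or> int M mod 5 = 5 - a" by simp
    then show "M \<in> range (\<lambda>m. nat \<bar>5 * m + a\<bar>)"
    proof
      assume "int M mod 5 = a"
      then have "int M = 5 * (int M div 5) + a"
        using mult_div_mod_eq[of 5 "int M"] by simp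
      then have "M = nat \<bar>5 * (int M div 5) + a\<bar>" by simp
      then show ?thesis by (rule range_eqI)
    next
      assume "int M mod 5 = 5 - a"
      then have "int M = - (5 * (- (int M div 5) - 1) + a)"
        using mult_div_mod_eq[of 5 "int M"] by simp
      then have "M = nat \<bar>5 * (- (int M div 5) - 1) + a\<bar>" by linarith
      then show ?thesis by (rule range_eqI)
    qed
  qed
qed

text \<open>The argument \<open>5 * \<tau>\<close> cancels the division by 5 and leaves integer
  multiples of \<tau>. Indices congruent to 1 or -1 enter positively and those congruent to 2 or -2
  negatively, which is the pattern of \<open>chi5\<close>.\<close>

lemma wp_diff_zero_expansion:
  assumes \<tau>: "Im \<tau> > 0"
  shows "wp_diff (1, 0) (2, 0) (5 * \<tau>) = - (4 * of_real pi ^ 2 / 25) * qser (of_int_fps eis_zero) \<tau>"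
proof -
  define g where "g = (\<lambda>M. lipschitz (of_nat M * \<tau>))"
  define A where "A = (\<lambda>a. {M::nat. M \<ge> 1 \<and> (int M mod 5 = a \<or> int M mod 5 = 5 - a)})"
  have g: "g M = - 4 * of_real pi ^ 2 * (\<Sum>\<^sub>\<infinity>k\<in>{1..}. of_nat k * qexp \<tau> ^ (M * k))" if "M \<ge> 1" for M
    using lipschitz_uhp[of "of_nat M * \<tau>"] \<tau> that
    by (simp add: g_def qexp_of_nat_mult flip: power_mult)
  have lip_abs: "lipschitz (of_int i * \<tau>) = g (nat \<bar>i\<bar>)" for i
    using lipschitz_minus[of "of_int i * \<tau>"] by (cases "i \<ge> 0") (auto simp: g_def abs_if)
  have gsum: "g summable_on {1..}"
  proof -
    have "(\<lambda>(m, k). of_int (int k) * qexp \<tau> ^ (m * k)) summable_on {1..} \<times> {1..}"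
      using norm_qexp_less_1[OF \<tau>] by (intro lambert_summable) auto
    then have "(\<lambda>m. \<Sum>\<^sub>\<infinity>k\<in>{1..}. of_nat k * qexp \<tau> ^ (m * k)) summable_on {1..}"
      using summable_on_Sigma_banach[of "\<lambda>m k. of_int (int k) * qexp \<tau> ^ (m * k)"] by simp
    then have "(\<lambda>M. - 4 * of_real pi ^ 2 * (\<Sum>\<^sub>\<infinity>k\<in>{1..}. of_nat k * qexp \<tau> ^ (M * k))) summable_on {1..}"
      by (rule summable_on_cmult_right)
    then show ?thesis by (rule summable_on_cong[THEN iffD1, rotated]) (simp add: g)
  qed
  have has: "(g has_sum infsum g (A a)) (A a)" for a
    using gsum by (intro has_sum_infsum summable_on_subset_banach[OF gsum]) (auto simp: A_def)
  have row: "((\<lambda>m. lipschitz (of_int (5 * m + a) * \<tau>)) has_sum infsum g (A a)) UNIV" if "a = 1 \<or> a = 2" for a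
    unfolding lip_abs
    using has_sum_reindex_bij_betw[OF bij_betw_mod5_abs[OF that], of g] has[of a] by (simp add: A_def)
  have row2: "((\<lambda>m. - lipschitz (of_int (5 * m + 2) * \<tau>)) has_sum - infsum g (A 2)) UNIV"
    using row[of 2] by (simp add: has_sum_uminus)
  have "((\<lambda>m. lipschitz (of_int (5 * m + 1) * \<tau>) + - lipschitz (of_int (5 * m + 2) * \<tau>)) has_sum
      (infsum g (A 1) + - infsum g (A 2))) UNIV"
    by (intro has_sum_add row row2) auto
  then have "(\<Sum>\<^sub>\<infinity>m. lipschitz (of_int (5 * m + 1) * \<tau>) - lipschitz (of_int (5 * m + 2) * \<tau>)) =
      infsum g (A 1) - infsum g (A 2)"
    by (simp only: infsumI add_uminus_conv_diff)
  moreover have "25 * wp_diff (1, 0) (2, 0) (5 * \<tau>) =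
      (\<Sum>\<^sub>\<infinity>m. lipschitz (of_int (5 * m + 1) * \<tau>) - lipschitz (of_int (5 * m + 2) * \<tau>))"
  proof -
    have nz: "nonzero5 (1, 0)" "nonzero5 (2, 0)" by (auto simp: nonzero5_def)
    have scale: "(of_int (5 * m + a) * (5 * \<tau>) + of_int 0) / 5 = of_int (5 * m + a) * \<tau>" for m a
      by simp
    show ?thesis
      using wp_diff_lipschitz(2)[OF _ nz, of "5 * \<tau>"] \<tau> unfolding fst_conv snd_conv scale by simp
  qed
  ultimately have W: "25 * wp_diff (1, 0) (2, 0) (5 * \<tau>) = infsum g (A 1) - infsum g (A 2)" by simp
  have "((\<lambda>M. of_int (chi5 (int M)) * g M) has_sum (infsum g (A 1) + - infsum g (A 2))) {1..}"
  proof -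
    have "((\<lambda>M. of_int (chi5 (int M)) * g M) has_sum infsum g (A 1)) (A 1)"
      using has[of 1] by (rule has_sum_cong[THEN iffD1, rotated]) (auto simp: A_def chi5_def)
    moreover have "((\<lambda>M. - g M) has_sum - infsum g (A 2)) (A 2)"
      using has[of 2] by (simp add: has_sum_uminus)
    then have "((\<lambda>M. of_int (chi5 (int M)) * g M) has_sum - infsum g (A 2)) (A 2)"
      by (rule has_sum_cong[THEN iffD1, rotated]) (auto simp: A_def chi5_def)
    moreover have "A 1 \<inter> A 2 = {}" by (auto simp: A_def)
    ultimately have "((\<lambda>M. of_int (chi5 (int M)) * g M) has_sum (infsum g (A 1) + - infsum g (A 2))) (A 1 \<union> A 2)"
      by (rule has_sum_Un_disjoint)
    then show ?thesis
      by (rule has_sum_cong_neutral[THEN iffD1, rotated -1]) (auto simp: A_def chi5_def split: if_splits)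
  qed
  then have "infsum g (A 1) - infsum g (A 2) = (\<Sum>\<^sub>\<infinity>M\<in>{1..}. of_int (chi5 (int M)) * g M)"
    by (simp add: infsumI)
  also have "\<dots> = (\<Sum>\<^sub>\<infinity>M\<in>{1..}. - 4 * of_real pi ^ 2 *
     (\<Sum>\<^sub>\<infinity>k\<in>{1..}. of_int (chi5 (int M) * int k) * qexp \<tau> ^ (M * k)))"
  proof (rule infsum_cong)
    fix M :: nat assume "M \<in> {1..}"
    then have "of_int (chi5 (int M)) * g M = - 4 * of_real pi ^ 2 *
      (of_int (chi5 (int M)) * (\<Sum>\<^sub>\<infinity>k\<in>{1..}. of_nat k * qexp \<tau> ^ (M * k)))"
      by (simp add: g)
    also have "of_int (chi5 (int M)) * (\<Sum>\<^sub>\<infinity>k\<in>{1..}. of_nat k * qexp \<tau> ^ (M * k)) =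
      (\<Sum>\<^sub>\<infinity>k\<in>{1..}. of_int (chi5 (int M)) * (of_nat k * qexp \<tau> ^ (M * k)))"
      by (rule infsum_cmult_right'[symmetric])
    finally show "of_int (chi5 (int M)) * g M = - 4 * of_real pi ^ 2 *
     (\<Sum>\<^sub>\<infinity>k\<in>{1..}. of_int (chi5 (int M) * int k) * qexp \<tau> ^ (M * k))"
      by (simp add: mult.assoc)
  qed
  also have "\<dots> = - 4 * of_real pi ^ 2 * qser (of_int_fps eis_zero) \<tau>"
    unfolding infsum_cmult_right' eis_zero_def qser_lambert[OF chi5_weight_le \<tau>] ..
  finally have "25 * wp_diff (1, 0) (2, 0) (5 * \<tau>) =
      25 * (- (4 * of_real pi ^ 2 / 25) * qser (of_int_fps eis_zero) \<tau>)"
    using W by simp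
  then show ?thesis by (simp only: mult_cancel_left) simp
qed

lemma infsum_int_symmetric:
  fixes f :: "int \<Rightarrow> complex"
  assumes "f summable_on UNIV"
  shows "infsum f UNIV = f 0 + (\<Sum>\<^sub>\<infinity>m\<in>{1::nat..}. f (int m) + f (- int m))"
proof -
  define P N where "P = int ` {1..}" and "N = (\<lambda>m. - int m) ` {1..}"
  have sub: "f summable_on X" for X by (rule summable_on_subset_banach[OF assms]) auto
  have "UNIV = {0} \<union> (P \<union> N)"
  proof -
    have "x \<in> {0} \<union> (P \<union> N)" for x
    proof -
      consider "x = 0" | "x = int (nat x)" "nat x \<ge> 1" | "x = - int (nat (- x))" "nat (- x) \<ge> 1" by linarith
      then show ?thesis unfolding P_def N_def by cases (blast intro: atLeast_iff[THEN iffD2])+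
    qed
    then show ?thesis by blast
  qed
  then have "infsum f UNIV = infsum f ({0} \<union> (P \<union> N))" by simp
  also have "\<dots> = infsum f {0} + infsum f (P \<union> N)"
    by (rule infsum_Un_disjoint[OF sub sub]) (auto simp: P_def N_def)
  also have "infsum f (P \<union> N) = infsum f P + infsum f N"
    by (rule infsum_Un_disjoint[OF sub sub]) (auto simp: P_def N_def)
  also have "infsum f P = (\<Sum>\<^sub>\<infinity>m\<in>{1..}. f (int m))"
    unfolding P_def by (subst infsum_reindex) (auto simp: o_def)
  also have "infsum f N = (\<Sum>\<^sub>\<infinity>m\<in>{1..}. f (- int m))"
    unfolding N_def by (subst infsum_reindex) (auto simp: o_def inj_on_def)
  also have "(\<Sum>\<^sub>\<infinity>m\<in>{1..}. f (int m)) + (\<Sum>\<^sub>\<infinity>m\<in>{1..}. f (- int m)) =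
      (\<Sum>\<^sub>\<infinity>m\<in>{1..}. f (int m) + f (- int m))"
  proof (rule infsum_add[symmetric])
    show "(\<lambda>m. f (int m)) summable_on {1..}"
      using sub[of P] unfolding P_def by (subst (asm) summable_on_reindex) (auto simp: o_def)
    show "(\<lambda>m. f (- int m)) summable_on {1..}"
      using sub[of N] unfolding N_def by (subst (asm) summable_on_reindex) (auto simp: o_def inj_on_def)
  qed
  finally show ?thesis by simp
qed

section \<open>The quadratic Gauss sum modulo 5 and the expansion of \<open>ainf\<close>\<close>

definition zeta5 :: complex where
  "zeta5 = qexp (1 / 5)"

definition gauss5 :: complex where
  "gauss5 = zeta5 - zeta5 ^ 2 + zeta5 ^ 4 - zeta5 ^ 3"

lemma zeta5_power_5: "zeta5 ^ 5 = 1"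
  unfolding zeta5_def qexp_of_nat_mult[of 5, symmetric, simplified]
  by (simp add: qexp_def)

lemma one_fifth_not_int: "of_nat j / 5 \<notin> (\<int> :: complex set)" if "0 < j" "j < 5"
proof
  assume "of_nat j / 5 \<in> (\<int> :: complex set)"
  then obtain n :: int where "of_nat j / 5 = (of_int n :: complex)" by (auto elim: Ints_cases)
  then have "of_int (int j) = (of_int (5 * n) :: complex)" by (simp add: field_simps)
  then have "int j = 5 * n" by (simp only: of_int_eq_iff)
  with that show False by presburger
qed

lemma zeta5_neq_1: "zeta5 \<noteq> 1"
  unfolding zeta5_def using qexp_neq_1[OF one_fifth_not_int[of 1]] by simp

lemma zeta5_sum: "1 + zeta5 + zeta5 ^ 2 + zeta5 ^ 3 + zeta5 ^ 4 = 0"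
proof -
  have "(1 - zeta5) * (1 + zeta5 + zeta5 ^ 2 + zeta5 ^ 3 + zeta5 ^ 4) = 1 - zeta5 ^ 5"
    by (simp add: eval_nat_numeral algebra_simps)
  then show ?thesis using zeta5_power_5 zeta5_neq_1 by simp
qed

lemma gauss5_power2: "gauss5 ^ 2 = 5"
  using zeta5_power_5 zeta5_sum unfolding gauss5_def by algebra

lemma gauss5_nonzero: "gauss5 \<noteq> 0"
  using gauss5_power2 by auto

text \<open>Periodicity in k leaves five cases. The identity converts the roots of unity attached to
  the division points into values of the character.\<close>

lemma gauss_sum_5:
  "(zeta5 ^ k) - (zeta5 ^ k) ^ 2 + (zeta5 ^ k) ^ 4 - (zeta5 ^ k) ^ 3 = of_int (chi5 (int k)) * gauss5"
proof -
  define i where "i = k mod 5"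
  have "zeta5 ^ k = zeta5 ^ (5 * (k div 5) + i)" by (simp add: i_def)
  also have "\<dots> = zeta5 ^ i" by (simp add: power_add power_mult zeta5_power_5)
  finally have k: "zeta5 ^ k = zeta5 ^ i" .
  have chi: "chi5 (int k) = chi5 (int i)"
    by (simp add: chi5_def i_def zmod_int)
  have red: "zeta5 ^ (5 * a + b) = zeta5 ^ b" for a b
    by (simp add: power_add power_mult zeta5_power_5)
  have powers: "zeta5 ^ 6 = zeta5" "zeta5 ^ 8 = zeta5 ^ 3" "zeta5 ^ 9 = zeta5 ^ 4"
    "zeta5 ^ 12 = zeta5 ^ 2" "zeta5 ^ 16 = zeta5"
    using red[of 1 1] red[of 1 3] red[of 1 4] red[of 2 2] red[of 3 1] by simp_all
  have "i = 0 \<or> i = 1 \<or> i = 2 \<or> i = 3 \<or> i = 4" unfolding i_def by presburger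
  then show ?thesis
    unfolding k chi gauss5_def
    by (elim disjE) (simp_all add: chi5_def powers flip: power_mult)
qed

text \<open>This is the row m = 0. Its points lie on the real axis, where the series of k q^k
  diverges, so the closed form is evaluated directly.\<close>

lemma lipschitz_fifth_diff: "lipschitz (1 / 5) - lipschitz (2 / 5) = 4 * of_real pi ^ 2 * (gauss5 / 5)"
proof -
  define x where "x = zeta5"
  have q: "qexp (1 / 5) = x" "qexp (2 / 5) = x\<^sup>2"
    using qexp_of_nat_mult[of 2 "1/5"] by (simp_all add: x_def zeta5_def)
  have nz: "1 - x \<noteq> 0" "1 - x\<^sup>2 \<noteq> 0"
    using qexp_neq_1[OF one_fifth_not_int[of 1]] qexp_neq_1[OF one_fifth_not_int[of 2]] by (simp_all add: q)
  \<comment> \<open>With denominators cleared the claim is a polynomial identity modulo 1 + x + x^2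
    + x^3 + x^4.\<close>
  have "5 * (x * (1 - x\<^sup>2)\<^sup>2 - x\<^sup>2 * (1 - x)\<^sup>2) = - (x - x ^ 2 + x ^ 4 - x ^ 3) * ((1 - x)\<^sup>2 * (1 - x\<^sup>2)\<^sup>2)"
    using zeta5_sum unfolding x_def[symmetric] by algebra
  then have "x / (1 - x)\<^sup>2 - x\<^sup>2 / (1 - x\<^sup>2)\<^sup>2 = - (gauss5 / 5)"
    using nz unfolding gauss5_def x_def[symmetric] by (simp add: divide_simps) (simp add: algebra_simps)
  then show ?thesis
    unfolding lipschitz_def q by (metis (no_types, opaque_lifting) minus_mult_minus minus_mult_left mult_minus_right right_diff_distrib)
qed

text \<open>The rows m and -m are paired. By evenness the second one contributes the inverse roots
  of unity, so the exponents 1, 2, 4, 3 of \<open>zeta5\<close> occur with the signs of the Gauss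
  sum.\<close>

lemma wp_diff_inf_expansion:
  assumes \<tau>: "Im \<tau> > 0"
  shows "wp_diff (0, 1) (0, 2) \<tau> = (4 * of_real pi ^ 2 * gauss5 / 125) * qser (of_int_fps eis_inf) \<tau>"
proof -
  define h where "h = (\<lambda>m. lipschitz (of_int m * \<tau> + 1 / 5) - lipschitz (of_int m * \<tau> + 2 / 5))"
  define E where "E = (\<lambda>x::complex. x / (1 - x)\<^sup>2)"
  have nz: "nonzero5 (0, 1)" "nonzero5 (0, 2)" by (auto simp: nonzero5_def)
  have scale: "(5 * of_int m * \<tau> + c) / 5 = of_int m * \<tau> + c / 5" for m c
    by (simp add: field_simps)
  have 1: "25 * wp_diff (0, 1) (0, 2) \<tau> = infsum h UNIV"
    using wp_diff_lipschitz(2)[OF \<tau> nz] by (simp add: h_def scale)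
  have "h summable_on UNIV"
    using wp_diff_lipschitz(1)[OF \<tau> nz] by (simp add: h_def scale)
  note 2 = infsum_int_symmetric[OF this]
  have pair: "h (int m) + h (- int m) = - 4 * of_real pi ^ 2 * gauss5 *
      (\<Sum>\<^sub>\<infinity>k\<in>{1..}. of_int (chi5 (int k) * int k) * qexp \<tau> ^ (m * k))" if m: "m \<in> {1..}" for m
  proof -
    define y where "y = qexp \<tau> ^ m"
    have y: "norm y < 1"
      using norm_qexp_less_1[OF \<tau>] m by (simp add: y_def norm_power power_less_one_iff)
    have zn: "norm zeta5 = 1" by (simp add: zeta5_def norm_qexp)
    have zj: "qexp (of_nat j / 5) = zeta5 ^ j" for j
      using qexp_of_nat_mult[of j "1/5"] by (simp add: zeta5_def)
    have lip: "lipschitz (of_nat m * \<tau> + of_nat j / 5) = - 4 * of_real pi ^ 2 * E (y * zeta5 ^ j)" for j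
      unfolding lipschitz_def E_def qexp_add zj qexp_of_nat_mult y_def ..
    have lip': "lipschitz (- (of_nat m * \<tau>) + of_nat j / 5) = - 4 * of_real pi ^ 2 * E (y * zeta5 ^ (5 - j))"
      if "j \<le> 5" for j
    proof -
      have "lipschitz (- (of_nat m * \<tau>) + of_nat j / 5) = lipschitz (of_nat m * \<tau> + - (of_nat j / 5))"
        using lipschitz_minus[of "of_nat m * \<tau> - of_nat j / 5"] by (simp add: algebra_simps)
      moreover have "qexp (- (of_nat j / 5)) = zeta5 ^ (5 - j)"
      proof -
        have "zeta5 ^ (5 - j) * zeta5 ^ j = 1"
          using that zeta5_power_5 by (simp flip: power_add)
        then show ?thesis unfolding qexp_minus zj by (metis divide_eq_eq mult_zero_right zero_neq_one)
      qed
      ultimately show ?thesis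
        unfolding lipschitz_def E_def qexp_add qexp_of_nat_mult y_def by simp
    qed
    have "h (int m) + h (- int m) = - 4 * of_real pi ^ 2 *
        (E (y * zeta5 ^ 1) - E (y * zeta5 ^ 2) + E (y * zeta5 ^ 4) - E (y * zeta5 ^ 3))"
      using lip[of 1] lip[of 2] lip'[of 1] lip'[of 2] by (simp add: h_def algebra_simps)
    also have "E (y * zeta5 ^ 1) - E (y * zeta5 ^ 2) + E (y * zeta5 ^ 4) - E (y * zeta5 ^ 3) =
      gauss5 * (\<Sum>\<^sub>\<infinity>k\<in>{1..}. of_int (chi5 (int k) * int k) * qexp \<tau> ^ (m * k))"
    proof -
      have e: "((\<lambda>k. of_nat k * (y * zeta5 ^ j) ^ k) has_sum E (y * zeta5 ^ j)) {1..}" for j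
        unfolding E_def by (rule has_sum_lambert_term) (simp add: norm_mult norm_power zn y)
      then have e': "((\<lambda>k. - (of_nat k * (y * zeta5 ^ j) ^ k)) has_sum - E (y * zeta5 ^ j)) {1..}" for j
        by (simp add: has_sum_uminus)
      have "((\<lambda>k. of_nat k * (y * zeta5 ^ 1) ^ k + - (of_nat k * (y * zeta5 ^ 2) ^ k) + of_nat k * (y * zeta5 ^ 4) ^ k
         + - (of_nat k * (y * zeta5 ^ 3) ^ k)) has_sum
        (E (y * zeta5 ^ 1) + - E (y * zeta5 ^ 2) + E (y * zeta5 ^ 4) + - E (y * zeta5 ^ 3))) {1..}"
        by (intro has_sum_add e e')
      moreover have "of_nat k * (y * zeta5 ^ 1) ^ k + - (of_nat k * (y * zeta5 ^ 2) ^ k) + of_nat k * (y * zeta5 ^ 4) ^ k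
         + - (of_nat k * (y * zeta5 ^ 3) ^ k) = gauss5 * (of_int (chi5 (int k) * int k) * qexp \<tau> ^ (m * k))" for k
      proof -
        have "of_nat k * (y * zeta5 ^ 1) ^ k + - (of_nat k * (y * zeta5 ^ 2) ^ k) + of_nat k * (y * zeta5 ^ 4) ^ k
         + - (of_nat k * (y * zeta5 ^ 3) ^ k) =
         of_nat k * y ^ k * ((zeta5 ^ k) - (zeta5 ^ k) ^ 2 + (zeta5 ^ k) ^ 4 - (zeta5 ^ k) ^ 3)"
          by (simp add: power_mult_distrib algebra_simps flip: power_mult)
        also have "\<dots> = gauss5 * (of_int (chi5 (int k) * int k) * qexp \<tau> ^ (m * k))"
          unfolding gauss_sum_5 by (simp add: y_def flip: power_mult)
        finally show ?thesis .
      qed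
      ultimately have "((\<lambda>k. gauss5 * (of_int (chi5 (int k) * int k) * qexp \<tau> ^ (m * k))) has_sum
        (E (y * zeta5 ^ 1) + - E (y * zeta5 ^ 2) + E (y * zeta5 ^ 4) + - E (y * zeta5 ^ 3))) {1..}"
        by (simp only:)
      then show ?thesis by (simp add: infsumI infsum_cmult_right'[symmetric])
    qed
    finally show ?thesis by (simp add: mult.assoc)
  qed
  have "(\<Sum>\<^sub>\<infinity>m\<in>{1..}. h (int m) + h (- int m)) = (\<Sum>\<^sub>\<infinity>m\<in>{1..}. - 4 * of_real pi ^ 2 * gauss5 *
      (\<Sum>\<^sub>\<infinity>k\<in>{1..}. of_int (chi5 (int k) * int k) * qexp \<tau> ^ (m * k)))"
    by (rule infsum_cong) (rule pair)
  then have A: "(\<Sum>\<^sub>\<infinity>m\<in>{1..}. h (int m) + h (- int m)) = - 4 * of_real pi ^ 2 * gauss5 *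
    qser (of_int_fps (lambert (\<lambda>m k. chi5 (int k) * int k))) \<tau>"
    unfolding infsum_cmult_right' qser_lambert[OF chi5_weight_le \<tau>] .
  have B: "h 0 = 4 * of_real pi ^ 2 * (gauss5 / 5)"
    using lipschitz_fifth_diff by (simp add: h_def)
  have C: "qser (of_int_fps eis_inf) \<tau> = 1 - 5 * qser (of_int_fps (lambert (\<lambda>m k. chi5 (int k) * int k))) \<tau>"
    unfolding eis_inf_def of_int_fps_diff of_int_fps_mult of_int_fps_const of_int_fps_1
    using \<tau> unit_conv_lambert[OF chi5_weight_le, of "\<lambda>m k. int k"]
    by (subst qser_diff; (subst qser_mult)?) (auto intro!: unit_conv_mult unit_conv_lambert chi5_weight_le simp: fps_const_1_eq_1[symmetric] simp del: fps_const_1_eq_1)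
  have "25 * wp_diff (0, 1) (0, 2) \<tau> = 25 * ((4 * of_real pi ^ 2 * gauss5 / 125) * qser (of_int_fps eis_inf) \<tau>)"
    unfolding 1 2 A B C by (simp add: algebra_simps)
  then show ?thesis by (simp only: mult_cancel_left) simp
qed

section \<open>Two forms of weight two\<close>

definition ainf :: "complex \<Rightarrow> complex" where
  "ainf = qser (of_int_fps eis_inf)"

definition czero :: "complex \<Rightarrow> complex" where
  "czero = qser (of_int_fps eis_zero)"

lemma wp_diff_inf:
  obtains \<kappa> where "\<kappa> \<noteq> 0" "\<And>z. Im z > 0 \<Longrightarrow> wp_diff (0, 1) (0, 2) z = \<kappa> * ainf z"
  using wp_diff_inf_expansion gauss5_nonzero that[of "4 * of_real pi ^ 2 * gauss5 / 125"]
  by (simp add: ainf_def)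

lemma wp_diff_zero:
  obtains \<kappa> where "\<kappa> \<noteq> 0" "\<And>z. Im z > 0 \<Longrightarrow> wp_diff (1, 0) (2, 0) (5 * z) = \<kappa> * czero z"
  using wp_diff_zero_expansion that[of "- (4 * of_real pi ^ 2 / 25)"]
  by (simp add: czero_def)

lemma chi5_cases:
  assumes "\<not> 5 dvd d"
  obtains "chi5 d = 1" "5 dvd d - 1 \<or> 5 dvd d + 1" | "chi5 d = -1" "5 dvd d - 2 \<or> 5 dvd d + 2"
proof -
  have "d mod 5 = 1 \<or> d mod 5 = 2 \<or> d mod 5 = 3 \<or> d mod 5 = 4"
    using assms by presburger
  then consider "d mod 5 = 1" | "d mod 5 = 2" | "d mod 5 = 3" | "d mod 5 = 4" by blast
  then show ?thesis
  proof cases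
    case 1
    then have "5 dvd d - 1" by presburger
    with 1 that(1) show ?thesis by (simp add: chi5_def)
  next
    case 2
    then have "5 dvd d - 2" by presburger
    with 2 that(2) show ?thesis by (simp add: chi5_def)
  next
    case 3
    then have "5 dvd d + 2" by presburger
    with 3 that(2) show ?thesis by (simp add: chi5_def)
  next
    case 4
    then have "5 dvd d + 1" by presburger
    with 4 that(1) show ?thesis by (simp add: chi5_def)
  qed
qed

text \<open>The origin of the character: modulo 5, multiplication by 1 or -1 fixes the points 1 and
  2 up to sign, whereas multiplication by 2 or -2 swaps them up to sign, because 4 is congruent to
  -1, and thus negates the difference.\<close>

lemma wp_diff_chi5_snd:
  assumes \<tau>: "Im \<tau> > 0" and c: "5 dvd c" and d: "\<not> 5 dvd d"
  shows "wp_diff (c, d) (2 * c, 2 * d) \<tau> = of_int (chi5 d) * wp_diff (0, 1) (0, 2) \<tau>"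
proof -
  have nz: "nonzero5 (0, 1)" "nonzero5 (0, 2)" by (auto simp: nonzero5_def)
  from d show ?thesis
  proof (cases rule: chi5_cases)
    case 1
    have "wp_diff (c, d) (2 * c, 2 * d) \<tau> = wp_diff (0, 1) (0, 2) \<tau>"
      by (rule wp_diff_cong[OF \<tau> nz]) (use c 1(2) in \<open>simp only: fst_conv snd_conv; presburger\<close>)+
    with 1 show ?thesis by simp
  next
    case 2
    have "wp_diff (c, d) (2 * c, 2 * d) \<tau> = wp_diff (0, 2) (0, 1) \<tau>"
      by (rule wp_diff_cong[OF \<tau> nz(2,1)]) (use c 2(2) in \<open>simp only: fst_conv snd_conv; presburger\<close>)+
    with 2 show ?thesis using wp_diff_swap[of "(0, 2)" "(0, 1)"] by simp
  qed
qed

lemma wp_diff_chi5_fst: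
  assumes \<tau>: "Im \<tau> > 0" and c: "5 dvd c" and d: "\<not> 5 dvd d"
  shows "wp_diff (d, c) (2 * d, 2 * c) \<tau> = of_int (chi5 d) * wp_diff (1, 0) (2, 0) \<tau>"
proof -
  have nz: "nonzero5 (1, 0)" "nonzero5 (2, 0)" by (auto simp: nonzero5_def)
  from d show ?thesis
  proof (cases rule: chi5_cases)
    case 1
    have "wp_diff (d, c) (2 * d, 2 * c) \<tau> = wp_diff (1, 0) (2, 0) \<tau>"
      by (rule wp_diff_cong[OF \<tau> nz]) (use c 1(2) in \<open>simp only: fst_conv snd_conv; presburger\<close>)+
    with 1 show ?thesis by simp
  next
    case 2
    have "wp_diff (d, c) (2 * d, 2 * c) \<tau> = wp_diff (2, 0) (1, 0) \<tau>"
      by (rule wp_diff_cong[OF \<tau> nz(2,1)]) (use c 2(2) in \<open>simp only: fst_conv snd_conv; presburger\<close>)+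
    with 2 show ?thesis using wp_diff_swap[of "(2, 0)" "(1, 0)"] by simp
  qed
qed

lemma not_5_dvd_det:
  assumes "a * d - b * c = (1::int)" "5 dvd c"
  shows "\<not> 5 dvd a" "\<not> 5 dvd d"
proof -
  have "5 dvd a * d - b * c \<longleftrightarrow> 5 dvd a * d" using assms(2) by (simp add: dvd_diff_left_iff)
  then show "\<not> 5 dvd a" "\<not> 5 dvd d" using assms(1) by auto
qed

lemma chi5_det:
  assumes det: "a * d - b * c = (1::int)" and c: "5 dvd c"
  shows "chi5 a = chi5 d"
proof -
  have "5 dvd a * d - 1" using det c by (metis add_diff_cancel_left' diff_add_cancel dvd_mult)
  then have "a * d mod 5 = 1" by presburger
  then have "(a mod 5) * (d mod 5) mod 5 = 1" by (simp only: mod_mult_eq)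
  moreover have "a mod 5 \<in> {0,1,2,3,4}" for a :: int
  proof -
    have "a mod 5 = 0 \<or> a mod 5 = 1 \<or> a mod 5 = 2 \<or> a mod 5 = 3 \<or> a mod 5 = 4" by presburger
    then show ?thesis by blast
  qed
  note this[of a] this[of d]
  ultimately show ?thesis by (auto simp: chi5_def)
qed

text \<open>The row (0, 1) times the matrix is its lower row (c, d), and c is zero modulo 5.\<close>

lemma ainf_moeb:
  assumes det: "a * d - b * c = 1" and c: "5 dvd c" and z: "Im z > 0"
  shows "ainf (moeb a b c d z) = of_int (chi5 d) * (of_int c * z + of_int d)\<^sup>2 * ainf z"
proof -
  obtain \<kappa> where \<kappa>: "\<kappa> \<noteq> 0" "\<And>z. Im z > 0 \<Longrightarrow> wp_diff (0, 1) (0, 2) z = \<kappa> * ainf z"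
    using wp_diff_inf by blast
  have "\<kappa> * ainf (moeb a b c d z) = (of_int c * z + of_int d)\<^sup>2 * wp_diff (c, d) (2 * c, 2 * d) z"
    using wp_diff_moeb[OF det moeb_denom_nonzero[OF det z], of "(0, 1)" "(0, 2)"] \<kappa>(2)[OF Im_moeb[OF det z]] by simp
  also have "\<dots> = \<kappa> * (of_int (chi5 d) * (of_int c * z + of_int d)\<^sup>2 * ainf z)"
    unfolding wp_diff_chi5_snd[OF z c not_5_dvd_det(2)[OF det c]] \<kappa>(2)[OF z] by simp
  finally show ?thesis using \<kappa>(1) by simp
qed

text \<open>Multiplication by \<open>5\<close> conjugates \<open>\<Gamma>\<^sub>0(5)\<close> into the group of matrices with \<open>5\<close> dividing
  the upper right entry.\<close>
lemma czero_moeb: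
  assumes det: "a * d - b * c = 1" and c: "5 dvd c" and z: "Im z > 0"
  shows "czero (moeb a b c d z) = of_int (chi5 d) * (of_int c * z + of_int d)\<^sup>2 * czero z"
proof -
  obtain \<kappa> where \<kappa>: "\<kappa> \<noteq> 0" "\<And>z. Im z > 0 \<Longrightarrow> wp_diff (1, 0) (2, 0) (5 * z) = \<kappa> * czero z"
    using wp_diff_zero by blast
  obtain c' where c': "c = 5 * c'" using c by (auto elim: dvdE)
  have z5: "Im (5 * z) > 0" using z by simp
  have det': "a * d - (5 * b) * c' = 1" using det by (simp add: c')
  have "5 * moeb a b c d z = moeb a (5 * b) c' d (5 * z)"
    by (simp add: moeb_def c' algebra_simps)
  then have "\<kappa> * czero (moeb a b c d z) = wp_diff (1, 0) (2, 0) (moeb a (5 * b) c' d (5 * z))"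
    using \<kappa>(2)[OF Im_moeb[OF det z]] by simp
  also have "\<dots> = (of_int c' * (5 * z) + of_int d)\<^sup>2 * wp_diff (a, 5 * b) (2 * a, 2 * (5 * b)) (5 * z)"
    using wp_diff_moeb[OF det' moeb_denom_nonzero[OF det' z5], of "(1, 0)" "(2, 0)"] by simp
  also have "\<dots> = (of_int c * z + of_int d)\<^sup>2 * (of_int (chi5 a) * (\<kappa> * czero z))"
    using wp_diff_chi5_fst[OF z5 _ not_5_dvd_det(1)[OF det c], of "5 * b"] \<kappa>(2)[OF z] by (simp add: c' mult_ac)
  finally show ?thesis using \<kappa>(1) chi5_det[OF det c] by simp
qed

text \<open>The inversion carries the points (0, 1) and (0, 2) to (1, 0) and (2, 0). The difference
  at the latter is a multiple of \<open>czero\<close> only at five times the argument, hence z /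
  5.\<close>

lemma ainf_inversion:
  obtains \<kappa> where "\<kappa> \<noteq> 0" "\<And>z. Im z > 0 \<Longrightarrow> ainf (-1 / z) = \<kappa> * z\<^sup>2 * czero (z / 5)"
proof -
  obtain \<kappa> where \<kappa>: "\<kappa> \<noteq> 0" "\<And>z. Im z > 0 \<Longrightarrow> wp_diff (0, 1) (0, 2) z = \<kappa> * ainf z"
    using wp_diff_inf by blast
  obtain \<mu> where \<mu>: "\<mu> \<noteq> 0" "\<And>z. Im z > 0 \<Longrightarrow> wp_diff (1, 0) (2, 0) (5 * z) = \<mu> * czero z"
    using wp_diff_zero by blast
  have "ainf (-1 / z) = (\<mu> / \<kappa>) * z\<^sup>2 * czero (z / 5)" if z: "Im z > 0" for z
  proof -
    have z0: "z \<noteq> 0" using z by auto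
    have "\<kappa> * ainf (-1 / z) = wp_diff (0, 1) (0, 2) (moeb 0 (-1) 1 0 z)"
      using \<kappa>(2)[OF Im_minus_inverse_pos[OF z]] by (simp add: moeb_def)
    also have "\<dots> = z\<^sup>2 * wp_diff (1, 0) (2, 0) (5 * (z / 5))"
      using z0 wp_diff_moeb[of 0 0 "-1" 1 z "(0, 1)" "(0, 2)"] by simp
    also have "\<dots> = z\<^sup>2 * (\<mu> * czero (z / 5))" using \<mu>(2)[of "z / 5"] z by simp
    finally show ?thesis using \<kappa>(1) by (simp add: field_simps)
  qed
  with \<kappa>(1) \<mu>(1) that show ?thesis by (metis divide_eq_0_iff)
qed

lemma czero_inversion:
  obtains \<kappa> where "\<kappa> \<noteq> 0" "\<And>z. Im z > 0 \<Longrightarrow> czero (-1 / z) = \<kappa> * z\<^sup>2 * ainf (z / 5)"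
proof -
  obtain \<kappa> where \<kappa>: "\<kappa> \<noteq> 0" "\<And>z. Im z > 0 \<Longrightarrow> ainf (-1 / z) = \<kappa> * z\<^sup>2 * czero (z / 5)"
    using ainf_inversion by blast
  have "czero (-1 / z) = (1 / (25 * \<kappa>)) * z\<^sup>2 * ainf (z / 5)" if z: "Im z > 0" for z
  proof -
    have z0: "z \<noteq> 0" using z by auto
    have "Im (5 * v) = 5 * Im v" for v by simp
    \<comment> \<open>\<open>ainf_inversion\<close> is applied at -5 / z, whose negative inverse is
      z / 5.\<close>
    then have "Im (5 * (-1 / z)) > 0" using Im_minus_inverse_pos[OF z] by (simp only:)
    from \<kappa>(2)[OF this] show ?thesis using z0 \<kappa>(1) by (simp add: field_simps power2_eq_square)
  qed
  with \<kappa>(1) that[of "1 / (25 * \<kappa>)"] show ?thesis by simp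
qed

text \<open>Growth at the cusp 0 is read off from the expansion of G; Im z > 5 keeps z / 5 in the
  range of \<open>qser_bdd\<close>.\<close>

lemma char_form_qserI:
  assumes F: "unit_conv F" and G: "unit_conv G"
    and trans: "\<And>a b c d z. a * d - b * c = 1 \<Longrightarrow> 5 dvd c \<Longrightarrow> Im z > 0 \<Longrightarrow>
      qser F (moeb a b c d z) = of_int (chi5 d) * (of_int c * z + of_int d)\<^sup>2 * qser F z"
    and inv: "\<And>z. Im z > 0 \<Longrightarrow> qser F (-1 / z) = \<kappa> * z\<^sup>2 * qser G (z / 5)"
  shows "char_form 1 (qser F)"
proof -
  obtain B where B: "\<And>z. Im z > 1 \<Longrightarrow> norm (qser F z) \<le> B" using qser_bdd[OF F] by blast
  obtain B' where B': "\<And>z. Im z > 1 \<Longrightarrow> norm (qser G z) \<le> B'" using qser_bdd[OF G] by blast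
  show ?thesis
  proof (rule char_formI[where Y = 1 and B = B and Y' = 5 and B' = "norm \<kappa> * B'"])
    show "norm (qser F (-1 / z)) \<le> norm \<kappa> * B' * norm z ^ (2 * 1)" if "Im z > 5" for z
    proof -
      have "norm \<kappa> * norm z ^ 2 * norm (qser G (z / 5)) \<le> norm \<kappa> * norm z ^ 2 * B'"
        using that by (intro mult_left_mono B') auto
      moreover have "Im z > 0" using that by simp
      ultimately show ?thesis by (simp only: inv) (simp add: norm_mult norm_power mult_ac)
    qed
  qed (use trans B qser_holomorphic[OF F] in auto)
qed

lemma char_form_ainf: "char_form 1 ainf"
  using ainf_inversion char_form_qserI[OF unit_conv_eis_inf unit_conv_eis_zero] ainf_moeb
  unfolding ainf_def czero_def by metis

lemma char_form_czero: "char_form 1 czero"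
  using czero_inversion char_form_qserI[OF unit_conv_eis_zero unit_conv_eis_inf] czero_moeb
  unfolding ainf_def czero_def by metis

lemma eis_zero_nth_0: "fps_nth eis_zero 0 = 0"
  by (simp add: eis_zero_def lambert_def)

lemma eis_zero_nth_1: "fps_nth eis_zero (Suc 0) = 1"
  by (simp add: eis_zero_def lambert_def chi5_def)

lemma eis_inf_nth_0: "fps_nth eis_inf 0 = 1"
  by (simp add: eis_inf_def lambert_def)

text \<open>Leading coefficients 1 make the elimination division-free, so it applies over the
  complex numbers and also over the integers, on which the reduction modulo 2 depends.\<close>

lemma triangular_elimination:
  fixes E :: "nat \<Rightarrow> 'a::comm_ring_1 fps"
  assumes "\<And>i j. i \<le> n \<Longrightarrow> j < i \<Longrightarrow> fps_nth (E i) j = 0" "\<And>i. i \<le> n \<Longrightarrow> fps_nth (E i) i = 1"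
  shows "\<exists>\<alpha>. \<forall>j\<le>n. fps_nth (F - (\<Sum>i\<le>n. fps_const (\<alpha> i) * E i)) j = 0"
  using assms
proof (induction n)
  case 0
  then show ?case by (intro exI[of _ "\<lambda>_. fps_nth F 0"]) simp
next
  case (Suc n)
  then obtain \<alpha> where \<alpha>: "\<forall>j\<le>n. fps_nth (F - (\<Sum>i\<le>n. fps_const (\<alpha> i) * E i)) j = 0"
    by (metis le_SucI)
  define \<beta> where "\<beta> = \<alpha>(Suc n := fps_nth (F - (\<Sum>i\<le>n. fps_const (\<alpha> i) * E i)) (Suc n))"
  have "(\<Sum>i\<le>n. fps_const (\<beta> i) * E i) = (\<Sum>i\<le>n. fps_const (\<alpha> i) * E i)"
    by (rule sum.cong) (auto simp: \<beta>_def)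
  then have "fps_nth (F - (\<Sum>i\<le>Suc n. fps_const (\<beta> i) * E i)) j = 0" if "j \<le> Suc n" for j
    using \<alpha> Suc.prems that by (cases "j = Suc n") (auto simp: \<beta>_def)
  then show ?case by blast
qed

lemma qser_char_form_vanishing:
  assumes F: "unit_conv F" and f: "char_form j (qser F)" and n: "\<And>i. i < n \<Longrightarrow> fps_nth F i = 0"
    and "n \<ge> 1" "6 * j \<le> 5 * n"
  shows "F = 0"
proof (rule ccontr)
  assume "F \<noteq> 0"
  then have "n \<le> subdegree F" using n by (intro subdegree_geI) auto
  then obtain C where "\<And>z. Im z > 1 \<Longrightarrow> norm (qser F z) \<le> C * exp (- (2 * pi * real n) * Im z)"
    using qser_decay[OF F] by metis
  then have "qser F z = 0" if "Im z > 0" for z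
    using char_form_vanishing[OF f] assms(4,5) that by blast
  then have "F = 0" by (rule qser_eq_0_imp[OF F])
  with \<open>F \<noteq> 0\<close> show False by simp
qed

text \<open>\<open>3 f'\<^sup>2 - 2 f f''\<close> is the second Rankin-Cohen bracket of a form \<open>f\<close> of weight two with itself.\<close>
lemma rankin_cohen_moeb:
  assumes det: "a * d - b * c = 1"
    and h: "\<And>z. Im z > 0 \<Longrightarrow> (h has_field_derivative h1 z) (at z)"
      "\<And>z. Im z > 0 \<Longrightarrow> (h1 has_field_derivative h2 z) (at z)"
    and f: "\<And>z. Im z > 0 \<Longrightarrow> (f has_field_derivative f1 z) (at z)"
      "\<And>z. Im z > 0 \<Longrightarrow> (f1 has_field_derivative f2 z) (at z)"
    and hf: "\<And>z. Im z > 0 \<Longrightarrow> h (moeb a b c d z) = (of_int c * z + of_int d)\<^sup>2 * f z"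
    and z: "Im z > 0"
  shows "3 * h1 (moeb a b c d z) ^ 2 - 2 * h (moeb a b c d z) * h2 (moeb a b c d z) =
    (of_int c * z + of_int d) ^ 8 * (3 * f1 z ^ 2 - 2 * f z * f2 z)"
proof -
  define J where "J = (\<lambda>z::complex. of_int c * z + of_int d)"
  have J0: "J z \<noteq> 0" if "Im z > 0" for z
    unfolding J_def by (rule moeb_denom_nonzero[OF det that])
  have Jz: "of_int c * z + of_int d = J z" for z
    by (simp add: J_def)
  have dJ: "(J has_field_derivative of_int c) (at z)" for z
    unfolding J_def by (auto intro!: derivative_eq_intros)
  have detc: "of_int a * of_int d - of_int b * of_int c = (1::complex)"
    using det by (metis of_int_1 of_int_diff of_int_mult)
  have dm: "(moeb a b c d has_field_derivative 1 / J z ^ 2) (at z)" if z: "Im z > 0" for z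
  proof -
    have "((\<lambda>z. (of_int a * z + of_int b) / J z) has_field_derivative
       (of_int a * J z - (of_int a * z + of_int b) * of_int c) / (J z * J z)) (at z)"
      using J0[OF z] by (auto intro!: derivative_eq_intros dJ)
    also have "of_int a * J z - (of_int a * z + of_int b) * of_int c = 1"
      using detc by (simp add: J_def algebra_simps)
    finally show ?thesis by (simp add: moeb_def[abs_def] J_def power2_eq_square)
  qed
  have first: "h1 (moeb a b c d z) = 2 * of_int c * J z ^ 3 * f z + J z ^ 4 * f1 z" if z: "Im z > 0" for z
  proof -
    have "((\<lambda>z. h (moeb a b c d z)) has_field_derivative h1 (moeb a b c d z) * (1 / J z ^ 2)) (at z)"
      by (rule DERIV_chain2[OF h(1)[OF Im_moeb[OF det z]] dm[OF z]])
    moreover have "((\<lambda>z. h (moeb a b c d z)) has_field_derivative 2 * J z * of_int c * f z + J z ^ 2 * f1 z) (at z)"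
    proof (rule has_field_derivative_transform_within_open[OF _ open_uhp])
      show "((\<lambda>z. J z ^ 2 * f z) has_field_derivative 2 * J z * of_int c * f z + J z ^ 2 * f1 z) (at z)"
        by (auto intro!: derivative_eq_intros dJ f z)
    qed (use z hf in \<open>auto simp: J_def\<close>)
    ultimately have "h1 (moeb a b c d z) * (1 / J z ^ 2) = 2 * J z * of_int c * f z + J z ^ 2 * f1 z"
      by (rule DERIV_unique)
    then show ?thesis using J0[OF z] by (simp add: field_simps eval_nat_numeral)
  qed
  have second: "h2 (moeb a b c d z) = 6 * of_int c ^ 2 * J z ^ 4 * f z + 6 * of_int c * J z ^ 5 * f1 z + J z ^ 6 * f2 z"
    if z: "Im z > 0" for z
  proof -
    have "((\<lambda>z. h1 (moeb a b c d z)) has_field_derivative h2 (moeb a b c d z) * (1 / J z ^ 2)) (at z)"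
      by (rule DERIV_chain2[OF h(2)[OF Im_moeb[OF det z]] dm[OF z]])
    moreover have "((\<lambda>z. h1 (moeb a b c d z)) has_field_derivative
      6 * of_int c ^ 2 * J z ^ 2 * f z + 6 * of_int c * J z ^ 3 * f1 z + J z ^ 4 * f2 z) (at z)"
    proof (rule has_field_derivative_transform_within_open[OF _ open_uhp])
      show "((\<lambda>z. 2 * of_int c * J z ^ 3 * f z + J z ^ 4 * f1 z) has_field_derivative
        6 * of_int c ^ 2 * J z ^ 2 * f z + 6 * of_int c * J z ^ 3 * f1 z + J z ^ 4 * f2 z) (at z)"
        by (auto intro!: derivative_eq_intros dJ f z simp: algebra_simps eval_nat_numeral)
    qed (use z first in auto)
    ultimately have "h2 (moeb a b c d z) * (1 / J z ^ 2) =
      6 * of_int c ^ 2 * J z ^ 2 * f z + 6 * of_int c * J z ^ 3 * f1 z + J z ^ 4 * f2 z"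
      by (rule DERIV_unique)
    then show ?thesis using J0[OF z] by (simp add: field_simps eval_nat_numeral)
  qed
  show ?thesis
    \<comment> \<open>The terms in c^2 f^2 and in c f f1 have coefficient 12 in both products and
      cancel; the coefficients 3 and 2 are chosen for this.\<close>
    unfolding first[OF z] second[OF z] hf[OF z] Jz
    by (simp add: algebra_simps eval_nat_numeral)
qed

text \<open>The operator q d/dq; differentiation in z is 2 pi i times it.\<close>

definition fps_theta :: "complex fps \<Rightarrow> complex fps" where
  "fps_theta F = fps_X * fps_deriv F"

lemma unit_conv_theta: "unit_conv F \<Longrightarrow> unit_conv (fps_theta F)"
  unfolding fps_theta_def by (intro unit_conv_mult unit_conv_deriv unit_conv_X)

definition fps_bracket :: "complex fps \<Rightarrow> complex fps" where
  "fps_bracket F = fps_const (3 * (2 * of_real pi * \<i>)\<^sup>2) * fps_theta F ^ 2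
     - fps_const (2 * (2 * of_real pi * \<i>)\<^sup>2) * (F * fps_theta (fps_theta F))"

lemma unit_conv_bracket: "unit_conv F \<Longrightarrow> unit_conv (fps_bracket F)"
  unfolding fps_bracket_def
  by (intro unit_conv_diff unit_conv_mult unit_conv_const unit_conv_power unit_conv_theta)

lemma qser_derivatives:
  assumes F: "unit_conv F" and z: "Im z > 0"
  shows "(qser F has_field_derivative 2 * of_real pi * \<i> * qser (fps_theta F) z) (at z)"
    "((\<lambda>z. 2 * of_real pi * \<i> * qser (fps_theta F) z) has_field_derivative
      (2 * of_real pi * \<i>)\<^sup>2 * qser (fps_theta (fps_theta F)) z) (at z)"
proof -
  show "(qser F has_field_derivative 2 * of_real pi * \<i> * qser (fps_theta F) z) (at z)"
    unfolding fps_theta_def by (rule qser_has_field_derivative[OF F z])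
  have "((\<lambda>z. 2 * of_real pi * \<i> * qser (fps_theta F) z) has_field_derivative
      2 * of_real pi * \<i> * (2 * of_real pi * \<i> * qser (fps_theta (fps_theta F)) z)) (at z)"
    unfolding fps_theta_def[of "fps_theta F"]
    by (intro DERIV_cmult qser_has_field_derivative unit_conv_theta F z)
  then show "((\<lambda>z. 2 * of_real pi * \<i> * qser (fps_theta F) z) has_field_derivative
      (2 * of_real pi * \<i>)\<^sup>2 * qser (fps_theta (fps_theta F)) z) (at z)"
    by (simp add: power2_eq_square mult_ac)
qed

lemma qser_bracket:
  assumes F: "unit_conv F" and z: "Im z > 0"
  shows "qser (fps_bracket F) z = 3 * (2 * of_real pi * \<i> * qser (fps_theta F) z)\<^sup>2
    - 2 * qser F z * ((2 * of_real pi * \<i>)\<^sup>2 * qser (fps_theta (fps_theta F)) z)"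
  unfolding fps_bracket_def using F z
  by (simp add: qser_diff qser_mult qser_power unit_conv_mult unit_conv_power unit_conv_theta power_mult_distrib)

lemma char_form_bracket_czero: "char_form 4 (qser (fps_bracket (of_int_fps eis_zero)))"
proof -
  note C = unit_conv_eis_zero and A = unit_conv_eis_inf
  obtain B where B: "\<And>z. Im z > 1 \<Longrightarrow> norm (qser (fps_bracket (of_int_fps eis_zero)) z) \<le> B"
    using qser_bdd[OF unit_conv_bracket[OF C]] by blast
  obtain B' where B': "\<And>z. Im z > 1 \<Longrightarrow> norm (qser (fps_bracket (of_int_fps eis_inf)) z) \<le> B'"
    using qser_bdd[OF unit_conv_bracket[OF A]] by blast
  obtain \<kappa> where \<kappa>: "\<And>z. Im z > 0 \<Longrightarrow> czero (-1 / z) = \<kappa> * z\<^sup>2 * ainf (z / 5)"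
    using czero_inversion by metis
  show ?thesis
  proof (rule char_formI[where Y = 1 and B = B and Y' = 5 and B' = "norm (\<kappa>\<^sup>2 / 25) * B'"])
    show "qser (fps_bracket (of_int_fps eis_zero)) holomorphic_on uhp"
      by (rule qser_holomorphic[OF unit_conv_bracket[OF C]])
    show "qser (fps_bracket (of_int_fps eis_zero)) (moeb a b c d z) =
        of_int (chi5 d) ^ 4 * (of_int c * z + of_int d) ^ (2 * 4) * qser (fps_bracket (of_int_fps eis_zero)) z"
      if det: "a * d - b * c = 1" and c: "5 dvd c" and z: "Im z > 0" for a b c d z
    proof -
      define \<epsilon> where "\<epsilon> = (of_int (chi5 d) :: complex)"
      \<comment> \<open>The bracket is quadratic, so the character enters squared and
        disappears.\<close>
      have \<epsilon>: "\<epsilon>\<^sup>2 = 1" "\<epsilon> ^ 4 = 1" using chi5_unit[OF det c] by (auto simp: \<epsilon>_def)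
      have hf: "qser (of_int_fps eis_zero) (moeb a b c d z) = (of_int c * z + of_int d)\<^sup>2 * (\<epsilon> * qser (of_int_fps eis_zero) z)"
        if "Im z > 0" for z using czero_moeb[OF det c that] by (simp add: czero_def \<epsilon>_def)
      note D = qser_derivatives[OF C]
      have "qser (fps_bracket (of_int_fps eis_zero)) (moeb a b c d z) =
        (of_int c * z + of_int d) ^ 8 * (3 * (\<epsilon> * (2 * of_real pi * \<i> * qser (fps_theta (of_int_fps eis_zero)) z))\<^sup>2
         - 2 * (\<epsilon> * qser (of_int_fps eis_zero) z) *
           (\<epsilon> * ((2 * of_real pi * \<i>)\<^sup>2 * qser (fps_theta (fps_theta (of_int_fps eis_zero))) z)))"
        unfolding qser_bracket[OF C Im_moeb[OF det z]]
        by (rule rankin_cohen_moeb[OF det D(1) D(2) DERIV_cmult[OF D(1)] DERIV_cmult[OF D(2)] hf z])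
      also have "\<dots> = (of_int c * z + of_int d) ^ 8 * (\<epsilon>\<^sup>2 * qser (fps_bracket (of_int_fps eis_zero)) z)"
        unfolding qser_bracket[OF C z] by (simp add: power2_eq_square algebra_simps)
      finally show ?thesis using \<epsilon> by (simp add: \<epsilon>_def)
    qed
    show "norm (qser (fps_bracket (of_int_fps eis_zero)) (-1 / z)) \<le> norm (\<kappa>\<^sup>2 / 25) * B' * norm z ^ (2 * 4)"
      if z: "Im z > 5" for z
    proof -
      \<comment> \<open>For the cusp 0, \<open>rankin_cohen_moeb\<close> is used with the inversion
        matrix and a rescaled \<open>ainf\<close> as its f. The bracket of \<open>eis_inf\<close> at
        z / 5 appears, and each differentiation contributes a factor 1 / 5.\<close>
      have hf: "qser (of_int_fps eis_zero) (moeb 0 (-1) 1 0 z) = (of_int 1 * z + of_int 0)\<^sup>2 * (\<kappa> * qser (of_int_fps eis_inf) (z / 5))"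
        if "Im z > 0" for z using \<kappa>[OF that] by (simp add: czero_def ainf_def moeb_def)
      have scale: "((\<lambda>z. \<kappa> * g (z / 5)) has_field_derivative (\<kappa> * (g1 (z / 5) * (1 / 5)))) (at z)"
        if "(g has_field_derivative g1 (z / 5)) (at (z / 5))" for g g1 :: "complex \<Rightarrow> complex" and z
        using that by (intro DERIV_cmult DERIV_chain2[of g]) (auto intro!: derivative_eq_intros)
      define a1 where "a1 = (\<lambda>z. 2 * of_real pi * \<i> * qser (fps_theta (of_int_fps eis_inf)) z)"
      define a2 where "a2 = (\<lambda>z. (2 * of_real pi * \<i>)\<^sup>2 * qser (fps_theta (fps_theta (of_int_fps eis_inf))) z)"
      have D1: "((\<lambda>z. \<kappa> * qser (of_int_fps eis_inf) (z / 5)) has_field_derivative (\<kappa> / 5) * a1 (z / 5)) (at z)"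
        if "Im z > 0" for z
        using scale[of "qser (of_int_fps eis_inf)" a1 z] qser_derivatives(1)[OF A, of "z / 5"] that by (simp add: a1_def)
      have D2: "((\<lambda>z. (\<kappa> / 5) * a1 (z / 5)) has_field_derivative (\<kappa> / 25) * a2 (z / 5)) (at z)"
        if "Im z > 0" for z
        using DERIV_cmult[OF scale[of a1 a2 z], of "1 / 5"] qser_derivatives(2)[OF A, of "z / 5"] that
        by (simp add: a1_def[symmetric] a2_def)
      have z': "Im z > 0" "Im (z / 5) > 0" "Im (z / 5) > 1" using z by auto
      note D = qser_derivatives[OF C]
      have "qser (fps_bracket (of_int_fps eis_zero)) (-1 / z) =
         z ^ 8 * (3 * ((\<kappa> / 5) * a1 (z / 5)) ^ 2 - 2 * (\<kappa> * qser (of_int_fps eis_inf) (z / 5)) * ((\<kappa> / 25) * a2 (z / 5)))"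
        using rankin_cohen_moeb[OF _ D(1) D(2) D1 D2 hf z'(1)] qser_bracket[OF C Im_minus_inverse_pos[OF z'(1)]]
        by (simp add: moeb_def)
      also have "\<dots> = z ^ 8 * ((\<kappa>\<^sup>2 / 25) * qser (fps_bracket (of_int_fps eis_inf)) (z / 5))"
        unfolding qser_bracket[OF A z'(2)] a1_def a2_def
        by (simp add: power2_eq_square algebra_simps)
      finally have "norm (qser (fps_bracket (of_int_fps eis_zero)) (-1 / z)) =
        norm z ^ 8 * (norm (\<kappa>\<^sup>2 / 25) * norm (qser (fps_bracket (of_int_fps eis_inf)) (z / 5)))"
        by (simp only: norm_mult norm_power)
      also have "\<dots> \<le> norm z ^ 8 * (norm (\<kappa>\<^sup>2 / 25) * B')"
        using B'[OF z'(3)] by (intro mult_left_mono) auto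
      finally show ?thesis by (simp add: mult_ac)
    qed
  qed (use B in auto)
qed

section \<open>Sharp vanishing order\<close>

lemma char_form_monomial: "char_form (i + j) (\<lambda>z. czero z ^ i * g z ^ j)" if "char_form 1 g" for g
  using char_form_mult[OF char_form_power[OF char_form_czero, of i] char_form_power[OF that, of j]] by simp

lemma fps_power_mult_nth:
  fixes F G :: "'a::comm_ring_1 fps"
  assumes F: "fps_nth F 0 = 0" "fps_nth F (Suc 0) = 1"
  shows "j < i \<Longrightarrow> fps_nth (F ^ i * G) j = 0" "fps_nth (F ^ i * G) i = fps_nth G 0"
proof -
  define U where "U = fps_shift 1 F"
  have U: "F = U * fps_X"
    unfolding U_def using F(1) by (intro fps_ext) (simp add: fps_mult_fps_X_commute[symmetric] split: nat.split)
  have U0: "fps_nth U 0 = 1" by (simp add: U_def F)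
  have eq: "F ^ i * G = fps_X ^ i * (U ^ i * G)"
    by (simp add: U power_mult_distrib mult_ac)
  show "fps_nth (F ^ i * G) j = 0" if "j < i"
    unfolding eq using that by (simp add: fps_X_power_mult_nth)
  show "fps_nth (F ^ i * G) i = fps_nth G 0"
    unfolding eq using U0 by (simp add: fps_X_power_mult_nth fps_power_zeroth)
qed

lemmas eis_zero_power_nth = fps_power_mult_nth[OF eis_zero_nth_0 eis_zero_nth_1]

text \<open>The form \<open>3 c'\<^sup>2 - 2 c c''\<close> of weight eight lies in the span of the products \<open>c\<^sup>i a\<^sup>4\<^sup>-\<^sup>i\<close>,
  because the weak vanishing criterion is still sharp in this weight, and its first two coefficients vanish.\<close>
lemma bracket_eq_czero_square_mult:
  obtains e where "e holomorphic_on uhp"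
    "\<And>z. Im z > 0 \<Longrightarrow> qser (fps_bracket (of_int_fps eis_zero)) z = czero z ^ 2 * e z"
proof -
  define A C where "A = (of_int_fps eis_inf :: complex fps)" and "C = (of_int_fps eis_zero :: complex fps)"
  have A: "unit_conv A" and C: "unit_conv C"
    by (simp_all add: A_def C_def unit_conv_eis_inf unit_conv_eis_zero)
  define E where "E = (\<lambda>i. C ^ i * A ^ (4 - i))"
  have Eint: "E i = of_int_fps (eis_zero ^ i * eis_inf ^ (4 - i))" for i
    by (simp add: E_def A_def C_def of_int_fps_mult of_int_fps_power)
  have E: "fps_nth (E i) j = 0" if "j < i" for i j
    using that by (simp add: Eint eis_zero_power_nth)
  have E': "fps_nth (E i) i = 1" for i
    by (simp add: Eint eis_zero_power_nth fps_power_zeroth eis_inf_nth_0)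
  have uE: "unit_conv (E i)" for i
    unfolding E_def by (intro unit_conv_mult unit_conv_power A C)
  have "\<exists>\<alpha>. \<forall>j\<le>4. fps_nth (fps_bracket C - (\<Sum>i\<le>4. fps_const (\<alpha> i) * E i)) j = 0"
    by (rule triangular_elimination) (use E E' in auto)
  then obtain \<alpha> where \<alpha>: "\<And>j. j \<le> 4 \<Longrightarrow> fps_nth (fps_bracket C - (\<Sum>i\<le>4. fps_const (\<alpha> i) * E i)) j = 0"
    by blast
  have uS: "unit_conv (\<Sum>i\<le>4. fps_const (\<alpha> i) * E i)"
    by (intro unit_conv_sum unit_conv_mult unit_conv_const uE)
  have qE: "qser (E i) z = czero z ^ i * ainf z ^ (4 - i)" if "Im z > 0" for i z
    using that A C by (simp add: E_def qser_mult qser_power unit_conv_power ainf_def czero_def A_def[symmetric] C_def[symmetric])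
  have qS: "qser (\<Sum>i\<le>4. fps_const (\<alpha> i) * E i) z = (\<Sum>i\<le>4. \<alpha> i * (czero z ^ i * ainf z ^ (4 - i)))"
    if "Im z > 0" for z
    using that uE by (simp add: qser_sum unit_conv_mult qser_mult qE)
  \<comment> \<open>The weak criterion reads 24 \<le> 25 here: the five coefficients removed by the
    elimination are enough.\<close>
  have "fps_bracket C - (\<Sum>i\<le>4. fps_const (\<alpha> i) * E i) = 0"
  proof (rule qser_char_form_vanishing[where j = 4 and n = 5])
    show "unit_conv (fps_bracket C - (\<Sum>i\<le>4. fps_const (\<alpha> i) * E i))"
      by (intro unit_conv_diff unit_conv_bracket C uS)
    have "char_form 4 (\<lambda>z. qser (fps_bracket C) z - (\<Sum>i\<le>4. \<alpha> i * (czero z ^ i * ainf z ^ (4 - i))))"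
    proof (intro char_form_diff char_form_sum char_form_cmult)
      show "char_form 4 (\<lambda>z. czero z ^ i * ainf z ^ (4 - i))" if "i \<in> {..4}" for i
        using char_form_monomial[OF char_form_ainf, of i "4 - i"] that by simp
    qed (use char_form_bracket_czero in \<open>auto simp: C_def\<close>)
    then show "char_form 4 (qser (fps_bracket C - (\<Sum>i\<le>4. fps_const (\<alpha> i) * E i)))"
      by (rule char_form_cong) (simp add: qser_diff unit_conv_bracket C uS qS)
  qed (use \<alpha> in auto)
  then have br: "fps_bracket C = (\<Sum>i\<le>4. fps_const (\<alpha> i) * E i)" by simp
  have C0: "fps_nth C 0 = 0" by (simp add: C_def eis_zero_nth_0)
  \<comment> \<open>C and its images under \<open>fps_theta\<close> have no constant term, so both
    products in the bracket start at q^2 or later. As \<open>E i\<close> starts at q^i with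
    coefficient 1, this kills \<open>\<alpha> 0\<close> and \<open>\<alpha> 1\<close>.\<close>
  have b01: "fps_nth (fps_bracket C) 0 = 0" "fps_nth (fps_bracket C) 1 = 0"
    by (simp_all add: fps_bracket_def fps_theta_def C0 power2_eq_square fps_mult_nth_1)
  have "\<alpha> 0 = 0"
    using b01(1) unfolding br by (simp add: eval_nat_numeral E E'[of 0])
  moreover have "\<alpha> 1 = 0"
    using b01(2) \<open>\<alpha> 0 = 0\<close> E'[of 1] unfolding br by (simp add: eval_nat_numeral E)
  ultimately have *: "qser (fps_bracket C) z = czero z ^ 2 *
      (\<alpha> 2 * ainf z ^ 2 + \<alpha> 3 * czero z * ainf z + \<alpha> 4 * czero z ^ 2)" if "Im z > 0" for z
    unfolding br qS[OF that] by (simp add: eval_nat_numeral algebra_simps)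
  show ?thesis
  proof (rule that)
    show "(\<lambda>z. \<alpha> 2 * ainf z ^ 2 + \<alpha> 3 * czero z * ainf z + \<alpha> 4 * czero z ^ 2) holomorphic_on uhp"
      by (intro holomorphic_intros char_form_holo[OF char_form_ainf] char_form_holo[OF char_form_czero])
  qed (use * in \<open>simp add: C_def\<close>)
qed

text \<open>At a zero of order \<open>n\<close> the bracket would only have order \<open>2 n - 2\<close>.\<close>
lemma czero_nonzero:
  assumes z0: "Im z0 > 0"
  shows "czero z0 \<noteq> 0"
proof
  assume zero: "czero z0 = 0"
  obtain e where e: "e holomorphic_on uhp"
    "\<And>z. Im z > 0 \<Longrightarrow> qser (fps_bracket (of_int_fps eis_zero)) z = czero z ^ 2 * e z"
    using bracket_eq_czero_square_mult by blast
  note C = unit_conv_eis_zero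
  have nc: "\<not> czero constant_on uhp"
  proof
    assume "czero constant_on uhp"
    then have "czero z = 0" if "Im z > 0" for z
      using zero z0 that unfolding constant_on_def by auto
    then have "of_int_fps eis_zero = (0 :: complex fps)"
      unfolding czero_def by (intro qser_eq_0_imp[OF C]) auto
    then have "fps_nth (of_int_fps eis_zero) 1 = (0 :: complex)" by simp
    then show False by (simp add: eis_zero_nth_1)
  qed
  obtain g \<rho> n where n: "n > 0" and \<rho>: "\<rho> > 0" "ball z0 \<rho> \<subseteq> uhp" and g: "g holomorphic_on ball z0 \<rho>"
    and fac: "\<And>w. w \<in> ball z0 \<rho> \<Longrightarrow> czero w = (w - z0) ^ n * g w"
    and gnz: "\<And>w. w \<in> ball z0 \<rho> \<Longrightarrow> g w \<noteq> 0"
    using holomorphic_factor_zero_nonconstant[OF char_form_holo[OF char_form_czero] open_uhp connected_uhp _ zero nc] z0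
    by (metis uhp_iff)
  have up: "Im w > 0" if "w \<in> ball z0 \<rho>" for w using \<rho>(2) that by auto
  define c1 where "c1 = (\<lambda>z. 2 * of_real pi * \<i> * qser (fps_theta (of_int_fps eis_zero)) z)"
  define c2 where "c2 = (\<lambda>z. (2 * of_real pi * \<i>)\<^sup>2 * qser (fps_theta (fps_theta (of_int_fps eis_zero))) z)"
  have dc: "(czero has_field_derivative c1 z) (at z)" "(c1 has_field_derivative c2 z) (at z)" if "Im z > 0" for z
    using qser_derivatives[OF C that] by (simp_all add: czero_def c1_def[abs_def] c2_def)
  have br: "3 * c1 z ^ 2 - 2 * czero z * c2 z = czero z ^ 2 * e z" if "Im z > 0" for z
    using e(2)[OF that] unfolding qser_bracket[OF C that] by (simp add: czero_def c1_def c2_def)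
  obtain n' where n': "n = Suc n'" using n by (cases n) auto
  have dg: "(g has_field_derivative deriv g w) (at w)" "(deriv g has_field_derivative deriv (deriv g) w) (at w)"
    if "w \<in> ball z0 \<rho>" for w
    using that g holomorphic_deriv[OF g] by (auto intro: holomorphic_derivI)
  \<comment> \<open>\<open>(w - z0) ^ n * g1 w\<close> is w - z0 times the derivative of c.
    Multiplying each derivative by w - z0 keeps the exponent n and avoids n - 1 and n - 2.\<close>
  define g1 where "g1 = (\<lambda>w. of_nat n * g w + (w - z0) * deriv g w)"
  define g1' where "g1' = (\<lambda>w. of_nat n * deriv g w + (deriv g w + (w - z0) * deriv (deriv g) w))"
  have dg1: "(g1 has_field_derivative g1' w) (at w)" if "w \<in> ball z0 \<rho>" for w
    unfolding g1_def g1'_def by (auto intro!: derivative_eq_intros dg that simp: algebra_simps)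
  have first: "(w - z0) * c1 w = (w - z0) ^ n * g1 w" if w: "w \<in> ball z0 \<rho>" for w
  proof -
    have "((\<lambda>w. (w - z0) ^ n * g w) has_field_derivative c1 w) (at w)"
      by (rule has_field_derivative_transform_within_open[OF dc(1)[OF up[OF w]] open_ball w]) (simp add: fac)
    moreover have "((\<lambda>w. (w - z0) ^ n * g w) has_field_derivative
        (of_nat n * (w - z0) ^ (n - 1) * g w + (w - z0) ^ n * deriv g w)) (at w)"
      by (auto intro!: derivative_eq_intros dg w)
    ultimately have c1w: "c1 w = of_nat n * (w - z0) ^ (n - 1) * g w + (w - z0) ^ n * deriv g w"
      by (rule DERIV_unique)
    show ?thesis unfolding c1w g1_def n' by (simp add: algebra_simps)
  qed
  have second: "(w - z0) ^ 2 * c2 w = (w - z0) ^ n * (of_nat n * g1 w + (w - z0) * g1' w - g1 w)"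
    if w: "w \<in> ball z0 \<rho>" for w
  proof -
    have "((\<lambda>w. (w - z0) * c1 w) has_field_derivative c1 w + (w - z0) * c2 w) (at w)"
      using dc(2)[OF up[OF w]] by (auto intro!: derivative_eq_intros)
    then have "((\<lambda>w. (w - z0) ^ n * g1 w) has_field_derivative c1 w + (w - z0) * c2 w) (at w)"
      by (rule has_field_derivative_transform_within_open[OF _ open_ball w]) (simp add: first)
    moreover have "((\<lambda>w. (w - z0) ^ n * g1 w) has_field_derivative
        (of_nat n * (w - z0) ^ (n - 1) * g1 w + (w - z0) ^ n * g1' w)) (at w)"
      by (auto intro!: derivative_eq_intros dg1 w)
    ultimately have "c1 w + (w - z0) * c2 w = of_nat n * (w - z0) ^ (n - 1) * g1 w + (w - z0) ^ n * g1' w"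
      by (rule DERIV_unique)
    then have "(w - z0) * c1 w + (w - z0) ^ 2 * c2 w =
        (w - z0) * (of_nat n * (w - z0) ^ (n - 1) * g1 w + (w - z0) ^ n * g1' w)"
      by (metis (no_types, opaque_lifting) distrib_left mult.assoc power2_eq_square)
    then have "(w - z0) ^ 2 * c2 w =
        (w - z0) * (of_nat n * (w - z0) ^ (n - 1) * g1 w + (w - z0) ^ n * g1' w) - (w - z0) ^ n * g1 w"
      unfolding first[OF w] by (simp add: algebra_simps)
    then show ?thesis by (simp add: n' algebra_simps)
  qed
  \<comment> \<open>What is left of the bracket identity after division by (w - z0)^(2 n - 2). It
    vanishes off z0, hence by continuity also at z0.\<close>
  define K where "K = (\<lambda>w. 3 * g1 w ^ 2 - 2 * g w * (of_nat n * g1 w + (w - z0) * g1' w - g1 w) - (w - z0) ^ 2 * g w ^ 2 * e w)"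
  have K0: "K w = 0" if w: "w \<in> ball z0 \<rho> - {z0}" for w
  proof -
    from w have wb: "w \<in> ball z0 \<rho>" and ne: "w - z0 \<noteq> 0" by auto
    have "((w - z0) ^ n) ^ 2 * K w = 3 * ((w - z0) ^ n * g1 w) ^ 2
       - 2 * ((w - z0) ^ n * g w) * ((w - z0) ^ n * (of_nat n * g1 w + (w - z0) * g1' w - g1 w))
       - (w - z0) ^ 2 * (((w - z0) ^ n * g w) ^ 2 * e w)"
      by (simp add: K_def power2_eq_square algebra_simps)
    also have "\<dots> = (w - z0) ^ 2 * ((3 * c1 w ^ 2 - 2 * czero w * c2 w) - czero w ^ 2 * e w)"
      unfolding fac[OF wb, symmetric] first[OF wb, symmetric] second[OF wb, symmetric]
      by (simp add: power2_eq_square algebra_simps)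
    also have "\<dots> = 0" using br[OF up[OF wb]] by simp
    finally show ?thesis using ne by simp
  qed
  have "continuous_on (ball z0 \<rho>) K"
    unfolding K_def g1_def g1'_def
    by (intro continuous_intros holomorphic_on_imp_continuous_on[OF g]
        holomorphic_on_imp_continuous_on[OF holomorphic_deriv[OF g]]
        holomorphic_on_imp_continuous_on[OF holomorphic_deriv[OF holomorphic_deriv[OF g]]]
        continuous_on_subset[OF holomorphic_on_imp_continuous_on[OF e(1)] \<rho>(2)] open_ball)
  then have "isCont K z0" using \<rho>(1) by (simp add: continuous_on_eq_continuous_at)
  then have "(K \<longlongrightarrow> K z0) (at z0)" by (simp add: isCont_def)
  moreover have "(K \<longlongrightarrow> 0) (at z0)"
  proof (rule tendsto_eventually)
    have "eventually (\<lambda>w. w \<in> ball z0 \<rho> - {z0}) (at z0)"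
      using eventually_at_in_open[of "ball z0 \<rho>" z0] \<rho>(1) by simp
    then show "eventually (\<lambda>w. K w = 0) (at z0)" by eventually_elim (rule K0)
  qed
  ultimately have "K z0 = 0" using tendsto_unique[OF at_neq_bot] by blast
  \<comment> \<open>At the centre every term with a factor w - z0 drops out, and \<open>g1\<close>
    takes the value n g.\<close>
  then have "(of_nat n * (of_nat n + 2)) * g z0 ^ 2 = 0"
    by (simp add: K_def g1_def power2_eq_square algebra_simps)
  moreover have "of_nat n * (of_nat n + 2) \<noteq> (0 :: complex)"
  proof -
    have "of_nat n * (of_nat n + 2) = (of_nat (n * (n + 2)) :: complex)"
      by (simp add: algebra_simps)
    then show ?thesis using n by (simp only: of_nat_eq_0_iff) auto
  qed
  ultimately show False using gnz[of z0] \<rho>(1) by simp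
qed

text \<open>Divide by \<open>c\<^sup>2\<^sup>m\<close>, whose zeros all lie at infinity.\<close>
lemma modform_eq_0_of_order:
  assumes F: "unit_conv F" and f: "char_form (2 * m) (qser F)"
    and zero: "\<And>i. i \<le> 2 * m \<Longrightarrow> fps_nth F i = 0"
  shows "F = 0"
proof (rule ccontr)
  assume "F \<noteq> 0"
  then have sd: "2 * m + 1 \<le> subdegree F" using zero by (intro subdegree_geI) auto
  define k where "k = 2 * m"
  define \<phi> where "\<phi> = (\<lambda>z. qser F z / czero z ^ k)"
  obtain C where C: "C > 0" "\<And>z. Im z > 1 \<Longrightarrow> norm (qser F z) \<le> C * exp (- (2 * pi * real (2 * m + 1)) * Im z)"
    using qser_decay[OF F sd] by metis
  have s1: "subdegree (of_int_fps eis_zero :: complex fps) = 1"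
    by (rule subdegreeI) (simp_all add: eis_zero_nth_0 eis_zero_nth_1)
  then have c1: "of_int_fps eis_zero \<noteq> (0::complex fps)" by auto
  obtain Y c where Y: "Y > 0" "c > 0" "\<And>z. Im z > Y \<Longrightarrow> c * exp (- (2 * pi) * Im z) \<le> norm (czero z)"
    using qser_lower_bound[OF unit_conv_eis_zero c1] unfolding s1 czero_def by auto
  have a1: "of_int_fps eis_inf \<noteq> (0::complex fps)"
    by (metis eis_inf_nth_0 fps_zero_nth of_int_1 of_int_fps_nth zero_neq_one)
  have s0: "subdegree (of_int_fps eis_inf :: complex fps) = 0"
    by (rule subdegreeI) (simp_all add: eis_inf_nth_0)
  obtain Y' c' where Y': "Y' > 0" "c' > 0" "\<And>z. Im z > Y' \<Longrightarrow> c' \<le> norm (ainf z)"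
    using qser_lower_bound[OF unit_conv_eis_inf a1] unfolding s0 ainf_def by auto
  obtain \<kappa> where \<kappa>: "\<kappa> \<noteq> 0" "\<And>z. Im z > 0 \<Longrightarrow> czero (-1 / z) = \<kappa> * z\<^sup>2 * ainf (z / 5)"
    using czero_inversion by blast
  obtain Yf B where B: "Yf > 0" "B > 0" "\<And>z. Im z > Yf \<Longrightarrow> norm (qser F (-1 / z)) \<le> B * norm z ^ (2 * k)"
    using char_form_bdd[OF f] unfolding k_def by metis
  \<comment> \<open>The numerator has order at least \<open>2 * m + 1\<close> and the denominator
    exactly \<open>2 * m\<close>, so one power of q remains.\<close>
  have decay: "norm (\<phi> z) \<le> (C / c ^ k) * exp (- (2 * pi * real 1) * Im z)" if z: "Im z > max 1 Y" for z
  proof -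
    have "norm (\<phi> z) = norm (qser F z) / norm (czero z) ^ k"
      by (simp add: \<phi>_def norm_divide norm_power)
    also have "\<dots> \<le> (C * exp (- (2 * pi * real (2 * m + 1)) * Im z)) / (c * exp (- (2 * pi) * Im z)) ^ k"
      using C Y z by (intro frac_le power_mono) (auto intro!: mult_pos_pos)
    also have "\<dots> = (C / c ^ k) * (exp (- (2 * pi * real (2 * m + 1)) * Im z) / exp (real k * (- (2 * pi) * Im z)))"
      by (simp only: power_mult_distrib exp_of_nat_mult times_divide_times_eq)
    also have "exp (- (2 * pi * real (2 * m + 1)) * Im z) / exp (real k * (- (2 * pi) * Im z)) =
        exp (- (2 * pi * real 1) * Im z)"
      unfolding exp_diff[symmetric] by (simp add: k_def algebra_simps)
    finally show ?thesis .
  qed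
  have "char_form 0 \<phi>"
  proof (rule char_formI[where Y = "max 1 Y" and B = "C / c ^ k" and Y' = "max Yf (5 * Y')"
        and B' = "B / (norm \<kappa> * c') ^ k"])
    show "\<phi> holomorphic_on uhp"
      unfolding \<phi>_def using czero_nonzero
      by (intro holomorphic_intros char_form_holo[OF f] char_form_holo[OF char_form_czero]) auto
    show "\<phi> (moeb a b c d z) = of_int (chi5 d) ^ 0 * (of_int c * z + of_int d) ^ (2 * 0) * \<phi> z"
      if det: "a * d - b * c = 1" "5 dvd c" "Im z > 0" for a b c d z
    proof -
      have "of_int (chi5 d) ^ k = (1::complex)" using chi5_unit[OF det(1,2)] by (auto simp: k_def)
      moreover have "of_int (chi5 d) \<noteq> (0::complex)" using chi5_unit[OF det(1,2)] by auto
      ultimately show ?thesis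
        unfolding \<phi>_def char_form_trans[OF f det] char_form_trans[OF char_form_czero det]
        using moeb_denom_nonzero[OF det(1,3)] by (simp add: k_def power_mult_distrib power_mult)
    qed
    show "norm (\<phi> z) \<le> C / c ^ k" if z: "Im z > max 1 Y" for z
    proof -
      have "exp (- (2 * pi * real 1) * Im z) \<le> 1" using z by simp
      then have "(C / c ^ k) * exp (- (2 * pi * real 1) * Im z) \<le> (C / c ^ k) * 1"
        using C(1) Y(2) by (intro mult_left_mono) auto
      with decay[OF z] show ?thesis by simp
    qed
    \<comment> \<open>At the cusp 0 the denominator turns into a power of \<open>ainf\<close>,
      bounded below because of its constant term 1, and the accompanying power of z matches the
      growth allowed to the numerator.\<close>
    show "norm (\<phi> (-1 / z)) \<le> B / (norm \<kappa> * c') ^ k * norm z ^ (2 * 0)" if z: "Im z > max Yf (5 * Y')" for z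
    proof -
      have z': "Im z > 0" "z \<noteq> 0" "Im (z / 5) > Y'" using z B(1) by auto
      have "norm (\<phi> (-1 / z)) = norm (qser F (-1 / z)) / (norm \<kappa> * norm z ^ 2 * norm (ainf (z / 5))) ^ k"
        by (simp only: \<phi>_def norm_divide norm_power norm_mult \<kappa>(2)[OF z'(1)])
      also have "\<dots> \<le> (B * norm z ^ (2 * k)) / (norm \<kappa> * norm z ^ 2 * c') ^ k"
        using B(2) B(3)[of z] z z' Y'(2) Y'(3)[OF z'(3)] \<kappa>(1)
        by (intro frac_le power_mono mult_left_mono) (auto intro!: mult_pos_pos)
      also have "\<dots> = B / (norm \<kappa> * c') ^ k"
        using z' by (simp add: power_mult_distrib power_mult)
      finally show ?thesis by simp
    qed
  qed
  \<comment> \<open>In weight zero the weak criterion asks only for n = 1, which the remaining power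
    of q provides.\<close>
  then have "\<phi> z = 0" if "Im z > 0" for z
    by (rule char_form_vanishing[where n = 1 and Y = "max 1 Y", OF _ decay]) (use that in auto)
  then have "qser F z / czero z ^ k = 0" if "Im z > 0" for z
    using that unfolding \<phi>_def by blast
  then have "qser F z = 0" if "Im z > 0" for z
    using that czero_nonzero[OF that] by (metis divide_eq_0_iff power_not_zero)
  with qser_eq_0_imp[OF F] \<open>F \<noteq> 0\<close> show False by blast
qed

section \<open>Reduction mod 2\<close>

lemma prime_power_decomposition_unique:
  fixes p :: nat
  assumes "p ^ a * u = p ^ b * v" "\<not> p dvd u" "\<not> p dvd v" "p > 0"
  shows "a = b \<and> u = v"
proof -
  have le: "b \<le> a" if "p ^ a * u = p ^ b * v" "\<not> p dvd u" for a b u v :: nat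
  proof (rule ccontr)
    assume "\<not> b \<le> a"
    then have "b = a + Suc (b - a - 1)" by simp
    then obtain k where "b = a + Suc k" by blast
    with that(1) have "p ^ a * u = p ^ a * (p * (p ^ k * v))" by (simp add: power_add mult_ac)
    then have "u = p * (p ^ k * v)" using \<open>p > 0\<close> by simp
    with that(2) show False by simp
  qed
  from le[OF assms(1,2)] le[OF assms(1)[symmetric] assms(3)] have "a = b" by simp
  with assms(1,4) show ?thesis by simp
qed

lemma decomposition_2_5_unique:
  fixes u v :: nat
  assumes "2 ^ a * (5 ^ b * u) = 2 ^ c * (5 ^ d * v)"
    and "\<not> 2 dvd u" "\<not> 5 dvd u" "\<not> 2 dvd v" "\<not> 5 dvd v"
  shows "a = c \<and> b = d \<and> u = v"
proof -
  have "\<not> 2 dvd 5 ^ b * u" "\<not> 2 dvd 5 ^ d * v" using assms by auto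
  with prime_power_decomposition_unique[OF assms(1)] have "a = c" "5 ^ b * u = 5 ^ d * v" by auto
  with prime_power_decomposition_unique[OF this(2) assms(3,5)] show ?thesis by simp
qed

lemma decomposition_2_5:
  assumes "N > (0::nat)"
  obtains a b u where "N = 2 ^ a * (5 ^ b * u)" "\<not> 2 dvd u" "\<not> 5 dvd u" "u > 0"
proof -
  obtain v where v: "N = 2 ^ multiplicity 2 N * v" "\<not> 2 dvd v"
    using multiplicity_decompose'[of N 2] assms by auto
  then have "v \<noteq> 0" by (metis dvd_0_right)
  then obtain u where u: "v = 5 ^ multiplicity 5 v * u" "\<not> 5 dvd u"
    using multiplicity_decompose'[of v 5] by auto
  have "\<not> 2 dvd u" using v(2) u(1) by (metis dvd_mult)
  moreover have "u > 0" using u(2) by (cases u) auto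
  ultimately show ?thesis using that u v by metis
qed

text \<open>Empty or a singleton, so its cardinality is the indicator of u being a square; both r
  and the divisor counts are compared with it.\<close>

definition square_roots :: "nat \<Rightarrow> nat set" where
  "square_roots u = {d. d * d = u}"

text \<open>The involution \<open>d \<mapsto> u div d\<close> pairs the divisors of \<open>u\<close> up to its fixed points.\<close>
lemma of_nat_card_divisors:
  assumes "u > 0"
  shows "(of_nat (card {d. d dvd u}) :: bit) = of_nat (card (square_roots u))"
proof -
  define A B where "A = {d. d dvd u \<and> d * d < u}" and "B = {d. d dvd u \<and> d * d > u}"
  have fin: "finite {d. d dvd u}" using assms by simp
  have finAB: "finite A" "finite B" "finite (square_roots u)"
    using fin by (auto simp: A_def B_def square_roots_def intro: finite_subset[of _ "{d. d dvd u}"])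
  have "bij_betw (\<lambda>d. u div d) A B"
  proof (rule bij_betw_byWitness[where f' = "\<lambda>d. u div d"])
    show "\<forall>a\<in>A. u div (u div a) = a" "\<forall>a\<in>B. u div (u div a) = a"
      using assms by (auto simp: A_def B_def elim!: dvdE)
    show "(\<lambda>d. u div d) ` A \<subseteq> B"
    proof
      fix k assume "k \<in> (\<lambda>d. u div d) ` A"
      then obtain d where d: "d dvd u" "d * d < u" "k = u div d" by (auto simp: A_def)
      then have u: "u = d * k" by simp
      then have "d < k" using d(2) by simp
      then show "k \<in> B" using u assms by (auto simp: B_def)
    qed
    show "(\<lambda>d. u div d) ` B \<subseteq> A"
    proof
      fix k assume "k \<in> (\<lambda>d. u div d) ` B"
      then obtain d where d: "d dvd u" "d * d > u" "k = u div d" by (auto simp: B_def)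
      then have u: "u = d * k" by simp
      then have "k < d" using d(2) by simp
      then show "k \<in> A" using u assms by (auto simp: A_def)
    qed
  qed
  then have "card A = card B" by (rule bij_betw_same_card)
  moreover have "{d. d dvd u} = (A \<union> B) \<union> square_roots u"
    by (auto simp: A_def B_def square_roots_def)
  moreover have "card ((A \<union> B) \<union> square_roots u) = card A + card B + card (square_roots u)"
    using finAB by (subst card_Un_disjoint; (subst card_Un_disjoint)?) (auto simp: A_def B_def square_roots_def)
  ultimately have "card {d. d dvd u} = 2 * card A + card (square_roots u)" by simp
  then show ?thesis by simp
qed

lemma power_2_5_square:
  "2 ^ (x + 2 * i) * (5 ^ (y + 2 * j) * (d * d)) = (2 ^ x * 5 ^ y) * (2 ^ i * (5 ^ j * d))\<^sup>2" for d :: nat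
proof -
  have "(c::nat) ^ (x + 2 * i) = c ^ x * (c ^ i * c ^ i)" for c x i
    by (simp only: power_add mult_2)
  then show ?thesis by (simp only: power2_eq_square mult_ac)
qed

text \<open>The numbers 1, 2, 5, 10 are the products of 2 and 5 with exponents 0 or 1. In
  \<open>t * n\<^sup>2\<close> the parities of the exponents of 2 and 5 therefore determine t, their
  halves go into n, and u has to be a square.\<close>

lemma card_r_exponents:
  assumes u: "\<not> 2 dvd u" "\<not> 5 dvd u" "u > 0" and N: "N = 2 ^ a * (5 ^ b * u)"
  shows "card {(t, n::nat). t \<in> {1, 2, 5, 10::nat} \<and> n > 0 \<and> N = t * n\<^sup>2} = card (square_roots u)"
proof -
  define h where "h = (\<lambda>d::nat. (2 ^ (a mod 2) * 5 ^ (b mod 2) :: nat, 2 ^ (a div 2) * (5 ^ (b div 2) * d)))"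
  have "bij_betw h (square_roots u) {(t, n::nat). t \<in> {1, 2, 5, 10::nat} \<and> n > 0 \<and> N = t * n\<^sup>2}"
  proof (rule bij_betw_imageI)
    show "inj_on h (square_roots u)" by (auto simp: inj_on_def h_def)
    show "h ` square_roots u = {(t, n::nat). t \<in> {1, 2, 5, 10::nat} \<and> n > 0 \<and> N = t * n\<^sup>2}"
    proof (intro equalityI subsetI)
      fix p assume "p \<in> h ` square_roots u"
      then obtain d where d: "d * d = u" "p = h d" by (auto simp: square_roots_def)
      have "d > 0" using d u by (cases d) auto
      moreover have "2 ^ (a mod 2) * 5 ^ (b mod 2) \<in> {1, 2, 5, 10::nat}"
        using mod_2_eq_odd[of a] mod_2_eq_odd[of b] by (cases "odd a"; cases "odd b") simp_all
      moreover have "N = (2 ^ (a mod 2) * 5 ^ (b mod 2)) * (2 ^ (a div 2) * (5 ^ (b div 2) * d))\<^sup>2"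
      proof -
        have *: "a mod 2 + 2 * (a div 2) = a" "b mod 2 + 2 * (b div 2) = b" by simp_all
        show ?thesis
          using power_2_5_square[of "a mod 2" "a div 2" "b mod 2" "b div 2" d] unfolding * d(1) N .
      qed
      ultimately show "p \<in> {(t, n::nat). t \<in> {1, 2, 5, 10::nat} \<and> n > 0 \<and> N = t * n\<^sup>2}"
        unfolding d(2) h_def by auto
    next
      fix p assume "p \<in> {(t, n::nat). t \<in> {1, 2, 5, 10::nat} \<and> n > 0 \<and> N = t * n\<^sup>2}"
      then obtain t n where p: "p = (t, n)" "t \<in> {1, 2, 5, 10}" "n > 0" "N = t * n\<^sup>2" by auto
      obtain x y where xy: "x < 2" "y < 2" "t = 2 ^ x * 5 ^ y"
        using p(2) that[of 0 0] that[of 1 0] that[of 0 1] that[of 1 1] by auto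
      obtain i j d where n: "n = 2 ^ i * (5 ^ j * d)" "\<not> 2 dvd d" "\<not> 5 dvd d"
        using decomposition_2_5[OF p(3)] by metis
      have "prime (2::nat)" "prime (5::nat)" by simp_all
      then have d: "\<not> 2 dvd d * d" "\<not> 5 dvd d * d" using n by (auto simp: prime_dvd_mult_iff)
      have "2 ^ (x + 2 * i) * (5 ^ (y + 2 * j) * (d * d)) = t * n\<^sup>2"
        unfolding xy(3) n(1) by (rule power_2_5_square)
      then have "2 ^ (x + 2 * i) * (5 ^ (y + 2 * j) * (d * d)) = 2 ^ a * (5 ^ b * u)"
        using N p(4) by simp
      from decomposition_2_5_unique[OF this d u(1,2)] have *: "a = x + 2 * i" "b = y + 2 * j" "u = d * d" by auto
      have "a mod 2 = x" "a div 2 = i" "b mod 2 = y" "b div 2 = j" using * xy by auto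
      then have "p = h d" by (simp add: h_def p(1) xy(3) n(1))
      then show "p \<in> h ` square_roots u" using * by (auto simp: square_roots_def)
    qed
  qed
  from bij_betw_same_card[OF this] show ?thesis by simp
qed

lemma r_nth:
  assumes "\<not> 2 dvd u" "\<not> 5 dvd u" "u > 0"
  shows "fps_nth r (2 ^ a * (5 ^ b * u)) = of_nat (card (square_roots u))"
  unfolding r_def fps_nth_Abs_fps using card_r_exponents[OF assms refl] by simp

lemma r_nth_0: "fps_nth r 0 = 0"
proof -
  have "{(t, n::nat). t \<in> {1, 2, 5, 10::nat} \<and> n > 0 \<and> 0 = t * n\<^sup>2} = {}" by auto
  then show ?thesis by (simp only: r_def fps_nth_Abs_fps card.empty of_nat_0)
qed

lemma dvd_coprime_10_part:
  assumes N: "2 ^ a * (5 ^ b * u) = m * k" and k: "\<not> 2 dvd k" "\<not> 5 dvd k"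
  shows "k dvd (u::nat)"
proof -
  have "coprime k (2 ^ a)" "coprime k (5 ^ b)"
    using k prime_imp_coprime[of "2::nat" k] prime_imp_coprime[of "5::nat" k] by (simp_all add: coprime_commute)
  moreover have "k dvd 2 ^ a * (5 ^ b * u)" using N by simp
  ultimately show ?thesis by (simp add: coprime_dvd_mult_right_iff)
qed

text \<open>Counts the odd terms in a coefficient of \<open>eis_inf\<close>:
  \<open>chi5 k * k\<close> is odd exactly for k prime to 10, and such cofactors are the divisors of
  u.\<close>

lemma card_quotients_coprime_10:
  fixes N u :: nat
  assumes u: "\<not> 2 dvd u" "\<not> 5 dvd u" "u > 0" and N: "N = 2 ^ a * (5 ^ b * u)"
  shows "card {m. m dvd N \<and> \<not> 5 dvd (N div m) \<and> odd (N div m)} = card {d. d dvd u}"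
proof -
  have N0: "N > 0" using N u by simp
  have "bij_betw (\<lambda>d. N div d) {d. d dvd u} {m. m dvd N \<and> \<not> 5 dvd (N div m) \<and> odd (N div m)}"
  proof (rule bij_betw_byWitness[where f' = "\<lambda>d. N div d"])
    have dN: "d dvd N" if "d dvd u" for d using that unfolding N by simp
    have inv: "N div (N div d) = d" if dv: "d dvd N" for d
    proof -
      obtain k where "N = d * k" using dv by (auto elim: dvdE)
      with N0 show ?thesis by auto
    qed
    then show "\<forall>d\<in>{d. d dvd u}. N div (N div d) = d"
      using dN by blast
    show "\<forall>m\<in>{m. m dvd N \<and> \<not> 5 dvd (N div m) \<and> odd (N div m)}. N div (N div m) = m"
      using inv by blast
    show "(\<lambda>d. N div d) ` {d. d dvd u} \<subseteq> {m. m dvd N \<and> \<not> 5 dvd (N div m) \<and> odd (N div m)}"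
    proof (clarify)
      fix d assume d: "d dvd u"
      then obtain k where k: "N = d * k" using dN by (auto elim: dvdE)
      have "d > 0" using d u by (cases d) auto
      then have "N div d = k" "N div k = d" using k N0 by auto
      then show "N div d dvd N \<and> \<not> 5 dvd (N div (N div d)) \<and> odd (N div (N div d))"
        using d u k by (auto dest: dvd_trans)
    qed
    show "(\<lambda>m. N div m) ` {m. m dvd N \<and> \<not> 5 dvd (N div m) \<and> odd (N div m)} \<subseteq> {d. d dvd u}"
    proof (clarify)
      fix m assume m: "m dvd N" "\<not> 5 dvd (N div m)" "odd (N div m)"
      then have "2 ^ a * (5 ^ b * u) = m * (N div m)" using N by simp
      from dvd_coprime_10_part[OF this] m show "N div m dvd u" by simp
    qed
  qed
  from bij_betw_same_card[OF this] show ?thesis by simp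
qed

text \<open>Counts the odd terms in a coefficient of \<open>eis_zero\<close>: an odd cofactor leaves
  the full power of 2 in m, and m has no factor 5, so m is 2^a times a divisor of u.\<close>

lemma card_divisors_odd_quotient:
  fixes N u :: nat
  assumes u: "\<not> 2 dvd u" "\<not> 5 dvd u" "u > 0" and N: "N = 2 ^ a * (5 ^ b * u)"
  shows "card {m. m dvd N \<and> \<not> 5 dvd m \<and> odd (N div m)} = card {d. d dvd u}"
proof -
  have N0: "N > 0" using N u by simp
  have "bij_betw (\<lambda>d. 2 ^ a * d) {d. d dvd u} {m. m dvd N \<and> \<not> 5 dvd m \<and> odd (N div m)}"
  proof (rule bij_betw_imageI)
    show "inj_on (\<lambda>d. 2 ^ a * d) {d. d dvd u}" by (auto simp: inj_on_def)
    show "(\<lambda>d. 2 ^ a * d) ` {d. d dvd u} = {m. m dvd N \<and> \<not> 5 dvd m \<and> odd (N div m)}"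
    proof (intro equalityI subsetI)
      fix m assume "m \<in> (\<lambda>d. 2 ^ a * d) ` {d. d dvd u}"
      then obtain d k where d: "m = 2 ^ a * d" "u = d * k" by (auto elim!: dvdE)
      have eq: "N = m * (5 ^ b * k)" unfolding N d by simp
      have p5: "prime (5::nat)" by simp
      then have "\<not> 5 dvd (2::nat) ^ a" using prime_dvd_power[of "5::nat" 2 a] by auto
      then have "\<not> 5 dvd m" using u(2) d p5 by (auto simp: prime_dvd_mult_iff)
      moreover have "N div m = 5 ^ b * k" using eq N0 by auto
      moreover have "odd k" using u(1) d(2) by auto
      ultimately show "m \<in> {m. m dvd N \<and> \<not> 5 dvd m \<and> odd (N div m)}" using eq by simp
    next
      fix m assume "m \<in> {m. m dvd N \<and> \<not> 5 dvd m \<and> odd (N div m)}"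
      then have m: "m dvd N" "\<not> 5 dvd m" "odd (N div m)" by auto
      define k where "k = N div m"
      have Nk: "N = m * k" using m by (simp add: k_def)
      have "m > 0" using Nk N0 by (cases m) auto
      then obtain v where v': "m = 2 ^ multiplicity 2 m * v" "\<not> 2 dvd v"
        using multiplicity_decompose'[of m 2] by auto
      then obtain i where v: "m = 2 ^ i * v" "\<not> 2 dvd v" by blast
      have "2 ^ i * (v * k) = 2 ^ a * (5 ^ b * u)" using Nk N v by (simp add: mult_ac)
      moreover have "\<not> 2 dvd v * k" "\<not> 2 dvd 5 ^ b * u" using v m u by (auto simp: k_def)
      ultimately have *: "i = a" "v * k = 5 ^ b * u"
        using prime_power_decomposition_unique[of 2 i "v * k" a "5 ^ b * u"] by auto
      have "\<not> 5 dvd v" using m(2) v(1) by auto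
      moreover have "2 ^ 0 * (5 ^ b * u) = k * v" using * by (simp add: mult.commute)
      ultimately have "v dvd u" using v(2) dvd_coprime_10_part[of 0 b u k v] by blast
      then show "m \<in> (\<lambda>d. 2 ^ a * d) ` {d. d dvd u}" using v * by auto
    qed
  qed
  from bij_betw_same_card[OF this] show ?thesis by simp
qed

lemma of_int_bit: "(of_int n :: bit) = of_bool (odd n)"
proof -
  have even: "(of_int (2 * k) :: bit) = 0" for k
    by (simp only: of_int_mult of_int_numeral bit_2_eq_0 mult_zero_left)
  have "n = 2 * (n div 2) + n mod 2" by simp
  then have "(of_int n :: bit) = of_int (2 * (n div 2)) + of_int (n mod 2)"
    by (metis of_int_add)
  then show ?thesis
    unfolding even by (cases "even n") (simp_all add: even_iff_mod_2_eq_zero odd_iff_mod_2_eq_one)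
qed

lemma odd_chi5: "odd (chi5 n) \<longleftrightarrow> \<not> 5 dvd n"
proof -
  have "n mod 5 = 0 \<or> n mod 5 = 1 \<or> n mod 5 = 2 \<or> n mod 5 = 3 \<or> n mod 5 = 4" by presburger
  moreover have "5 dvd n \<longleftrightarrow> n mod 5 = 0" by presburger
  ultimately show ?thesis unfolding chi5_def by (elim disjE) simp_all
qed

lemma five_dvd_int: "5 dvd int k \<longleftrightarrow> 5 dvd k"
  by (metis of_nat_dvd_iff of_nat_numeral)

lemma of_int_fps_lambert_nth:
  assumes "N > 0"
  shows "fps_nth (of_int_fps (lambert w) :: bit fps) N = of_nat (card {m. m dvd N \<and> odd (w m (N div m))})"
proof -
  have fin: "finite {m. m dvd N}" using assms by simp
  have "fps_nth (of_int_fps (lambert w) :: bit fps) N = (\<Sum>m | m dvd N. of_int (w m (N div m)))"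
    using assms by (simp add: lambert_def)
  also have "\<dots> = (\<Sum>m | m dvd N. of_bool (odd (w m (N div m))))"
    by (simp only: of_int_bit)
  also have "\<dots> = of_nat (card ({m. m dvd N} \<inter> {m. odd (w m (N div m))}))"
    by (rule sum_of_bool_eq; rule fin)
  also have "{m. m dvd N} \<inter> {m. odd (w m (N div m))} = {m. m dvd N \<and> odd (w m (N div m))}" by auto
  finally show ?thesis .
qed

lemma eis_zero_mod_2: "of_int_fps eis_zero = r"
proof (rule fps_ext)
  fix N
  show "fps_nth (of_int_fps eis_zero) N = fps_nth r N"
  proof (cases "N = 0")
    case False
    then obtain a b u where N: "N = 2 ^ a * (5 ^ b * u)" and u: "\<not> 2 dvd u" "\<not> 5 dvd u" "u > 0"
      using decomposition_2_5[of N] by auto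
    have "fps_nth (of_int_fps eis_zero :: bit fps) N = of_nat (card {m. m dvd N \<and> \<not> 5 dvd m \<and> odd (N div m)})"
      unfolding eis_zero_def using False by (subst of_int_fps_lambert_nth) (simp_all add: odd_chi5 five_dvd_int)
    also have "\<dots> = fps_nth r N"
      by (simp only: card_divisors_odd_quotient[OF u N] of_nat_card_divisors[OF u(3)] r_nth[OF u, of a b, folded N])
    finally show ?thesis .
  qed (simp add: eis_zero_nth_0 r_nth_0)
qed

lemma eis_inf_mod_2: "of_int_fps eis_inf = 1 + r"
proof (rule fps_ext)
  fix N
  show "fps_nth (of_int_fps eis_inf) N = fps_nth (1 + r) N"
  proof (cases "N = 0")
    case False
    then obtain a b u where N: "N = 2 ^ a * (5 ^ b * u)" and u: "\<not> 2 dvd u" "\<not> 5 dvd u" "u > 0"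
      using decomposition_2_5[of N] by auto
    have "fps_nth (of_int_fps (lambert (\<lambda>m k. chi5 (int k) * int k)) :: bit fps) N
      = of_nat (card {m. m dvd N \<and> \<not> 5 dvd (N div m) \<and> odd (N div m)})"
      using False by (subst of_int_fps_lambert_nth) (simp_all add: odd_chi5 five_dvd_int)
    also have "\<dots> = fps_nth r N"
      by (simp only: card_quotients_coprime_10[OF u N] of_nat_card_divisors[OF u(3)] r_nth[OF u, of a b, folded N])
    finally show ?thesis
      using False by (simp add: eis_inf_def)
  qed (simp add: eis_inf_nth_0 r_nth_0)
qed

section \<open>Bases\<close>

lemma bit_double: "a + a = (0::bit)"
  by (cases a) simp_all

lemma fps_bit_double: "F + F = (0 :: bit fps)"
  by (simp add: fps_eq_iff bit_double)

lemma r_nth_1: "fps_nth r (Suc 0) = 1"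
  using arg_cong[OF eis_zero_mod_2, of "\<lambda>F. fps_nth F (Suc 0)"] by (simp add: eis_zero_nth_1)

text \<open>By \<open>r_nth\<close> a coefficient depends only on the part of the index prime to 10.
  With the squaring rule over \<open>bit\<close>, r^2 and r then agree at even exponents, which is
  why r^2 + r is odd.\<close>

lemma r_nth_double: "fps_nth r (2 * n) = fps_nth r n"
proof (cases "n = 0")
  case False
  then obtain a b u where n: "n = 2 ^ a * (5 ^ b * u)" and u: "\<not> 2 dvd u" "\<not> 5 dvd u" "u > 0"
    using decomposition_2_5[of n] by auto
  have "2 * n = 2 ^ Suc a * (5 ^ b * u)" by (simp add: n)
  then show ?thesis using r_nth[OF u, of "Suc a" b] r_nth[OF u, of a b] by (simp only: n)
qed simp

text \<open>The terms for i and n - i cancel over \<open>bit\<close>; at most the middle one is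
  left, and it is idempotent.\<close>

lemma fps_bit_square_nth:
  fixes F :: "bit fps"
  shows "fps_nth (F ^ 2) n = (if even n then fps_nth F (n div 2) else 0)"
proof -
  define A B where "A = {i. i \<le> n \<and> 2 * i < n}" and "B = {i. i \<le> n \<and> n < 2 * i}"
  define f where "f = (\<lambda>i. fps_nth F i * fps_nth F (n - i))"
  have BA: "sum f B = sum f A"
    by (rule sum.reindex_bij_witness[where i = "\<lambda>i. n - i" and j = "\<lambda>i. n - i"])
       (auto simp: A_def B_def f_def mult.commute)
  have fin: "finite A" "finite B" by (auto simp: A_def B_def)
  have "{0..n} = (A \<union> B) \<union> {i. 2 * i = n}" by (auto simp: A_def B_def)
  then have "sum f {0..n} = sum f ((A \<union> B) \<union> {i. 2 * i = n})" by simp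
  also have "\<dots> = (sum f A + sum f B) + sum f {i. 2 * i = n}"
  proof -
    have "finite {i. 2 * i = n}" by (rule finite_subset[of _ "{0..n}"]) auto
    with fin show ?thesis
      by (subst sum.union_disjoint; (subst sum.union_disjoint)?) (auto simp: A_def B_def)
  qed
  also have "\<dots> = sum f {i. 2 * i = n}" by (simp add: BA bit_double)
  also have "\<dots> = (if even n then fps_nth F (n div 2) else 0)"
  proof (cases "even n")
    case True
    then have "{i. 2 * i = n} = {n div 2}" by auto
    moreover have "n - n div 2 = n div 2" using True by auto
    moreover have "a * a = a" for a :: bit by (cases a) auto
    ultimately have "f (n div 2) = fps_nth F (n div 2)" by (simp only: f_def)
    moreover have "sum f {n div 2} = f (n div 2)" by simp
    ultimately show ?thesis using True \<open>{i. 2 * i = n} = {n div 2}\<close> by (simp only: if_True)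
  next
    case False
    then have "{i. 2 * i = n} = {}" by auto
    with False show ?thesis by simp
  qed
  finally show ?thesis by (simp add: power2_eq_square fps_mult_nth f_def)
qed

lemma r_square_plus_r_nth_even: "even n \<Longrightarrow> fps_nth (r ^ 2 + r) n = 0"
  by (elim evenE) (simp add: fps_bit_square_nth r_nth_double)

lemma r_even_power_nth_odd: "odd n \<Longrightarrow> fps_nth (r ^ (2 * k)) n = 0"
  unfolding power_even_eq fps_bit_square_nth by simp

lemma fps_even_mult_odd:
  fixes F G :: "'a::comm_ring_1 fps"
  assumes "\<And>n. odd n \<Longrightarrow> fps_nth F n = 0" "\<And>n. even n \<Longrightarrow> fps_nth G n = 0" "even n"
  shows "fps_nth (F * G) n = 0"
  unfolding fps_mult_nth
proof (intro sum.neutral ballI)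
  fix i assume "i \<in> {0..n}"
  then show "fps_nth F i * fps_nth G (n - i) = 0"
    using assms by (cases "even i") auto
qed

text \<open>Strong induction on k: at the exponent \<open>d k\<close> the elements of larger index
  have not yet started, and those of smaller index already have coefficient zero.\<close>

lemma triangular_independence:
  fixes E :: "nat \<Rightarrow> 'a::comm_ring_1 fps"
  assumes mono: "strict_mono d"
    and E: "\<And>i j. j < d i \<Longrightarrow> fps_nth (E i) j = 0" "\<And>i. fps_nth (E i) (d i) = 1"
    and zero: "(\<Sum>i\<le>n. fps_const (c i) * E i) = 0" and k: "k \<le> n"
  shows "c k = 0"
  using k
proof (induction k rule: less_induct)
  case (less k)
  have "0 = fps_nth (\<Sum>i\<le>n. fps_const (c i) * E i) (d k)" by (simp add: zero)
  also have "\<dots> = (\<Sum>i\<le>n. c i * fps_nth (E i) (d k))" by (simp add: fps_sum_nth)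
  also have "\<dots> = (\<Sum>i\<in>{k}. c i * fps_nth (E i) (d k))"
  proof (rule sum.mono_neutral_right)
    show "\<forall>i\<in>{..n} - {k}. c i * fps_nth (E i) (d k) = 0"
    proof
      fix i assume i: "i \<in> {..n} - {k}"
      then consider "i < k" | "k < i" by force
      then show "c i * fps_nth (E i) (d k) = 0"
      proof cases
        case 1
        with less i show ?thesis by simp
      next
        case 2
        then have "d k < d i" using mono by (simp add: strict_mono_less)
        then show ?thesis by (simp add: E(1))
      qed
    qed
  qed (use less in auto)
  also have "\<dots> = c k" by (simp add: E(2))
  finally show ?case by simp
qed

lemma r_powers_independent:
  assumes "(\<Sum>i\<le>n. fps_const (c i) * r ^ i) = 0" "i \<le> n"
  shows "c i = 0"
  using fps_power_mult_nth[OF r_nth_0 r_nth_1, where G = 1] strict_monoI[of "\<lambda>i::nat. i"]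
  by (intro triangular_independence[where d = "\<lambda>i. i" and E = "\<lambda>i. r ^ i", OF _ _ _ assms]) auto

lemma r_odd_basis_independent:
  assumes "(\<Sum>k\<le>n. fps_const (c k) * (r ^ (2 * k) * (r\<^sup>2 + r))) = 0" "k \<le> n"
  shows "c k = 0"
proof (rule triangular_independence[where d = "\<lambda>k. 2 * k + 1" and E = "\<lambda>k. r ^ (2 * k) * (r\<^sup>2 + r)", OF _ _ _ assms])
  show "strict_mono (\<lambda>k::nat. 2 * k + 1)" by (rule strict_monoI) simp
  \<comment> \<open>In this form the order 2 k + 1 is visible, and the cofactor has constant term
    1.\<close>
  have eq: "r ^ (2 * k) * (r\<^sup>2 + r) = r ^ (2 * k + 1) * (r + 1)" for k
    by (simp add: power2_eq_square algebra_simps)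
  show "fps_nth (r ^ (2 * k) * (r\<^sup>2 + r)) j = 0" if "j < 2 * k + 1" for j k
    unfolding eq using that by (rule fps_power_mult_nth(1)[OF r_nth_0 r_nth_1])
  show "fps_nth (r ^ (2 * k) * (r\<^sup>2 + r)) (2 * k + 1) = 1" for k
    unfolding eq fps_power_mult_nth(2)[OF r_nth_0 r_nth_1] by (simp add: r_nth_0)
qed

section \<open>Integral forms lifting the powers of r\<close>

definition int_basis :: "nat \<Rightarrow> nat \<Rightarrow> int fps" where
  "int_basis n i = eis_zero ^ i * (eis_inf + eis_zero) ^ (n - i)"

lemma int_basis_mod_2: "of_int_fps (int_basis n i) = r ^ i"
proof -
  have "1 + r + r = 1" by (simp only: add.assoc fps_bit_double add_0_right)
  then show ?thesis
    unfolding int_basis_def of_int_fps_mult of_int_fps_power of_int_fps_add eis_zero_mod_2 eis_inf_mod_2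
    by (simp only: power_one mult_1_right)
qed

lemma int_basis_nth: "j < i \<Longrightarrow> fps_nth (int_basis n i) j = 0" "fps_nth (int_basis n i) i = 1"
  unfolding int_basis_def
  by (simp_all add: eis_zero_power_nth fps_power_zeroth eis_inf_nth_0 eis_zero_nth_0)

lemma unit_conv_int_basis: "unit_conv (of_int_fps (int_basis n i))"
  unfolding int_basis_def of_int_fps_mult of_int_fps_power of_int_fps_add
  by (intro unit_conv_mult unit_conv_power unit_conv_add unit_conv_eis_inf unit_conv_eis_zero)

lemma char_form_int_basis:
  assumes "i \<le> n"
  shows "char_form n (qser (of_int_fps (int_basis n i)))"
proof (rule char_form_cong)
  have "char_form 1 (\<lambda>z. ainf z + czero z)"
    by (rule char_form_add[OF char_form_ainf char_form_czero])
  from char_form_monomial[OF this, of i "n - i"] assms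
  show "char_form n (\<lambda>z. czero z ^ i * (ainf z + czero z) ^ (n - i))" by simp
  show "qser (of_int_fps (int_basis n i)) z = czero z ^ i * (ainf z + czero z) ^ (n - i)" if "Im z > 0" for z
    unfolding int_basis_def of_int_fps_mult of_int_fps_power of_int_fps_add czero_def ainf_def
    using that
    by (simp add: qser_mult qser_power qser_add unit_conv_power unit_conv_add unit_conv_eis_inf unit_conv_eis_zero)
qed

lemma int_basis_span:
  fixes \<alpha> :: "nat \<Rightarrow> int" and n :: nat
  defines "G \<equiv> (\<Sum>i\<le>n. fps_const (\<alpha> i) * int_basis n i)"
  shows "unit_conv (of_int_fps G)" "char_form n (qser (of_int_fps G))"
    "of_int_fps G = (\<Sum>i\<le>n. fps_const (of_int (\<alpha> i)) * r ^ i)"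
proof -
  \<comment> \<open>Kept over an arbitrary ring, since it is used both over the complex numbers and
    over \<open>bit\<close>.\<close>
  have eq: "of_int_fps G = (\<Sum>i\<le>n. fps_const (of_int (\<alpha> i)) * of_int_fps (int_basis n i) :: 'a::comm_ring_1 fps)"
    by (simp add: G_def of_int_fps_sum of_int_fps_mult of_int_fps_const)
  show "unit_conv (of_int_fps G)"
    unfolding eq by (intro unit_conv_sum unit_conv_mult unit_conv_const unit_conv_int_basis)
  show "of_int_fps G = (\<Sum>i\<le>n. fps_const (of_int (\<alpha> i)) * r ^ i)"
    unfolding eq int_basis_mod_2 ..
  show "char_form n (qser (of_int_fps G))"
  proof (rule char_form_cong)
    show "char_form n (\<lambda>z. \<Sum>i\<le>n. of_int (\<alpha> i) * qser (of_int_fps (int_basis n i)) z)"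
      by (intro char_form_sum char_form_cmult char_form_int_basis) auto
    show "qser (of_int_fps G) z = (\<Sum>i\<le>n. of_int (\<alpha> i) * qser (of_int_fps (int_basis n i)) z)" if "Im z > 0" for z
      unfolding eq using that by (simp add: qser_sum qser_mult unit_conv_mult unit_conv_int_basis)
  qed
qed

lemma exp_eq_qexp_power: "exp (2 * of_real pi * \<i> * of_nat n * z) = qexp z ^ n"
  by (simp add: qexp_def mult_ac flip: exp_of_nat_mult)

lemma Mk_eq_span: "Mk (4 * m) = {(\<Sum>i\<le>2 * m. fps_const (c i) * r ^ i) | c. True}"
proof (intro equalityI subsetI)
  fix F assume "F \<in> Mk (4 * m)"
  then obtain a f where F: "F = Abs_fps (\<lambda>n. of_int (a n))" and f: "modform_G05 (4 * m) f"
    and exp: "\<And>z. z \<in> uhp \<Longrightarrow> (\<lambda>n. of_int (a n) * exp (2 * of_real pi * \<i> * of_nat n * z)) sums f z"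
    unfolding Mk_def by blast
  define P where "P = Abs_fps a"
  have P: "of_int_fps P = F" by (simp add: F P_def of_int_fps_def)
  have sums: "(\<lambda>n. fps_nth (of_int_fps P) n * qexp z ^ n) sums f z" if "Im z > 0" for z
    using exp[of z] that by (simp add: P_def exp_eq_qexp_power)
  \<comment> \<open>The expansion converges at every value of \<open>qexp\<close> on the half-plane,
    that is, throughout the punctured unit disc.\<close>
  have uP: "unit_conv (of_int_fps P)"
  proof (rule unit_convI)
    fix q :: complex assume "norm q < 1" "q \<noteq> 0"
    then obtain z where "Im z > 0" "qexp z = q" using qexp_surj by blast
    with sums[of z] show "summable (\<lambda>n. fps_nth (of_int_fps P) n * q ^ n)" by (auto simp: sums_iff)
  qed
  have "char_form (2 * m) f" using modform_imp_char_form[of "2 * m" f] f by simp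
  then have fP: "char_form (2 * m) (qser (of_int_fps P))"
    by (rule char_form_cong) (use qser_eqI[OF sums] in blast)
  \<comment> \<open>Elimination over the integers, so that the resulting combination can be reduced
    modulo 2.\<close>
  obtain \<alpha> where \<alpha>: "\<And>j. j \<le> 2 * m \<Longrightarrow> fps_nth (P - (\<Sum>i\<le>2 * m. fps_const (\<alpha> i) * int_basis (2 * m) i)) j = 0"
    using triangular_elimination[of "2 * m" "int_basis (2 * m)" P] int_basis_nth by blast
  define G where "G = (\<Sum>i\<le>2 * m. fps_const (\<alpha> i) * int_basis (2 * m) i)"
  note G = int_basis_span[where n = "2 * m" and \<alpha> = \<alpha>, folded G_def]
  have "of_int_fps (P - G) = (0 :: complex fps)"
  proof (rule modform_eq_0_of_order)
    show "unit_conv (of_int_fps (P - G))"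
      unfolding of_int_fps_diff by (intro unit_conv_diff uP G(1))
    show "char_form (2 * m) (qser (of_int_fps (P - G)))"
      by (rule char_form_cong[OF char_form_diff[OF fP G(2)]])
         (simp add: of_int_fps_diff qser_diff uP G(1))
    show "fps_nth (of_int_fps (P - G)) i = (0::complex)" if "i \<le> 2 * m" for i
      using \<alpha>[OF that] by (simp add: G_def)
  qed
  then have "P = G" by (simp add: fps_eq_iff)
  then have "F = (\<Sum>i\<le>2 * m. fps_const (of_int (\<alpha> i)) * r ^ i)"
    using P G(3) by simp
  then show "F \<in> {(\<Sum>i\<le>2 * m. fps_const (c i) * r ^ i) | c. True}"
    unfolding mem_Collect_eq by (intro exI conjI TrueI)
next
  fix F assume "F \<in> {(\<Sum>i\<le>2 * m. fps_const (c i) * r ^ i) | c. True}"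
  then obtain c where F: "F = (\<Sum>i\<le>2 * m. fps_const (c i) * r ^ i)" by blast
  define \<alpha> :: "nat \<Rightarrow> int" where "\<alpha> = (\<lambda>i. if c i = 0 then 0 else 1)"
  define G where "G = (\<Sum>i\<le>2 * m. fps_const (\<alpha> i) * int_basis (2 * m) i)"
  note G = int_basis_span[where n = "2 * m" and \<alpha> = \<alpha>, folded G_def]
  have "of_int (\<alpha> i) = c i" for i by (simp add: \<alpha>_def)
  then have "of_int_fps G = F" using G(3) F by simp
  then have "F = Abs_fps (\<lambda>n. of_int (fps_nth G n))" by (simp add: of_int_fps_def)
  moreover have "modform_G05 (4 * m) (qser (of_int_fps G))"
    using char_form_imp_modform[OF G(2)] by simp
  moreover have "(\<lambda>n. of_int (fps_nth G n) * exp (2 * of_real pi * \<i> * of_nat n * z)) sums qser (of_int_fps G) z"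
    if "z \<in> uhp" for z
    using qser_sums[OF G(1), of z] that by (simp add: exp_eq_qexp_power)
  ultimately show "F \<in> Mk (4 * m)" unfolding Mk_def by blast
qed

lemma sum_pad:
  fixes c :: "nat \<Rightarrow> 'a::comm_ring_1" and E :: "nat \<Rightarrow> 'a fps"
  assumes "n \<le> k"
  shows "(\<Sum>i\<le>n. fps_const (c i) * E i) = (\<Sum>i\<le>k. fps_const (if i \<le> n then c i else 0) * E i)"
  using assms by (intro sum.mono_neutral_cong_left) auto

lemma M_eq_span: "M = {(\<Sum>i\<le>n. fps_const (c i) * r ^ i) | n c. True}"
proof (intro equalityI subsetI)
  fix F assume "F \<in> {(\<Sum>i\<le>n. fps_const (c i) * r ^ i) | n c. True}"
  then obtain n c where "F = (\<Sum>i\<le>n. fps_const (c i) * r ^ i)" by blast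
  \<comment> \<open>Degree n fits into weight \<open>4 * n\<close>, whose basis reaches degree
    \<open>2 * n\<close>.\<close>
  then have "F = (\<Sum>i\<le>2 * n. fps_const (if i \<le> n then c i else 0) * r ^ i)"
    using sum_pad[of n "2 * n" c "\<lambda>i. r ^ i"] by simp
  then have "F \<in> Mk (4 * n)" unfolding Mk_eq_span mem_Collect_eq by (intro exI conjI TrueI)
  then show "F \<in> M" unfolding M_def by blast
qed (auto simp: M_def Mk_eq_span)

lemma M_add: "F \<in> M \<Longrightarrow> G \<in> M \<Longrightarrow> F + G \<in> M"
proof -
  assume "F \<in> M" "G \<in> M"
  then obtain n c n' c' where F: "F = (\<Sum>i\<le>n. fps_const (c i) * r ^ i)" and G: "G = (\<Sum>i\<le>n'. fps_const (c' i) * r ^ i)"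
    unfolding M_eq_span by blast
  have "F + G = (\<Sum>i\<le>max n n'. fps_const ((if i \<le> n then c i else 0) + (if i \<le> n' then c' i else 0)) * r ^ i)"
    unfolding F G sum_pad[OF max.cobounded1[of n n'], of c "\<lambda>i. r ^ i"] sum_pad[OF max.cobounded2[of n' n], of c' "\<lambda>i. r ^ i"]
    by (simp only: sum.distrib[symmetric] distrib_right[symmetric] fps_const_add)
  then show ?thesis unfolding M_eq_span mem_Collect_eq by (intro exI conjI TrueI)
qed

lemma M_monomial: "fps_const a * r ^ i \<in> M"
proof -
  have "fps_const a * r ^ i = (\<Sum>j\<le>i. fps_const (if j = i then a else 0) * r ^ j)"
    by (subst sum.mono_neutral_right[where S = "{i}"]) auto
  then show ?thesis unfolding M_eq_span mem_Collect_eq by (intro exI conjI TrueI)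
qed

lemma M_sum: "(\<And>k. k \<in> I \<Longrightarrow> F k \<in> M) \<Longrightarrow> (\<Sum>k\<in>I. F k) \<in> M"
proof (induction I rule: infinite_finite_induct)
  case (insert k I)
  then show ?case by (simp add: M_add)
qed (use M_monomial[of 0 0] in auto)

lemma odd_basis_nth_even: "even n \<Longrightarrow> fps_nth (fps_const a * (r ^ (2 * k) * (r\<^sup>2 + r))) n = 0"
  using fps_even_mult_odd[of "r ^ (2 * k)" "r\<^sup>2 + r" n] r_even_power_nth_odd r_square_plus_r_nth_even by simp

text \<open>Over \<open>bit\<close>, r^(2 k + 1) = r^(2 k) (r^2 + r) + r^(2 k + 2). So a polynomial
  in r is an odd series U from the span plus a polynomial V in r^2, which has only even exponents;
  for an odd series V vanishes.\<close>

lemma M_odd_eq_span: "M_odd = {(\<Sum>k\<le>n. fps_const (c k) * (r ^ (2 * k) * (r\<^sup>2 + r))) | n c. True}"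
proof (intro equalityI subsetI)
  fix F assume "F \<in> M_odd"
  then have odd: "\<And>n. even n \<Longrightarrow> fps_nth F n = 0" and "F \<in> M" by (auto simp: M_odd_def)
  from \<open>F \<in> M\<close> obtain n c where F: "F = (\<Sum>i\<le>n. fps_const (c i) * r ^ i)" unfolding M_eq_span by blast
  define c' where "c' = (\<lambda>i. if i \<le> n then c i else 0)"
  define U where "U = (\<Sum>k\<le>n. fps_const (c' (2 * k + 1)) * (r ^ (2 * k) * (r\<^sup>2 + r)))"
  define V where "V = (\<Sum>k\<le>n. fps_const (c' (2 * k)) * r ^ (2 * k) + fps_const (c' (2 * k + 1)) * r ^ (2 * (k + 1)))"
  \<comment> \<open>Padding up to \<open>2 * n + 1\<close> pairs each even power with the next odd
    one.\<close>
  have pairs: "(\<Sum>i\<le>2 * n + 1. g i) = (\<Sum>k\<le>n. g (2 * k) + g (2 * k + 1))" for g :: "nat \<Rightarrow> bit fps"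
    by (induction n) (simp_all add: add.assoc)
  have split: "fps_const a * r ^ (2 * k) + fps_const b * r ^ (2 * k + 1) =
      fps_const b * (r ^ (2 * k) * (r\<^sup>2 + r)) + (fps_const a * r ^ (2 * k) + fps_const b * r ^ (2 * (k + 1)))" for a b k
  proof -
    have "fps_const b * (r ^ (2 * k) * (r\<^sup>2 + r)) + (fps_const a * r ^ (2 * k) + fps_const b * r ^ (2 * (k + 1))) =
      (fps_const b * r ^ (2 * k + 2) + fps_const b * r ^ (2 * k + 2)) + (fps_const a * r ^ (2 * k) + fps_const b * r ^ (2 * k + 1))"
      by (simp add: power_add power2_eq_square algebra_simps)
    then show ?thesis unfolding fps_bit_double by simp
  qed
  have "F = (\<Sum>i\<le>2 * n + 1. fps_const (c' i) * r ^ i)"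
    unfolding F c'_def by (rule sum_pad) simp
  also have "\<dots> = U + V"
    unfolding pairs split U_def V_def sum.distrib ..
  finally have FOE: "F = U + V" .
  have "fps_nth V i = 0" for i
  proof (cases "even i")
    case True
    then have "fps_nth U i = 0" unfolding U_def fps_sum_nth by (intro sum.neutral ballI odd_basis_nth_even)
    with odd[OF True] FOE show ?thesis by simp
  next
    case False
    then show ?thesis unfolding V_def fps_sum_nth
      using r_even_power_nth_odd[OF False] by (intro sum.neutral ballI) (simp only: fps_add_nth fps_mult_left_const_nth mult_zero_right add_0)
  qed
  then have "F = U" unfolding FOE by (simp add: fps_eq_iff)
  then show "F \<in> {(\<Sum>k\<le>n. fps_const (c k) * (r ^ (2 * k) * (r\<^sup>2 + r))) | n c. True}"
    unfolding U_def mem_Collect_eq by (intro exI conjI TrueI)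
next
  fix F assume "F \<in> {(\<Sum>k\<le>n. fps_const (c k) * (r ^ (2 * k) * (r\<^sup>2 + r))) | n c. True}"
  then obtain n c where F: "F = (\<Sum>k\<le>n. fps_const (c k) * (r ^ (2 * k) * (r\<^sup>2 + r)))" by blast
  have "fps_const a * (r ^ (2 * k) * (r\<^sup>2 + r)) = fps_const a * r ^ (2 * k + 2) + fps_const a * r ^ (2 * k + 1)" for a k
    by (simp add: power_add power2_eq_square algebra_simps)
  then have "F \<in> M" unfolding F by (intro M_sum) (simp only: M_add M_monomial)
  moreover have "fps_nth F i = 0" if "even i" for i
    unfolding F fps_sum_nth using that by (intro sum.neutral ballI odd_basis_nth_even)
  ultimately show "F \<in> M_odd" by (simp add: M_odd_def)
qed

theorem theorem1p11:
  shows "(\<forall>m::nat.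
            Mk (4 * m) = {(\<Sum>i\<le>2 * m. fps_const (c i) * r ^ i) | c. True} \<and>
            (\<forall>c. (\<Sum>i\<le>2 * m. fps_const (c i) * r ^ i) = 0 \<longrightarrow> (\<forall>i\<le>2 * m. c i = 0)))
       \<and> M = {(\<Sum>i\<le>n. fps_const (c i) * r ^ i) | n c. True}
       \<and> M_odd = {(\<Sum>k\<le>n. fps_const (c k) * (r ^ (2 * k) * (r\<^sup>2 + r))) | n c. True}
       \<and> (\<forall>n c. (\<Sum>k\<le>n. fps_const (c k) * (r ^ (2 * k) * (r\<^sup>2 + r))) = 0 \<longrightarrow> (\<forall>k\<le>n. c k = 0))"
proof (intro conjI allI impI)
  show "Mk (4 * m) = {(\<Sum>i\<le>2 * m. fps_const (c i) * r ^ i) | c. True}" for m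
    by (rule Mk_eq_span)
  show "c i = 0" if "(\<Sum>i\<le>2 * m. fps_const (c i) * r ^ i) = 0" "i \<le> 2 * m" for m c i
    using that by (rule r_powers_independent)
  show "M = {(\<Sum>i\<le>n. fps_const (c i) * r ^ i) | n c. True}"
    by (rule M_eq_span)
  show "M_odd = {(\<Sum>k\<le>n. fps_const (c k) * (r ^ (2 * k) * (r\<^sup>2 + r))) | n c. True}"
    by (rule M_odd_eq_span)
  show "c k = 0" if "(\<Sum>k\<le>n. fps_const (c k) * (r ^ (2 * k) * (r\<^sup>2 + r))) = 0" "k \<le> n" for n c k
    using that by (rule r_odd_basis_independent)
qed

end
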